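(* Let $\mathbb F$ be a perfect field of characteristic $p>0$ and let $L$ be a nilpotent Lie algebra of dimension at most $4$ over $\mathbb F$, given by one of the presentations below. Then the equivalence classes of the $[p]$-nilpotent $[p]$-maps on $L$ are as follows: in each case every $[p]$-nilpotent $[p]$-map on $L$ is equivalent to one in the relevant list, and different items of the same list are inequivalent. Within a parametrized family, maps with different parameters are equivalent exactly as stated; a family's maps are inequivalent to those in other items. **(1/1)** $L=\langle x_1\rangle$: (a) $x_1^{[p]}=0$. **(2/1)** $L=\langle x_1,x_2\rangle$ abelian: (a) $x_1^{[p]}=x_2^{[p]}=0$; (b) $x_1^{[p]}=x_2$, $x_2^{[p]}=0$. **(3/1)** $L=\langle x_1,x_2,x_3\rangle$ abelian: (a) $x_1^{[p]}=x_2^{[p]}=x_3^{[p]}=0$; (b) $x_1^{[p]}=x_2$, $x_2^{[p]}=x_3^{[p]}=0$; (c) $x_1^{[p]}=x_2$, $x_2^{[p]}=x_3$, $x_3^{[p]}=0$. **(3/2)** $L=\langle x_1,x_2,x_3\mid [x_1,x_2]=x_3\rangle$. If $p\geq 3$: (a) $x_1^{[p]}=x_2^{[p]}=x_3^{[p]}=0$; (b) $x_1^{[p]}=x_3$, $x_2^{[p]}=x_3^{[p]}=0$. If $p=2$: (a) $x_1^{[2]}=x_3$, $x_2^{[2]}=\xi x_3$, $x_3^{[2]}=0$, with $\xi\in\mathbb F$; the parameters $\xi_1$ and $\xi_2$ give equivalent $[2]$-maps if and only if $\xi_1+\xi_2\in\mathbb K$. **(4/1)** $L=\langle x_1,x_2,x_3,x_4\rangle$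 abelian: (a) $x_1^{[p]}=x_2^{[p]}=x_3^{[p]}=x_4^{[p]}=0$; (b) $x_1^{[p]}=x_2$, $x_2^{[p]}=x_3^{[p]}=x_4^{[p]}=0$; (c) $x_1^{[p]}=x_2$, $x_3^{[p]}=x_4$, $x_2^{[p]}=x_4^{[p]}=0$; (d) $x_1^{[p]}=x_2$, $x_2^{[p]}=x_3$, $x_3^{[p]}=x_4^{[p]}=0$; (e) $x_1^{[p]}=x_2$, $x_2^{[p]}=x_3$, $x_3^{[p]}=x_4$, $x_4^{[p]}=0$. **(4/2)** $L=\langle x_1,x_2,x_3,x_4\mid [x_1,x_2]=x_3\rangle$. If $p\geq 3$: (a) $x_1^{[p]}=x_2^{[p]}=x_3^{[p]}=x_4^{[p]}=0$; (b) $x_1^{[p]}=x_3$, $x_2^{[p]}=x_3^{[p]}=x_4^{[p]}=0$; (c) $x_1^{[p]}=x_4$, $x_2^{[p]}=x_3^{[p]}=x_4^{[p]}=0$; (d) $x_1^{[p]}=x_3$, $x_2^{[p]}=x_4$, $x_3^{[p]}=x_4^{[p]}=0$; (e) $x_3^{[p]}=x_4$, $x_1^{[p]}=x_2^{[p]}=x_4^{[p]}=0$; (f) $x_3^{[p]}=x_4$, $x_2^{[p]}=x_3$, $x_1^{[p]}=x_4^{[p]}=0$; (g) $x_4^{[p]}=x_3$, $x_1^{[p]}=x_2^{[p]}=x_3^{[p]}=0$; (h) $x_4^{[p]}=x_3$, $x_2^{[p]}=x_4$, $x_1^{[p]}=x_3^{[p]}=0$. If $p=2$: (a) $x_1^{[2]}=x_3$,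 $x_2^{[2]}=\xi x_3$, $x_3^{[2]}=x_4^{[2]}=0$, with $\xi\in\mathbb F$; (b) $x_1^{[2]}=x_4$, $x_2^{[2]}=x_3^{[2]}=x_4^{[2]}=0$; (c) $x_1^{[2]}=x_3$, $x_2^{[2]}=x_4$, $x_3^{[2]}=x_4^{[2]}=0$; (d) $x_3^{[2]}=x_4$, $x_1^{[2]}=x_3$, $x_2^{[2]}=\xi x_3$, $x_4^{[2]}=0$, with $\xi\in\mathbb F$; (e) $x_4^{[2]}=x_3$, $x_1^{[2]}=x_2^{[2]}=x_3^{[2]}=0$; (f) $x_4^{[2]}=x_3$, $x_2^{[2]}=x_4$, $x_1^{[2]}=x_3^{[2]}=0$. In each of the cases (a) and (d), the parameters $\xi_1,\xi_2$ give equivalent $[2]$-maps if and only if $\xi_1+\xi_2\in\mathbb K$. **(4/3)** $L=\langle x_1,x_2,x_3,x_4\mid [x_1,x_2]=x_3,\ [x_1,x_3]=x_4\rangle$. If $p\geq 5$: (a) $x_1^{[p]}=x_2^{[p]}=x_3^{[p]}=x_4^{[p]}=0$; (b) $x_1^{[p]}=x_4$, $x_2^{[p]}=x_3^{[p]}=x_4^{[p]}=0$; (c) $x_2^{[p]}=\xi x_4$, $x_1^{[p]}=x_3^{[p]}=x_4^{[p]}=0$, with $\xi\in\mathbb F^*$; the parameters $\xi_1$ and $\xi_2$ give isomorphic restricted Lie algebras (equivalently, equivalent $[p]$-maps) if and only if $\xi_1\xi_2^{-1}$ is a square in $\mathbb F$; (d) $x_3^{[p]}=x_4$, $x_1^{[p]}=x_2^{[p]}=x_4^{[p]}=0$.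 If $p=3$: (a) $x_1^{[3]}=x_2^{[3]}=x_3^{[3]}=x_4^{[3]}=0$; (b) $x_3^{[3]}=x_4$, $x_1^{[3]}=x_2^{[3]}=x_4^{[3]}=0$; (c) $x_1^{[3]}=\alpha x_4$, $x_2^{[3]}=\beta x_4$, $x_3^{[3]}=x_4^{[3]}=0$, with $\alpha\in\mathbb F$, $\beta\in\mathbb F^*$; the pairs $(\alpha_1,\beta_1)$ and $(\alpha_2,\beta_2)$ give equivalent $[3]$-maps if and only if $\beta_2/\beta_1$ is a square in $\mathbb F$ and at least one of $\alpha_1+\alpha_2\sqrt{\beta_2/\beta_1}$, $\alpha_1-\alpha_2\sqrt{\beta_2/\beta_1}$ lies in $\mathbb K_{\beta_1}$. If $p=2$, then $L$ is not restrictable.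
   Context: In each presentation the $x_i$ form a basis of $L$ over $\mathbb F$, and all brackets $[x_i,x_j]$ with $i<j$ that are not listed are zero. The listed presentations are, up to isomorphism, all the nilpotent Lie algebras of dimension $1,2,3,4$ over $\mathbb F$ (a known fact that is used as the starting point). Let $L$ be a Lie algebra over a field $\mathbb F$ of characteristic $p>0$. A $[p]$-map on $L$ is a map $L\to L$, $x\mapsto x^{[p]}$, such that for all $a,b\in L$ and $\alpha\in\mathbb F$: 1. $(\mathrm{ad}\, a)^p=\mathrm{ad}(a^{[p]})$; 2. $(\alpha a)^{[p]}=\alpha^p a^{[p]}$; 3. $(a+b)^{[p]}=a^{[p]}+b^{[p]}+\sum_{i=1}^{p-1}s_i(a,b)$, where the $s_i(a,b)\in L$ are given by $$\bigl(\mathrm{ad}(a\otimes X+b\otimes 1)\bigr)^{p-1}(a\otimes 1)=\sum_{i=1}^{p-1} i\,s_i(a,b)\otimes X^{i-1}$$ in the Lie algebra $L\otimes\mathbb F[X]$ over the polynomial ring $\mathbb F[X]$. $L$ is restrictable if it admits a $[p]$-map; a Lie algebra with a given $[p]$-map is called a restricted Lie algebra. A $[p]$-map on $L$ is determined by its values on a basis, so a $[p]$-map is specified by the values $x_i^{[p]}$. A $[p]$-map (or the restricted Lie algebra it defines) is $[p]$-nilpotent if there is an integer $n$ such that the $n$-fold iterate of $x\mapsto x^{[p]}$ sends every element of $L$ to $0$. Two $[p]$-maps $\varphi_1,\varphi_2$ on $L$ are equivalent if there is a Lie algebra automorphism $A$ of $L$ such that, with maps written on the right, $x\varphi_1A=xA\varphi_2$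 for all $x\in L$; that is, $\varphi_1$ and $\varphi_2$ are conjugate under $\mathrm{Aut}(L)$, or equivalently, the restricted Lie algebras $(L,\varphi_1)$ and $(L,\varphi_2)$ are isomorphic. If $\mathrm{char}\,\mathbb F=2$, then $\mathbb K=\{\delta+\delta^2\mid\delta\in\mathbb F\}$ (the Artin–Schreier subspace). If $\mathrm{char}\,\mathbb F=3$ and $\beta\in\mathbb F^*$, then $\mathbb K_\beta=\{\beta\delta^3+\delta\mid\delta\in\mathbb F\}$. $\mathbb F^*$ denotes the set of nonzero elements of $\mathbb F$, and $\sqrt{\beta_2/\beta_1}$ is either of the square roots of $\beta_2/\beta_1$ in $\mathbb F$. *)

theory Defs
  imports
    "HOL-Computational_Algebra.Polynomial"
    "HOL-Computational_Algebra.Primes"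
    "HOL-Computational_Algebra.Nth_Powers"
begin

text \<open>The Lie algebra is the whole type \<open>'l\<close>.\<close>

locale lie_algebra = vector_space scale
  for scale :: "'f::field \<Rightarrow> 'l::ab_group_add \<Rightarrow> 'l" (infixr "*s" 75) +
  fixes br :: "'l \<Rightarrow> 'l \<Rightarrow> 'l"
  assumes br_add_left: "br (a + b) c = br a c + br b c"
    and br_add_right: "br a (b + c) = br a b + br a c"
    and br_scale_left: "br (\<alpha> *s a) b = \<alpha> *s br a b"
    and br_scale_right: "br a (\<alpha> *s b) = \<alpha> *s br a b"
    and br_self: "br a a = 0"
    and jacobi: "br a (br b c) + br b (br c a) + br c (br a b) = 0"

definition lie_automorphism ::
    "('f::field \<Rightarrow> 'l::ab_group_add \<Rightarrow> 'l) \<Rightarrow> ('l \<Rightarrow> 'l \<Rightarrow> 'l) \<Rightarrow> ('l \<Rightarrow> 'l) \<Rightarrow> bool" where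
  "lie_automorphism scale br A \<longleftrightarrow>
     Vector_Spaces.linear scale scale A \<and> bij A \<and> (\<forall>a b. A (br a b) = br (A a) (A b))"

definition is_basis :: "('f::field \<Rightarrow> 'l::ab_group_add \<Rightarrow> 'l) \<Rightarrow> 'l list \<Rightarrow> bool" where
  "is_basis scale xs \<longleftrightarrow>
     distinct xs \<and> \<not> module.dependent scale (set xs) \<and> module.span scale (set xs) = UNIV"

text \<open>The association list \<open>rels\<close> contains \<open>((x\<^sub>i, x\<^sub>j), [x\<^sub>i, x\<^sub>j])\<close> for the brackets listed in
  a presentation, with \<open>i < j\<close>.\<close>

definition has_presentation ::
    "('f::field \<Rightarrow> 'l::ab_group_add \<Rightarrow> 'l) \<Rightarrow> ('l \<Rightarrow> 'l \<Rightarrow> 'l) \<Rightarrow> 'l list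
      \<Rightarrow> (('l \<times> 'l) \<times> 'l) list \<Rightarrow> bool" where
  "has_presentation scale br xs rels \<longleftrightarrow>
     is_basis scale xs \<and>
     (\<forall>i j. i < j \<and> j < length xs \<longrightarrow>
        br (xs ! i) (xs ! j) =
          (case map_of rels (xs ! i, xs ! j) of None \<Rightarrow> 0 | Some z \<Rightarrow> z))"

text \<open>The type \<open>'l poly\<close> of polynomials with coefficients in \<open>L\<close> represents \<open>L \<otimes> \<bbbF>[X]\<close>, where
  \<open>monom a i\<close> stands for \<open>a \<otimes> X\<^sup>i\<close>. The bracket is
  \<open>[a \<otimes> X\<^sup>i, b \<otimes> X\<^sup>j] = [a, b] \<otimes> X\<^sup>i\<^sup>+\<^sup>j\<close>, extended biadditively.\<close>

definition poly_br ::
    "('l::ab_group_add \<Rightarrow> 'l \<Rightarrow> 'l) \<Rightarrow> 'l poly \<Rightarrow> 'l poly \<Rightarrow> 'l poly" where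
  "poly_br br f g =
     (\<Sum>i\<le>degree f. \<Sum>j\<le>degree g. monom (br (coeff f i) (coeff g j)) (i + j))"

text \<open>The elements \<open>s\<^sub>1(a,b), \<dots>, s\<^sub>p\<^sub>-\<^sub>1(a,b)\<close>; they are determined uniquely because
  \<open>1, \<dots>, p - 1\<close> are invertible in a field of characteristic \<open>p\<close>.\<close>

definition jacobson_terms ::
    "('f::field \<Rightarrow> 'l::ab_group_add \<Rightarrow> 'l) \<Rightarrow> ('l \<Rightarrow> 'l \<Rightarrow> 'l) \<Rightarrow> 'l \<Rightarrow> 'l
      \<Rightarrow> (nat \<Rightarrow> 'l) \<Rightarrow> bool" where
  "jacobson_terms scale br a b s \<longleftrightarrow>
     (poly_br br (monom a 1 + monom b 0) ^^ (CHAR('f) - 1)) (monom a 0) =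
       (\<Sum>i = 1..CHAR('f) - 1. monom (scale (of_nat i) (s i)) (i - 1))"

definition p_map ::
    "('f::field \<Rightarrow> 'l::ab_group_add \<Rightarrow> 'l) \<Rightarrow> ('l \<Rightarrow> 'l \<Rightarrow> 'l) \<Rightarrow> ('l \<Rightarrow> 'l) \<Rightarrow> bool" where
  "p_map scale br \<phi> \<longleftrightarrow>
     (\<forall>a. br a ^^ CHAR('f) = br (\<phi> a)) \<and>
     (\<forall>\<alpha> a. \<phi> (scale \<alpha> a) = scale (\<alpha> ^ CHAR('f)) (\<phi> a)) \<and>
     (\<forall>a b. \<exists>s. jacobson_terms scale br a b s \<and>
        \<phi> (a + b) = \<phi> a + \<phi> b + (\<Sum>i = 1..CHAR('f) - 1. s i))"

definition restrictable ::
    "('f::field \<Rightarrow> 'l::ab_group_add \<Rightarrow> 'l) \<Rightarrow> ('l \<Rightarrow> 'l \<Rightarrow> 'l) \<Rightarrow> bool" where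
  "restrictable scale br \<longleftrightarrow> (\<exists>\<phi>. p_map scale br \<phi>)"

definition p_nilpotent :: "('l::zero \<Rightarrow> 'l) \<Rightarrow> bool" where
  "p_nilpotent \<phi> \<longleftrightarrow> (\<exists>n. \<forall>x. (\<phi> ^^ n) x = 0)"

definition equivalent_maps ::
    "('f::field \<Rightarrow> 'l::ab_group_add \<Rightarrow> 'l) \<Rightarrow> ('l \<Rightarrow> 'l \<Rightarrow> 'l)
      \<Rightarrow> ('l \<Rightarrow> 'l) \<Rightarrow> ('l \<Rightarrow> 'l) \<Rightarrow> bool" where
  "equivalent_maps scale br \<phi>1 \<phi>2 \<longleftrightarrow>
     (\<exists>A. lie_automorphism scale br A \<and> (\<forall>x. A (\<phi>1 x) = \<phi>2 (A x)))"

text \<open>The list \<open>vs\<close> specifies \<open>\<phi>\<close> by its values on the basis \<open>xs\<close>.\<close>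

definition p_map_with_values ::
    "('f::field \<Rightarrow> 'l::ab_group_add \<Rightarrow> 'l) \<Rightarrow> ('l \<Rightarrow> 'l \<Rightarrow> 'l) \<Rightarrow> 'l list \<Rightarrow> 'l list
      \<Rightarrow> ('l \<Rightarrow> 'l) \<Rightarrow> bool" where
  "p_map_with_values scale br xs vs \<phi> \<longleftrightarrow> p_map scale br \<phi> \<and> map \<phi> xs = vs"

definition equivalent_values ::
    "('f::field \<Rightarrow> 'l::ab_group_add \<Rightarrow> 'l) \<Rightarrow> ('l \<Rightarrow> 'l \<Rightarrow> 'l) \<Rightarrow> 'l list \<Rightarrow> 'l list
      \<Rightarrow> 'l list \<Rightarrow> bool" where
  "equivalent_values scale br xs vs ws \<longleftrightarrow>
     (\<exists>\<phi> \<psi>. p_map_with_values scale br xs vs \<phi> \<and> p_map_with_values scale br xs ws \<psi> \<and>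
        equivalent_maps scale br \<phi> \<psi>)"

text \<open>Each item is the set of value lists of a family of maps (a singleton if there are no
  parameters). The conjuncts say: every value list specifies exactly one \<open>[p]\<close>-map, which is
  \<open>[p]\<close>-nilpotent; every \<open>[p]\<close>-nilpotent \<open>[p]\<close>-map is equivalent to a listed one; maps in
  different items are inequivalent. Equivalence within one family is not covered here.\<close>

definition nilpotent_p_maps_listed ::
    "('f::field \<Rightarrow> 'l::ab_group_add \<Rightarrow> 'l) \<Rightarrow> ('l \<Rightarrow> 'l \<Rightarrow> 'l) \<Rightarrow> 'l list
      \<Rightarrow> 'l list set list \<Rightarrow> bool" where
  "nilpotent_p_maps_listed scale br xs items \<longleftrightarrow>
     (\<forall>I\<in>set items. \<forall>vs\<in>I.
        (\<exists>!\<phi>. p_map_with_values scale br xs vs \<phi>) \<and>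
        (\<forall>\<phi>. p_map_with_values scale br xs vs \<phi> \<longrightarrow> p_nilpotent \<phi>)) \<and>
     (\<forall>\<phi>. p_map scale br \<phi> \<and> p_nilpotent \<phi> \<longrightarrow>
        (\<exists>I\<in>set items. \<exists>vs\<in>I. \<exists>\<psi>.
           p_map_with_values scale br xs vs \<psi> \<and> equivalent_maps scale br \<phi> \<psi>)) \<and>
     (\<forall>i<length items. \<forall>j<length items. i \<noteq> j \<longrightarrow>
        (\<forall>vs\<in>items ! i. \<forall>ws\<in>items ! j. \<not> equivalent_values scale br xs vs ws))"

definition artin_schreier :: "'f::field set" where
  "artin_schreier = {\<delta> + \<delta>\<^sup>2 | \<delta>. True}"

definition K_set :: "'f::field \<Rightarrow> 'f set" where
  "K_set \<beta> = {\<beta> * \<delta> ^ 3 + \<delta> | \<delta>. True}"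

end

theory Submission
  imports Defs
begin

text \<open>Every algebra in question is nilpotent of class at most \<open>3\<close>, and this makes Jacobson's formula
collapse. If the class is smaller than \<open>p\<close>, all the terms \<open>s\<^sub>i\<close> vanish, and a \<open>[p]\<close>-map is a
\<open>p\<close>-semilinear map with values in the centre. Only two cases escape: class \<open>2\<close> with \<open>p = 2\<close> and
class \<open>3\<close> with \<open>p = 3\<close>, where the additivity defect is \<open>[b, a]\<close> and \<open>[b, [b, a]] - [a, [b, a]]\<close>
(\<open>p_map_iff_small_class\<close>, \<open>p_map_iff_char_2\<close>, \<open>p_map_iff_char_3\<close>). In coordinates the defect is
the polarization of an explicit \<open>q\<close>, so that a \<open>[p]\<close>-map has the closed form
\<open>\<phi>(\<Sum> a\<^sub>i x\<^sub>i) = \<Sum> a\<^sub>i\<^sup>p \<phi>(x\<^sub>i) + q(a)\<close> with \<open>q\<close> one of \<open>0\<close>, \<open>a\<^sub>1 a\<^sub>2 x\<^sub>3\<close>, \<open>a\<^sub>1\<^sup>2 a\<^sub>2 x\<^sub>4\<close>,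
and the values \<open>\<phi>(x\<^sub>i)\<close> may be chosen freely in the centre (\<open>p_map_iff_formula\<close>,
\<open>p_map_with_values_exists\<close>).

Two bases with the same structure constants differ by an automorphism (\<open>automorphism_of_bases\<close>).
Hence \<open>\<phi>\<close> is equivalent to a listed map exactly if it takes the listed values on some basis
satisfying the same presentation (\<open>has_normal_form\<close>, \<open>equivalent_values_iff\<close>), and the
classification becomes a search for good bases. The field being perfect, \<open>p\<close>-th roots exist; so a
nonzero value can absorb the corresponding components of the other values by a change of
basis vectors, and a binary semilinear form has a zero (\<open>unimodular_kill_form\<close>).

For abelian \<open>L\<close> the lists are the Jordan types of a nilpotent semilinear map. For the Heisenberg
algebras one first looks at the nilpotent semilinear map induced on the centre and then at the
values of \<open>x\<^sub>1\<close> and \<open>x\<^sub>2\<close>; if \<open>p = 2\<close>, the \<open>x\<^sub>3\<close>-component is a quadratic form with the determinant as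
polar form, and its Arf invariant is the class of \<open>\<xi>\<close> modulo the Artin-Schreier subspace
(\<open>arf_invariant\<close>). For the filiform algebra the values of \<open>x\<^sub>1\<close>, \<open>x\<^sub>2\<close>, \<open>x\<^sub>3\<close> are multiples of \<open>x\<^sub>4\<close>, and their three
coefficients transform under automorphisms by explicit equations, from which the conditions on squares
and on \<open>\<bbbK>\<^sub>\<beta>\<close> can be read off.

Maps in different items are told apart by properties that equivalence preserves: which power of \<open>\<phi>\<close>
vanishes, whether \<open>\<phi>\<close> kills the centre, the brackets or the centralizer of the brackets, and how
its image lies relative to the brackets.\<close>

section \<open>Jacobson terms in nilpotent Lie algebras\<close>

context lie_algebra
begin

lemma br_zero_left [simp]: "br 0 a = 0"
  using br_add_left[of 0 0 a] by simp

lemma br_zero_right [simp]: "br a 0 = 0"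
  using br_add_right[of a 0 0] by simp

lemma br_minus_left [simp]: "br (- a) b = - br a b"
  using br_add_left[of a "- a" b] by (simp add: eq_neg_iff_add_eq_0 add.commute)

lemma br_minus_right [simp]: "br a (- b) = - br a b"
  using br_add_right[of a b "- b"] by (simp add: eq_neg_iff_add_eq_0 add.commute)

lemma br_anticommute: "br b a = - br a b"
  using br_self[of "a + b"] unfolding br_add_left br_add_right
  by (simp add: br_self eq_neg_iff_add_eq_0 add.commute)

lemma br_sum_left: "br (\<Sum>i\<in>I. f i) b = (\<Sum>i\<in>I. br (f i) b)"
  by (induction I rule: infinite_finite_induct) (simp_all add: br_add_left)

lemma br_sum_right: "br b (\<Sum>i\<in>I. f i) = (\<Sum>i\<in>I. br b (f i))"
  by (induction I rule: infinite_finite_induct) (simp_all add: br_add_right)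

lemma coeff_poly_br:
  "coeff (poly_br br f g) n = (\<Sum>i\<le>n. br (coeff f i) (coeff g (n - i)))"
proof -
  have inner: "(\<Sum>j\<le>degree g. coeff (monom (br (coeff f i) (coeff g j)) (i + j)) n) =
      (if i \<le> n then br (coeff f i) (coeff g (n - i)) else 0)" for i
  proof (cases "i \<le> n")
    case True
    have "(\<Sum>j\<le>degree g. coeff (monom (br (coeff f i) (coeff g j)) (i + j)) n) =
        (\<Sum>j\<le>degree g. if j = n - i then br (coeff f i) (coeff g j) else 0)"
      using True by (intro sum.cong) auto
    also have "\<dots> = br (coeff f i) (coeff g (n - i))"
      by (simp add: coeff_eq_0)
    finally show ?thesis
      using True by simp
  qed auto
  have "coeff (poly_br br f g) n =
      (\<Sum>i\<le>degree f. if i \<le> n then br (coeff f i) (coeff g (n - i)) else 0)"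
    by (simp only: poly_br_def coeff_sum inner)
  also have "\<dots> = (\<Sum>i\<in>{..degree f} \<inter> {..n}. br (coeff f i) (coeff g (n - i)))"
    by (subst sum.inter_restrict) auto
  also have "\<dots> = (\<Sum>i\<le>n. br (coeff f i) (coeff g (n - i)))"
    by (rule sum.mono_neutral_left) (auto intro!: le_degree)
  finally show ?thesis .
qed

lemma coeff_poly_br_linear:
  "coeff (poly_br br (monom a 1 + monom b 0) g) n =
     br b (coeff g n) + (if n = 0 then 0 else br a (coeff g (n - 1)))"
proof (cases n)
  case 0
  then show ?thesis by (simp add: coeff_poly_br)
next
  case (Suc m)
  have "(\<Sum>i\<le>m. br (coeff (monom a 1 + monom b 0) (Suc i)) (coeff g (m - i))) =
     (\<Sum>i\<le>m. if i = 0 then br a (coeff g m) else 0)"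
    by (rule sum.cong) auto
  moreover have "coeff (poly_br br (monom a 1 + monom b 0) g) (Suc m) =
      br b (coeff g (Suc m)) +
      (\<Sum>i\<le>m. br (coeff (monom a 1 + monom b 0) (Suc i)) (coeff g (m - i)))"
    unfolding coeff_poly_br sum.atMost_Suc_shift by simp
  ultimately show ?thesis
    using Suc by simp
qed

text \<open>The upper central series: \<open>upper_central k\<close> consists of the elements that vanish under any \<open>k\<close>
successive brackets from the left, so that \<open>upper_central k = UNIV\<close> says that the nilpotency class
is at most \<open>k\<close>.\<close>

primrec upper_central :: "nat \<Rightarrow> 'l set" where
  "upper_central 0 = {0}"
| "upper_central (Suc k) = {x. \<forall>a. br a x \<in> upper_central k}"

lemma upper_central_add: "x \<in> upper_central k \<Longrightarrow> y \<in> upper_central k \<Longrightarrow> x + y \<in> upper_central k"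
  by (induction k arbitrary: x y) (simp_all add: br_add_right)

lemma ad_pow_upper_central: "x \<in> upper_central k \<Longrightarrow> (br a ^^ k) x = 0"
  by (induction k arbitrary: x) (simp_all add: funpow_Suc_right del: funpow.simps)

text \<open>Each bracket with \<open>a X + b\<close> pushes all coefficients one step down the upper central series.\<close>

lemma iterated_poly_br_upper_central:
  assumes "\<And>n. coeff g n \<in> upper_central k"
  shows "(poly_br br (monom a 1 + monom b 0) ^^ k) g = 0"
  using assms
proof (induction k arbitrary: g)
  case 0
  then show ?case by (simp add: poly_eq_iff)
next
  case (Suc k)
  have "(poly_br br (monom a 1 + monom b 0) ^^ k) (poly_br br (monom a 1 + monom b 0) g) = 0"
    using Suc.prems
    by (intro Suc.IH) (auto simp: coeff_poly_br_linear upper_central_add simp del: One_nat_def)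
  then show ?case by (simp add: funpow_Suc_right del: funpow.simps)
qed

lemma jacobson_terms_iff_coeff:
  "jacobson_terms scale br a b s \<longleftrightarrow>
     (\<forall>n. coeff ((poly_br br (monom a 1 + monom b 0) ^^ (CHAR('f) - 1)) (monom a 0)) n =
        (if Suc n < CHAR('f) then of_nat (Suc n) *s s (Suc n) else 0))"
proof -
  have "coeff (\<Sum>i = 1..CHAR('f) - 1. monom (of_nat i *s s i) (i - 1)) n =
      (if Suc n < CHAR('f) then of_nat (Suc n) *s s (Suc n) else 0)" for n
  proof -
    have "coeff (\<Sum>i = 1..CHAR('f) - 1. monom (of_nat i *s s i) (i - 1)) n =
       (\<Sum>i = 1..CHAR('f) - 1. if i = Suc n then of_nat i *s s i else 0)"
      unfolding coeff_sum by (rule sum.cong) auto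
    also have "\<dots> = (if Suc n < CHAR('f) then of_nat (Suc n) *s s (Suc n) else 0)"
      by (subst sum.delta) auto
    finally show ?thesis .
  qed
  then show ?thesis
    unfolding jacobson_terms_def poly_eq_iff by (simp only:)
qed

text \<open>The scalars \<open>1, \<dots>, p - 1\<close> are invertible, so the coefficients of the defining polynomial determine the
terms \<open>s\<^sub>i\<close>.\<close>

lemma jacobson_terms_unique:
  assumes "jacobson_terms scale br a b s" "jacobson_terms scale br a b t"
  shows "(\<Sum>i = 1..CHAR('f) - 1. s i) = (\<Sum>i = 1..CHAR('f) - 1. t i)"
proof (rule sum.cong)
  fix i assume i: "i \<in> {1..CHAR('f) - 1}"
  then obtain n where n: "i = Suc n" "Suc n < CHAR('f)" by (cases i) auto
  have "of_nat i *s s i = of_nat i *s t i"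
    using assms n unfolding jacobson_terms_iff_coeff by (metis (full_types))
  moreover have "(of_nat i :: 'f) \<noteq> 0"
    using n by (simp add: of_nat_eq_0_iff_char_dvd nat_dvd_not_less del: of_nat_Suc)
  ultimately show "s i = t i" by (simp only: scale_left_imp_eq scale_cancel_left) simp
qed simp

lemma jacobson_terms_automorphism:
  assumes A: "lie_automorphism scale br A" and s: "jacobson_terms scale br a b s"
  shows "jacobson_terms scale br (A a) (A b) (\<lambda>i. A (s i))"
proof -
  interpret A: Vector_Spaces.linear scale scale A
    using A by (simp add: lie_automorphism_def)
  have A_br: "A (br x y) = br (A x) (A y)" for x y
    using A by (simp add: lie_automorphism_def)
  have "coeff ((poly_br br (monom (A a) 1 + monom (A b) 0) ^^ k) (monom (A a) 0)) n =
      A (coeff ((poly_br br (monom a 1 + monom b 0) ^^ k) (monom a 0)) n)" for k n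
  proof (induction k arbitrary: n)
    case 0
    show ?case by (simp add: A.zero)
  next
    case (Suc k)
    then show ?case
      by (simp add: coeff_poly_br_linear A.add A_br A.zero del: One_nat_def)
  qed
  then show ?thesis
    using s by (simp add: jacobson_terms_iff_coeff A.scale A.zero del: of_nat_Suc One_nat_def)
qed

lemma lie_automorphism_inv:
  assumes "lie_automorphism scale br A"
  shows "lie_automorphism scale br (inv A)"
proof -
  interpret A: Vector_Spaces.linear scale scale A
    using assms by (simp add: lie_automorphism_def)
  have bij: "bij A" and A_br: "A (br x y) = br (A x) (A y)" for x y
    using assms by (auto simp: lie_automorphism_def)
  have A_inv: "A (inv A x) = x" for x
    using bij by (simp add: bij_is_surj surj_f_inv_f)
  have inv_eq: "inv A x = y \<longleftrightarrow> x = A y" for x y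
    using bij by (metis A_inv bij_is_inj injD)
  have "Vector_Spaces.linear scale scale (inv A)"
    by unfold_locales (simp_all add: inv_eq A.add A.scale A_inv)
  then show ?thesis
    by (simp add: lie_automorphism_def inv_eq A_br A_inv bij bij_imp_bij_inv)
qed

lemma p_map_conjugate:
  assumes A: "lie_automorphism scale br A" and \<phi>: "p_map scale br \<phi>"
  shows "p_map scale br (\<lambda>x. inv A (\<phi> (A x)))"
proof -
  have A': "lie_automorphism scale br (inv A)"
    by (rule lie_automorphism_inv[OF A])
  interpret A: Vector_Spaces.linear scale scale A
    using A by (simp add: lie_automorphism_def)
  interpret A': Vector_Spaces.linear scale scale "inv A"
    using A' by (simp add: lie_automorphism_def)
  have bij: "bij A" and A_br: "A (br x y) = br (A x) (A y)" for x y
    using A by (auto simp: lie_automorphism_def)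
  have A_inv [simp]: "A (inv A x) = x" and inv_A [simp]: "inv A (A x) = x" for x
    using bij by (simp_all add: bij_is_surj surj_f_inv_f bij_is_inj)
  have "A ((br a ^^ k) x) = (br (A a) ^^ k) (A x)" for a k x
    by (induction k) (simp_all add: A_br)
  moreover have "br (A a) ^^ CHAR('f) = br (\<phi> (A a))" for a
    using \<phi> by (simp add: p_map_def)
  ultimately have "A ((br a ^^ CHAR('f)) x) = A (br (inv A (\<phi> (A a))) x)" for a x
    by (simp only: A_br A_inv)
  then have "br a ^^ CHAR('f) = br (inv A (\<phi> (A a)))" for a
    using bij by (metis bij_is_inj ext injD)
  moreover have "inv A (\<phi> (A (\<alpha> *s a))) = \<alpha> ^ CHAR('f) *s inv A (\<phi> (A a))" for \<alpha> a
    using \<phi> by (simp add: p_map_def A.scale A'.scale)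
  moreover have "\<exists>s. jacobson_terms scale br a b s \<and>
      inv A (\<phi> (A (a + b))) = inv A (\<phi> (A a)) + inv A (\<phi> (A b)) + (\<Sum>i = 1..CHAR('f) - 1. s i)" for a b
  proof -
    obtain s where s: "jacobson_terms scale br (A a) (A b) s"
      and eq: "\<phi> (A a + A b) = \<phi> (A a) + \<phi> (A b) + (\<Sum>i = 1..CHAR('f) - 1. s i)"
      using \<phi> unfolding p_map_def by blast
    have "jacobson_terms scale br a b (\<lambda>i. inv A (s i))"
      using jacobson_terms_automorphism[OF A' s] by simp
    then show ?thesis
      using eq by (auto simp: A.add A'.add A'.sum)
  qed
  ultimately show ?thesis
    unfolding p_map_def by blast
qed

end

section \<open>\<open>[p]\<close>-maps over perfect fields\<close>

locale perfect_lie_algebra = lie_algebra scale br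
  for scale :: "'f::field \<Rightarrow> 'l::ab_group_add \<Rightarrow> 'l" (infixr "*s" 75) and br +
  fixes p :: nat
  assumes p_eq_CHAR: "p = CHAR('f)" and p_pos: "p > 0"
    and perfect: "\<And>a::'f. \<exists>b. b ^ p = a"
begin

lemma prime_p: "prime p"
  using p_pos p_eq_CHAR prime_CHAR_semidom[where 'a = 'f] by simp

lemma zero_power_p [simp]: "(0::'f) ^ p = 0"
  using p_pos by simp

lemma frobenius_add: "((a::'f) + b) ^ p = a ^ p + b ^ p"
  using prime_p freshmans_dream[of p a b] by (simp add: p_eq_CHAR)

lemma frobenius_minus: "(- a::'f) ^ p = - (a ^ p)"
  using frobenius_add[of a "- a"] p_pos by (simp add: eq_neg_iff_add_eq_0 add.commute power_0_left)

lemma p_map_scale: "p_map scale br \<phi> \<Longrightarrow> \<phi> (\<alpha> *s a) = \<alpha> ^ p *s \<phi> a"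
  by (simp add: p_map_def p_eq_CHAR)

lemma p_map_zero: "p_map scale br \<phi> \<Longrightarrow> \<phi> 0 = 0"
  using p_map_scale[of \<phi> 0 0] p_pos by (simp add: power_0_left)

text \<open>The Jacobson terms are functions of the arguments alone, so the set where two \<open>[p]\<close>-maps agree is
closed under linear combinations.\<close>

lemma p_map_eqI:
  assumes \<phi>: "p_map scale br \<phi>" and \<psi>: "p_map scale br \<psi>"
    and eq: "\<And>x. x \<in> B \<Longrightarrow> \<phi> x = \<psi> x" and B: "span B = UNIV"
  shows "\<phi> = \<psi>"
proof
  fix x
  have "x \<in> span B" using B by simp
  then show "\<phi> x = \<psi> x"
  proof (induction rule: span_induct_alt)
    case base
    show ?case using \<phi> \<psi> by (simp add: p_map_zero)
  next
    case (step c x y)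
    obtain s where s: "jacobson_terms scale br (c *s x) y s"
      "\<phi> (c *s x + y) = \<phi> (c *s x) + \<phi> y + (\<Sum>i = 1..CHAR('f) - 1. s i)"
      using \<phi> unfolding p_map_def by blast
    obtain t where t: "jacobson_terms scale br (c *s x) y t"
      "\<psi> (c *s x + y) = \<psi> (c *s x) + \<psi> y + (\<Sum>i = 1..CHAR('f) - 1. t i)"
      using \<psi> unfolding p_map_def by blast
    show ?case
      unfolding s(2) t(2) jacobson_terms_unique[OF s(1) t(1)]
      using step eq \<phi> \<psi> by (simp add: p_map_scale)
  qed
qed

text \<open>The \<open>[p]\<close>-maps of nilpotent algebras of small class have central values and fail to be additive by
a known function \<open>c\<close>, the sum of the Jacobson terms.\<close>

definition central_p_map :: "('l \<Rightarrow> 'l \<Rightarrow> 'l) \<Rightarrow> ('l \<Rightarrow> 'l) \<Rightarrow> bool" where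
  "central_p_map c \<phi> \<longleftrightarrow>
     (\<forall>a b. br (\<phi> a) b = 0) \<and>
     (\<forall>\<alpha> a. \<phi> (\<alpha> *s a) = \<alpha> ^ p *s \<phi> a) \<and>
     (\<forall>a b. \<phi> (a + b) = \<phi> a + \<phi> b + c a b)"

text \<open>If \<open>(ad a)\<^sup>p = 0\<close>, the first axiom of a \<open>[p]\<close>-map says that its values are central.\<close>

lemma p_map_iff_central_p_map:
  assumes nilp: "upper_central p = UNIV"
    and c: "\<And>a b. \<exists>s. jacobson_terms scale br a b s \<and> (\<Sum>i = 1..CHAR('f) - 1. s i) = c a b"
  shows "p_map scale br \<phi> \<longleftrightarrow> central_p_map c \<phi>"
proof -
  have "br a ^^ p = (\<lambda>_. 0)" for a
    using ad_pow_upper_central[of _ p a] nilp by auto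
  then have ad: "br a ^^ CHAR('f) = br (\<phi> a) \<longleftrightarrow> (\<forall>b. br (\<phi> a) b = 0)" for a
    using p_eq_CHAR by (auto simp: fun_eq_iff)
  have add: "(\<exists>s. jacobson_terms scale br a b s \<and>
        \<phi> (a + b) = \<phi> a + \<phi> b + (\<Sum>i = 1..CHAR('f) - 1. s i)) \<longleftrightarrow>
      \<phi> (a + b) = \<phi> a + \<phi> b + c a b" for a b
    using c[of a b] jacobson_terms_unique[of a b] by metis
  show ?thesis
    unfolding p_map_def central_p_map_def ad add using p_eq_CHAR by simp
qed

text \<open>The Jacobson terms are sums of \<open>(p - 1)\<close>-fold brackets and vanish if the class is below \<open>p\<close>.\<close>

lemma p_map_iff_small_class:
  assumes nilp: "upper_central (p - 1) = UNIV"
  shows "p_map scale br \<phi> \<longleftrightarrow> central_p_map (\<lambda>_ _. 0) \<phi>"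
proof (rule p_map_iff_central_p_map)
  have "upper_central (Suc (p - 1)) = UNIV" using nilp by simp
  then show "upper_central p = UNIV" using p_pos by simp
next
  fix a b
  have "jacobson_terms scale br a b (\<lambda>_. 0)"
    using iterated_poly_br_upper_central[of "monom a 0" "p - 1" a b] nilp p_eq_CHAR
    by (simp add: jacobson_terms_iff_coeff)
  then show "\<exists>s. jacobson_terms scale br a b s \<and> (\<Sum>i = 1..CHAR('f) - 1. s i) = 0"
    by auto
qed

lemma p_map_iff_char_2:
  assumes p: "p = 2" and nilp: "upper_central 2 = UNIV"
  shows "p_map scale br \<phi> \<longleftrightarrow> central_p_map (\<lambda>a b. br b a) \<phi>"
proof (rule p_map_iff_central_p_map)
  show "upper_central p = UNIV" using nilp p by simp
next
  fix a b
  have "jacobson_terms scale br a b (\<lambda>_. br b a)"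
    using p p_eq_CHAR
    by (auto simp: jacobson_terms_iff_coeff coeff_poly_br_linear br_self simp del: One_nat_def)
  then show "\<exists>s. jacobson_terms scale br a b s \<and> (\<Sum>i = 1..CHAR('f) - 1. s i) = br b a"
    using p p_eq_CHAR by (intro exI[of _ "\<lambda>_. br b a"]) simp
qed

lemma p_map_iff_char_3:
  assumes p: "p = 3" and nilp: "upper_central 3 = UNIV"
  shows "p_map scale br \<phi> \<longleftrightarrow> central_p_map (\<lambda>a b. br b (br b a) - br a (br b a)) \<phi>"
proof (rule p_map_iff_central_p_map)
  show "upper_central p = UNIV" using nilp p by simp
next
  fix a b
  \<comment> \<open>The second Jacobson term is half of \<open>[a, [b, a]]\<close>, and \<open>1/2 = -1\<close> in characteristic \<open>3\<close>.\<close>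
  let ?s = "\<lambda>i::nat. if i = 1 then br b (br b a) else - br a (br b a)"
  have three: "(3::'f) = 0"
    by (metis of_nat_CHAR of_nat_numeral p p_eq_CHAR)
  have "(2::'f) = - 1"
    using three by (simp add: eq_neg_iff_add_eq_0)
  then have two: "2 *s x = - x" for x
    by (simp only: scale_minus_left scale_one)
  have "jacobson_terms scale br a b ?s"
    unfolding jacobson_terms_iff_coeff
  proof
    fix n :: nat
    have char: "CHAR('f) = 3"
      using p p_eq_CHAR by simp
    have "(poly_br br (monom a 1 + monom b 0) ^^ (CHAR('f) - 1)) (monom a 0) =
       poly_br br (monom a 1 + monom b 0) (poly_br br (monom a 1 + monom b 0) (monom a 0))"
      by (simp add: char numeral_2_eq_2 del: One_nat_def)
    moreover have "coeff (poly_br br (monom a 1 + monom b 0) (poly_br br (monom a 1 + monom b 0) (monom a 0))) n =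
       (if n = 0 then br b (br b a) else if n = 1 then br a (br b a) else 0)"
      by (auto simp: coeff_poly_br_linear br_self simp del: One_nat_def)
    ultimately show "coeff ((poly_br br (monom a 1 + monom b 0) ^^ (CHAR('f) - 1)) (monom a 0)) n =
        (if Suc n < CHAR('f) then of_nat (Suc n) *s ?s (Suc n) else 0)"
      by (cases "n = 0"; cases "n = 1") (simp_all add: char two)
  qed
  then show "\<exists>s. jacobson_terms scale br a b s \<and>
      (\<Sum>i = 1..CHAR('f) - 1. s i) = br b (br b a) - br a (br b a)"
    using p p_eq_CHAR by (intro exI[of _ ?s]) (simp add: numeral_2_eq_2)
qed

end

section \<open>Bases given by lists\<close>

context lie_algebra
begin

lemma sum_nth_distinct:
  "distinct xs \<Longrightarrow> (\<Sum>b\<in>set xs. f b) = (\<Sum>i<length xs. f (xs ! i))"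
  by (rule sum.reindex_bij_betw[symmetric, of "nth xs" "{..<length xs}" "set xs" f])
    (auto simp: bij_betw_nth)

text \<open>Coordinates are indexed by positions in the list rather than by basis vectors, so that maps with
prescribed values can be written as sums over positions.\<close>

definition coord :: "'l list \<Rightarrow> 'l \<Rightarrow> nat \<Rightarrow> 'f" where
  "coord xs x i = representation (set xs) x (xs ! i)"

context
  fixes xs :: "'l list"
  assumes basis: "is_basis scale xs"
begin

lemma basis_independent: "independent (set xs)" and basis_span: "span (set xs) = UNIV"
  and basis_distinct: "distinct xs"
  using basis by (auto simp: is_basis_def)

lemma sum_coord: "(\<Sum>i<length xs. coord xs x i *s xs ! i) = x"
  using sum_representation_eq[OF basis_independent, of x "set xs"]
  by (simp add: basis_span coord_def sum_nth_distinct[OF basis_distinct])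

lemma coord_add: "coord xs (x + y) i = coord xs x i + coord xs y i"
  by (simp add: coord_def representation_add basis_independent basis_span)

lemma coord_scale: "coord xs (\<alpha> *s x) i = \<alpha> * coord xs x i"
  by (simp add: coord_def representation_scale basis_independent basis_span)

lemma coord_basis: "i < length xs \<Longrightarrow> j < length xs \<Longrightarrow> coord xs (xs ! j) i = (if i = j then 1 else 0)"
  by (simp add: coord_def representation_basis basis_independent basis_distinct nth_eq_iff_index_eq)

lemma coord_sum: "coord xs (\<Sum>k\<in>I. f k) i = (\<Sum>k\<in>I. coord xs (f k) i)"
  by (simp add: coord_def representation_sum basis_independent basis_span)

lemma coord_lincomb: "i < length xs \<Longrightarrow> coord xs (\<Sum>k<length xs. c k *s xs ! k) i = c i"
  by (simp add: coord_sum coord_scale coord_basis if_distrib cong: if_cong)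

end

lemma independent_listI:
  assumes indep: "\<And>c. (\<Sum>i<length ys. c i *s ys ! i) = 0 \<Longrightarrow> \<forall>i<length ys. c i = 0"
  shows "distinct ys" "independent (set ys)"
proof -
  show dist: "distinct ys"
  proof (rule ccontr)
    assume "\<not> distinct ys"
    then obtain i j where ij: "i < length ys" "j < length ys" "i \<noteq> j" "ys ! i = ys ! j"
      by (auto simp: distinct_conv_nth)
    let ?c = "\<lambda>k. (if k = i then 1 else 0) - (if k = j then 1 else 0) :: 'f"
    have "(\<Sum>k<length ys. ?c k *s ys ! k) =
        (\<Sum>k<length ys. (if k = i then ys ! k else 0) - (if k = j then ys ! k else 0))"
      by (rule sum.cong) auto
    then have "(\<Sum>k<length ys. ?c k *s ys ! k) = 0"
      using ij by (simp add: sum_subtractf)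
    from indep[OF this] ij show False by auto
  qed
  show "independent (set ys)"
    unfolding dependent_finite[OF finite_set]
  proof safe
    fix u v assume *: "(\<Sum>v\<in>set ys. u v *s v) = 0" "v \<in> set ys" "u v \<noteq> 0"
    then show False
      using indep[of "\<lambda>i. u (ys ! i)"] by (auto simp: sum_nth_distinct[OF dist] in_set_conv_nth)
  qed
qed

lemma independent_list_length_le:
  assumes "is_basis scale xs" "distinct ys" "independent (set ys)"
  shows "length ys \<le> length xs"
  using independent_span_bound[of "set xs" "set ys"] assms
  by (simp add: is_basis_def distinct_card)

lemma is_basis_of_length:
  assumes xs: "is_basis scale xs" and ys: "distinct ys" "independent (set ys)"
    and len: "length ys = length xs"
  shows "is_basis scale ys"
proof -
  have "v \<in> span (set ys)" for v
  proof (rule ccontr)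
    assume v: "v \<notin> span (set ys)"
    then have "distinct (v # ys)" "independent (set (v # ys))"
      using ys span_base by (auto simp: independent_insert)
    from independent_list_length_le[OF xs this] len show False by simp
  qed
  then show ?thesis
    using ys by (auto simp: is_basis_def)
qed

lemma basis_of_independent_list:
  assumes "is_basis scale xs" "length ys = length xs"
    and "\<And>c. (\<Sum>i<length ys. c i *s ys ! i) = 0 \<Longrightarrow> \<forall>i<length ys. c i = 0"
  shows "is_basis scale ys"
  using is_basis_of_length[OF assms(1) independent_listI[OF assms(3)] assms(2)] .

lemma independent_list_extend:
  assumes xs: "is_basis scale xs" and len: "length ys < length xs"
  obtains w where "w \<notin> span (set ys)"
proof -
  have "\<exists>w. w \<notin> span (set ys)"
  proof (rule ccontr)
    assume "\<nexists>w. w \<notin> span (set ys)"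
    then have "set xs \<subseteq> span (set ys)" by blast
    then have "card (set xs) \<le> card (set ys)"
      using independent_span_bound[of "set ys" "set xs"] xs by (simp add: is_basis_def)
    then show False
      using len xs card_length[of ys] by (simp add: is_basis_def distinct_card)
  qed
  with that show thesis by blast
qed

text \<open>By bilinearity the linear map between the two bases respects all brackets as soon as it respects
those of basis vectors, and by antisymmetry the pairs \<open>i < j\<close> suffice.\<close>

lemma automorphism_of_bases:
  assumes xs: "is_basis scale xs" and ys: "is_basis scale ys" and len: "length ys = length xs"
    and br: "\<And>i j. i < j \<Longrightarrow> j < length xs \<Longrightarrow>
      \<exists>c. br (xs ! i) (xs ! j) = (\<Sum>k<length xs. c k *s xs ! k) \<and>
          br (ys ! i) (ys ! j) = (\<Sum>k<length xs. c k *s ys ! k)"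
  obtains A where "lie_automorphism scale br A" "map A xs = ys"
proof
  define A where "A x = (\<Sum>i<length xs. coord xs x i *s ys ! i)" for x
  define B where "B x = (\<Sum>i<length xs. coord ys x i *s xs ! i)" for x
  interpret A: Vector_Spaces.linear scale scale A
    by unfold_locales
      (simp_all add: A_def coord_add[OF xs] coord_scale[OF xs] scale_left_distrib sum.distrib scale_sum_right)
  have A_lincomb: "A (\<Sum>k<length xs. c k *s xs ! k) = (\<Sum>k<length xs. c k *s ys ! k)" for c
    by (simp add: A_def coord_lincomb[OF xs])
  have B_lincomb: "B (\<Sum>k<length xs. c k *s ys ! k) = (\<Sum>k<length xs. c k *s xs ! k)" for c
    using coord_lincomb[OF ys] len by (simp add: B_def)
  have "B (A x) = x" for x
    using B_lincomb[of "coord xs x"] by (simp add: A_def sum_coord[OF xs])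
  moreover have "A (B x) = x" for x
    using A_lincomb[of "coord ys x"] sum_coord[OF ys, of x] len by (simp add: B_def)
  ultimately have bij: "bij A"
    by (metis bijI')
  have A_basis: "A (xs ! i) = ys ! i" if "i < length xs" for i
  proof -
    have "A (xs ! i) = (\<Sum>k<length xs. if k = i then ys ! k else 0)"
      unfolding A_def by (rule sum.cong) (auto simp: coord_basis[OF xs] that)
    then show ?thesis using that by simp
  qed
  then show "map A xs = ys"
    by (simp add: list_eq_iff_nth_eq len)
  have A_br_less: "A (br (xs ! i) (xs ! j)) = br (A (xs ! i)) (A (xs ! j))" if "i < j" "j < length xs" for i j
    using br[OF that] that by (auto simp: A_lincomb A_basis)
  have A_br_basis: "A (br (xs ! i) (xs ! j)) = br (A (xs ! i)) (A (xs ! j))" if "i < length xs" "j < length xs" for i j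
  proof (cases i j rule: linorder_cases)
    case less
    then show ?thesis using A_br_less that by simp
  next
    case equal
    then show ?thesis by (simp add: br_self A.zero)
  next
    case greater
    then have "A (- br (xs ! j) (xs ! i)) = - br (A (xs ! j)) (A (xs ! i))"
      using A_br_less that by (simp add: A.neg)
    then show ?thesis by (simp only: br_anticommute[symmetric])
  qed
  have "A (br x y) = br (A x) (A y)" for x y
  proof -
    have "A (br (\<Sum>i<length xs. coord xs x i *s xs ! i) (\<Sum>j<length xs. coord xs y j *s xs ! j)) =
      (\<Sum>j<length xs. \<Sum>i<length xs. coord xs y j *s coord xs x i *s A (br (xs ! i) (xs ! j)))"
      by (simp add: br_sum_left br_sum_right br_scale_left br_scale_right A.sum A.scale scale_sum_right)
    also have "\<dots> = (\<Sum>j<length xs. \<Sum>i<length xs. coord xs y j *s coord xs x i *s br (A (xs ! i)) (A (xs ! j)))"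
      by (intro sum.cong refl arg_cong2[where f = scale]) (simp add: A_br_basis)
    also have "\<dots> = br (A (\<Sum>i<length xs. coord xs x i *s xs ! i)) (A (\<Sum>j<length xs. coord xs y j *s xs ! j))"
      by (simp add: br_sum_left br_sum_right br_scale_left br_scale_right A.sum A.scale scale_sum_right)
    finally show ?thesis by (simp add: sum_coord[OF xs])
  qed
  then show "lie_automorphism scale br A"
    using A.linear_axioms bij by (simp add: lie_automorphism_def)
qed

end

section \<open>Formulas and normal forms for \<open>[p]\<close>-maps\<close>

context perfect_lie_algebra
begin

text \<open>If the additivity defect \<open>c\<close> is the polarization of a \<open>p\<close>-homogeneous \<open>q\<close>, then \<open>\<phi> - q\<close> is
\<open>p\<close>-semilinear. As \<open>q\<close> vanishes on the basis, the values of \<open>\<phi>\<close> there are the coefficients of the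
semilinear part.\<close>

lemma p_map_iff_formula:
  assumes xs: "is_basis scale xs"
    and pm: "p_map scale br \<phi> \<longleftrightarrow> central_p_map c \<phi>"
    and q_central: "\<And>a b. br (q a) b = 0"
    and q_scale: "\<And>\<alpha> a. q (\<alpha> *s a) = \<alpha> ^ p *s q a"
    and q_add: "\<And>a b. q (a + b) = q a + q b + c a b"
    and q_basis: "\<And>i. i < length xs \<Longrightarrow> q (xs ! i) = 0"
  shows "p_map scale br \<phi> \<longleftrightarrow>
    (\<forall>i<length xs. \<forall>b. br (\<phi> (xs ! i)) b = 0) \<and>
    (\<forall>x. \<phi> x = (\<Sum>i<length xs. coord xs x i ^ p *s \<phi> (xs ! i)) + q x)"
  unfolding pm
proof
  assume \<phi>: "central_p_map c \<phi>"
  have \<phi>_scale: "\<phi> (\<alpha> *s a) = \<alpha> ^ p *s \<phi> a" and \<phi>_add: "\<phi> (a + b) = \<phi> a + \<phi> b + c a b" for \<alpha> a b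
    using \<phi> by (auto simp: central_p_map_def)
  let ?f = "\<lambda>x. \<phi> x - q x"
  have f_add: "?f (a + b) = ?f a + ?f b" for a b
    by (simp add: \<phi>_add q_add)
  have "?f 0 = 0"
    using f_add[of 0 0] by simp
  then have f_sum: "?f (\<Sum>i\<in>I. g i) = (\<Sum>i\<in>I. ?f (g i))" for I :: "nat set" and g
    by (induction I rule: infinite_finite_induct) (simp_all add: f_add)
  have "?f x = (\<Sum>i<length xs. coord xs x i ^ p *s \<phi> (xs ! i))" for x
  proof -
    have "?f x = (\<Sum>i<length xs. ?f (coord xs x i *s xs ! i))"
      by (subst f_sum[symmetric]) (simp add: sum_coord[OF xs])
    also have "\<dots> = (\<Sum>i<length xs. coord xs x i ^ p *s \<phi> (xs ! i))"
      by (rule sum.cong) (simp_all add: \<phi>_scale q_scale q_basis)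
    finally show ?thesis .
  qed
  then have "\<phi> x = (\<Sum>i<length xs. coord xs x i ^ p *s \<phi> (xs ! i)) + q x" for x
    by (metis diff_add_cancel)
  then show "(\<forall>i<length xs. \<forall>b. br (\<phi> (xs ! i)) b = 0) \<and>
    (\<forall>x. \<phi> x = (\<Sum>i<length xs. coord xs x i ^ p *s \<phi> (xs ! i)) + q x)"
    using \<phi> unfolding central_p_map_def by blast
next
  assume "(\<forall>i<length xs. \<forall>b. br (\<phi> (xs ! i)) b = 0) \<and>
    (\<forall>x. \<phi> x = (\<Sum>i<length xs. coord xs x i ^ p *s \<phi> (xs ! i)) + q x)"
  then have central: "\<And>i b. i < length xs \<Longrightarrow> br (\<phi> (xs ! i)) b = 0"
    and eq: "\<phi> = (\<lambda>x. (\<Sum>i<length xs. coord xs x i ^ p *s \<phi> (xs ! i)) + q x)"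
    by (blast, blast)
  show "central_p_map c \<phi>"
    by (subst eq, unfold central_p_map_def)
      (simp add: br_add_left br_sum_left br_scale_left central q_central q_scale q_add
        coord_add[OF xs] coord_scale[OF xs] frobenius_add power_mult_distrib scale_left_distrib
        scale_right_distrib scale_sum_right sum.distrib)
qed

lemma p_map_with_values_unique:
  assumes "is_basis scale xs" "p_map_with_values scale br xs vs \<phi>" "p_map_with_values scale br xs vs \<psi>"
  shows "\<phi> = \<psi>"
  using assms by (intro p_map_eqI[of _ _ "set xs"]) (auto simp: p_map_with_values_def is_basis_def)

text \<open>Read in the basis \<open>map A xs\<close>, which satisfies the same presentation as \<open>xs\<close>, the map \<open>\<phi>\<close> takes the
values that \<open>vs\<close> describes in terms of \<open>xs\<close>.\<close>

definition has_normal_form :: "('l \<Rightarrow> 'l) \<Rightarrow> 'l list \<Rightarrow> 'l list \<Rightarrow> bool" where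
  "has_normal_form \<phi> xs vs \<longleftrightarrow>
     (\<exists>A. lie_automorphism scale br A \<and> map (\<lambda>x. \<phi> (A x)) xs = map A vs)"

text \<open>The required map is the conjugate \<open>A\<^sup>-\<^sup>1 \<phi> A\<close>.\<close>

lemma equivalent_to_listed:
  assumes \<phi>: "p_map scale br \<phi>" and nf: "has_normal_form \<phi> xs vs"
  shows "\<exists>\<psi>. p_map_with_values scale br xs vs \<psi> \<and> equivalent_maps scale br \<phi> \<psi>"
proof -
  obtain A where A: "lie_automorphism scale br A" and eq: "map (\<lambda>x. \<phi> (A x)) xs = map A vs"
    using nf by (auto simp: has_normal_form_def)
  have bij: "bij A" using A by (simp add: lie_automorphism_def)
  let ?\<psi> = "\<lambda>x. inv A (\<phi> (A x))"
  have "map ?\<psi> xs = map (inv A) (map (\<lambda>x. \<phi> (A x)) xs)" by simp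
  also have "\<dots> = vs" using bij by (simp add: eq comp_def bij_is_inj)
  finally have "p_map_with_values scale br xs vs ?\<psi>"
    using p_map_conjugate[OF A \<phi>] by (simp add: p_map_with_values_def)
  moreover have "equivalent_maps scale br \<phi> ?\<psi>"
    unfolding equivalent_maps_def
    using lie_automorphism_inv[OF A] bij by (intro exI[of _ "inv A"]) (simp add: bij_is_surj surj_f_inv_f)
  ultimately show ?thesis by blast
qed

lemma equivalent_values_iff:
  assumes xs: "is_basis scale xs"
  shows "equivalent_values scale br xs vs ws \<longleftrightarrow>
    (\<exists>\<phi>. p_map_with_values scale br xs vs \<phi> \<and> has_normal_form \<phi> xs ws)"
    (is "?L \<longleftrightarrow> ?R")
proof
  assume ?L
  then obtain \<phi> \<psi> B where *: "p_map_with_values scale br xs vs \<phi>" "map \<psi> xs = ws"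
    "lie_automorphism scale br B" "\<And>x. B (\<phi> x) = \<psi> (B x)"
    by (auto simp: equivalent_values_def equivalent_maps_def p_map_with_values_def)
  have bij: "bij B" using * by (simp add: lie_automorphism_def)
  have "\<phi> (inv B x) = inv B (\<psi> x)" for x
    using *(4)[of "inv B x"] bij by (metis bij_inv_eq_iff)
  then have "has_normal_form \<phi> xs ws"
    unfolding has_normal_form_def
    using *(2) lie_automorphism_inv[OF *(3)] by (intro exI[of _ "inv B"]) auto
  then show ?R using *(1) by blast
next
  assume ?R
  then show ?L
    using equivalent_to_listed by (auto simp: equivalent_values_def p_map_with_values_def)
qed

lemma p_map_with_values_exists:
  assumes xs: "is_basis scale xs" and len: "length vs = length xs"
    and central: "\<And>v b. v \<in> set vs \<Longrightarrow> br v b = 0"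
    and q_basis: "\<And>i. i < length xs \<Longrightarrow> q (xs ! i) = 0"
    and pm: "\<And>\<phi>. p_map scale br \<phi> \<longleftrightarrow>
      (\<forall>i<length xs. \<forall>b. br (\<phi> (xs ! i)) b = 0) \<and>
      (\<forall>x. \<phi> x = (\<Sum>i<length xs. coord xs x i ^ p *s \<phi> (xs ! i)) + q x)"
  shows "\<exists>\<phi>. p_map_with_values scale br xs vs \<phi>"
proof -
  define \<phi> where "\<phi> x = (\<Sum>i<length xs. coord xs x i ^ p *s vs ! i) + q x" for x
  have values_eq: "\<phi> (xs ! j) = vs ! j" if "j < length xs" for j
  proof -
    have "(\<Sum>i<length xs. coord xs (xs ! j) i ^ p *s vs ! i) = (\<Sum>i<length xs. if i = j then vs ! i else 0)"
      using that p_pos by (intro sum.cong refl) (auto simp: coord_basis[OF xs] power_0_left)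
    then show ?thesis
      using that by (simp add: \<phi>_def q_basis)
  qed
  then have "p_map scale br \<phi>"
    unfolding pm using central len by (auto simp: \<phi>_def)
  moreover have "map \<phi> xs = vs"
    using values_eq by (simp add: list_eq_iff_nth_eq len)
  ultimately show ?thesis
    unfolding p_map_with_values_def by blast
qed

definition equivalence_invariant :: "(('l \<Rightarrow> 'l) \<Rightarrow> 'k) \<Rightarrow> bool" where
  "equivalence_invariant P \<longleftrightarrow> (\<forall>\<phi> \<psi>. equivalent_maps scale br \<phi> \<psi> \<longrightarrow> P \<phi> = P \<psi>)"

text \<open>Inequivalence of the items is delegated to an invariant \<open>P\<close> that takes a different value, the key, on
each item.\<close>

lemma nilpotent_p_maps_listedI:
  assumes xs: "is_basis scale xs" and P: "equivalence_invariant P" and keys: "distinct keys"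
    and exist: "\<And>I vs. I \<in> set items \<Longrightarrow> vs \<in> I \<Longrightarrow> \<exists>\<phi>. p_map_with_values scale br xs vs \<phi>"
    and items: "list_all2 (\<lambda>I k. \<forall>vs\<in>I. \<forall>\<phi>. p_map_with_values scale br xs vs \<phi> \<longrightarrow>
      p_nilpotent \<phi> \<and> P \<phi> = k) items keys"
    and cover: "\<And>\<phi>. p_map scale br \<phi> \<Longrightarrow> p_nilpotent \<phi> \<Longrightarrow>
      \<exists>I\<in>set items. \<exists>vs\<in>I. has_normal_form \<phi> xs vs"
  shows "nilpotent_p_maps_listed scale br xs items"
  unfolding nilpotent_p_maps_listed_def
proof (intro conjI ballI allI impI)
  fix I vs assume I: "I \<in> set items" "vs \<in> I"
  show "\<exists>!\<phi>. p_map_with_values scale br xs vs \<phi>"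
    using exist[OF I] p_map_with_values_unique[OF xs] by blast
  fix \<phi> assume "p_map_with_values scale br xs vs \<phi>"
  then show "p_nilpotent \<phi>"
    using items I by (fastforce simp: list_all2_conv_all_nth in_set_conv_nth)
next
  fix \<phi> assume \<phi>: "p_map scale br \<phi> \<and> p_nilpotent \<phi>"
  with cover obtain I vs where "I \<in> set items" "vs \<in> I" "has_normal_form \<phi> xs vs"
    by blast
  then show "\<exists>I\<in>set items. \<exists>vs\<in>I. \<exists>\<psi>. p_map_with_values scale br xs vs \<psi> \<and> equivalent_maps scale br \<phi> \<psi>"
    using equivalent_to_listed \<phi> by blast
next
  fix i j vs ws
  assume ij: "i < length items" "j < length items" "i \<noteq> j" "vs \<in> items ! i" "ws \<in> items ! j"
  show "\<not> equivalent_values scale br xs vs ws"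
  proof
    assume "equivalent_values scale br xs vs ws"
    then obtain \<phi> \<psi> where *: "p_map_with_values scale br xs vs \<phi>" "p_map_with_values scale br xs ws \<psi>"
      "equivalent_maps scale br \<phi> \<psi>"
      by (auto simp: equivalent_values_def)
    then have "P \<phi> = P \<psi>" using P by (simp add: equivalence_invariant_def)
    moreover have "P \<phi> = keys ! i" "P \<psi> = keys ! j" and "length keys = length items"
      using items ij * by (auto simp: list_all2_conv_all_nth)
    ultimately show False
      using keys ij by (simp add: nth_eq_iff_index_eq)
  qed
qed

section \<open>Properties of maps that equivalence preserves\<close>

definition power_zero :: "nat \<Rightarrow> ('l \<Rightarrow> 'l) \<Rightarrow> bool" where
  "power_zero n \<phi> \<longleftrightarrow> (\<forall>x. (\<phi> ^^ n) x = 0)"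

definition kills_center :: "('l \<Rightarrow> 'l) \<Rightarrow> bool" where
  "kills_center \<phi> \<longleftrightarrow> (\<forall>z. (\<forall>a. br z a = 0) \<longrightarrow> \<phi> z = 0)"

definition kills_brackets :: "('l \<Rightarrow> 'l) \<Rightarrow> bool" where
  "kills_brackets \<phi> \<longleftrightarrow> (\<forall>a b. \<phi> (br a b) = 0)"

definition kills_bracket_centralizer :: "('l \<Rightarrow> 'l) \<Rightarrow> bool" where
  "kills_bracket_centralizer \<phi> \<longleftrightarrow> (\<forall>x. (\<forall>a b. br x (br a b) = 0) \<longrightarrow> \<phi> x = 0)"

definition image_in_brackets :: "('l \<Rightarrow> 'l) \<Rightarrow> bool" where
  "image_in_brackets \<phi> \<longleftrightarrow> (\<forall>x. \<exists>a b. \<phi> x = br a b)"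

definition image_avoids_brackets :: "('l \<Rightarrow> 'l) \<Rightarrow> bool" where
  "image_avoids_brackets \<phi> \<longleftrightarrow> (\<forall>x a b. \<phi> x = br a b \<longrightarrow> \<phi> x = 0)"

definition kernel_in_image :: "('l \<Rightarrow> 'l) \<Rightarrow> bool" where
  "kernel_in_image \<phi> \<longleftrightarrow> (\<forall>x. \<phi> x = 0 \<longrightarrow> (\<exists>y. x = \<phi> y))"

text \<open>Equivalence is symmetric, so it suffices to transport a property in one direction; \<open>A\<close> and \<open>B\<close> are
the automorphism and its inverse.\<close>

lemma equivalence_invariantI:
  assumes "\<And>\<phi> \<psi> A B. \<lbrakk>P \<phi>; \<And>x. \<psi> x = A (\<phi> (B x)); \<And>x. B (A x) = x; \<And>x. A (B x) = x;
     \<And>a b. A (br a b) = br (A a) (A b); \<And>a b. B (br a b) = br (B a) (B b); A 0 = 0; B 0 = 0\<rbrakk> \<Longrightarrow> P \<psi>"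
  shows "equivalence_invariant P"
proof -
  have *: "(P \<phi> \<longrightarrow> P \<psi>) \<and> (P \<psi> \<longrightarrow> P \<phi>)"
    if A: "lie_automorphism scale br A" and eq: "\<And>x. A (\<phi> x) = \<psi> (A x)" for \<phi> \<psi> A
  proof -
    note B = lie_automorphism_inv[OF A]
    interpret A: Vector_Spaces.linear scale scale A
      using A by (simp add: lie_automorphism_def)
    interpret B: Vector_Spaces.linear scale scale "inv A"
      using B by (simp add: lie_automorphism_def)
    have bij: "bij A" using A by (simp add: lie_automorphism_def)
    then have inv: "A (inv A x) = x" "inv A (A x) = x" for x
      by (simp_all add: bij_is_surj surj_f_inv_f bij_is_inj)
    then have eqs: "\<psi> x = A (\<phi> (inv A x))" "\<phi> x = inv A (\<psi> (A x))" for x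
      by (metis eq)+
    have "\<And>a b. A (br a b) = br (A a) (A b)" "\<And>a b. inv A (br a b) = br (inv A a) (inv A b)"
      using A B by (auto simp: lie_automorphism_def)
    then show ?thesis
      using assms[of \<phi> \<psi> A "inv A"] assms[of \<psi> \<phi> "inv A" A] eqs inv A.zero B.zero by blast
  qed
  then show ?thesis
    unfolding equivalence_invariant_def equivalent_maps_def by blast
qed

lemma power_zero_invariant: "equivalence_invariant (power_zero n)"
proof (rule equivalence_invariantI)
  fix \<phi> \<psi> A B :: "'l \<Rightarrow> 'l"
  assume *: "power_zero n \<phi>" "\<And>x. \<psi> x = A (\<phi> (B x))" "\<And>x. B (A x) = x" "\<And>x. A (B x) = x" "A 0 = 0"
  have "(\<psi> ^^ n) x = A ((\<phi> ^^ n) (B x))" for x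
    by (induction n) (simp_all add: *)
  then show "power_zero n \<psi>" using * by (simp add: power_zero_def)
qed

lemma kills_center_invariant: "equivalence_invariant kills_center"
  by (rule equivalence_invariantI, unfold kills_center_def) metis

lemma kills_brackets_invariant: "equivalence_invariant kills_brackets"
  by (rule equivalence_invariantI) (simp add: kills_brackets_def)

lemma kills_bracket_centralizer_invariant: "equivalence_invariant kills_bracket_centralizer"
  by (rule equivalence_invariantI, unfold kills_bracket_centralizer_def) metis

lemma image_in_brackets_invariant: "equivalence_invariant image_in_brackets"
  by (rule equivalence_invariantI, unfold image_in_brackets_def) metis

lemma image_avoids_brackets_invariant: "equivalence_invariant image_avoids_brackets"
  by (rule equivalence_invariantI, unfold image_avoids_brackets_def) metis

lemma kernel_in_image_invariant: "equivalence_invariant kernel_in_image"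
  by (rule equivalence_invariantI, unfold kernel_in_image_def) metis

lemmas invariants = power_zero_invariant kills_center_invariant kills_brackets_invariant
  kills_bracket_centralizer_invariant image_in_brackets_invariant image_avoids_brackets_invariant
  kernel_in_image_invariant

lemma invariant_Cons:
  "equivalence_invariant P \<Longrightarrow> equivalence_invariant Ps \<Longrightarrow> equivalence_invariant (\<lambda>\<phi>. P \<phi> # Ps \<phi>)"
  and invariant_Nil: "equivalence_invariant (\<lambda>\<phi>. [])"
  by (simp_all add: equivalence_invariant_def)

section \<open>Nilpotent semilinear maps and binary forms\<close>

text \<open>Let \<open>i\<close> be the least index with \<open>c i \<noteq> 0\<close>. Applying \<open>\<phi>\<close> to the relation \<open>k - i\<close> times leaves a nonzero
multiple of the last element \<open>\<phi>\<^sup>k z\<close>. The subspace \<open>S\<close> serves the case of characteristic \<open>2\<close>, where a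
\<open>[p]\<close>-map is additive on the centre only.\<close>

lemma chain_independent:
  assumes add: "\<And>a b. a \<in> S \<Longrightarrow> b \<in> S \<Longrightarrow> \<phi> (a + b) = \<phi> a + \<phi> b"
    and scale: "\<And>\<alpha> a. \<phi> (\<alpha> *s a) = \<alpha> ^ p *s \<phi> a"
    and S: "subspace S" "\<And>a. a \<in> S \<Longrightarrow> \<phi> a \<in> S" "z \<in> S"
    and k: "(\<phi> ^^ Suc k) z = 0" "(\<phi> ^^ k) z \<noteq> 0"
    and rel: "(\<Sum>i\<le>k. c i *s (\<phi> ^^ i) z) = 0" and i: "i \<le> k"
  shows "c i = 0"
proof -
  have zero: "\<phi> 0 = 0"
    using scale[of 0 0] p_pos by (simp add: power_0_left)
  have zero_pow: "(\<phi> ^^ m) 0 = 0" for m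
    by (induction m) (simp_all add: zero)
  have later: "(\<phi> ^^ m) z = 0" if "m > k" for m
    using that
  proof (induction m)
    case (Suc m)
    then show ?case using k zero by (cases "m = k") auto
  qed simp
  have in_S: "(\<phi> ^^ j) z \<in> S" for j
    by (induction j) (auto simp: S)
  have apply_pow: "(\<phi> ^^ m) (\<Sum>i\<in>I. c i *s (\<phi> ^^ i) z) = (\<Sum>i\<in>I. c i ^ (p ^ m) *s (\<phi> ^^ (m + i)) z)"
    if "finite I" for m I
  proof (induction m)
    case (Suc m)
    have "\<phi> (\<Sum>i\<in>I. c i ^ (p ^ m) *s (\<phi> ^^ (m + i)) z) = (\<Sum>i\<in>I. \<phi> (c i ^ (p ^ m) *s (\<phi> ^^ (m + i)) z))"
      using that
    proof (induction I)
      case (insert x F)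
      then show ?case
        by (simp add: add S in_S subspace_sum subspace_scale)
    qed (simp add: zero)
    then show ?case
      using Suc by (simp add: scale power_mult[symmetric] mult.commute)
  qed simp
  show ?thesis using i
  proof (induction i rule: less_induct)
    case (less i)
    have "0 = (\<phi> ^^ (k - i)) (\<Sum>i\<le>k. c i *s (\<phi> ^^ i) z)"
      unfolding rel zero_pow ..
    also have "\<dots> = (\<Sum>j\<le>k. c j ^ (p ^ (k - i)) *s (\<phi> ^^ (k - i + j)) z)"
      by (rule apply_pow) simp
    also have "\<dots> = (\<Sum>j\<le>k. if j = i then c i ^ (p ^ (k - i)) *s (\<phi> ^^ k) z else 0)"
    proof (intro sum.cong refl)
      fix j assume "j \<in> {..k}"
      then show "c j ^ (p ^ (k - i)) *s (\<phi> ^^ (k - i + j)) z =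
          (if j = i then c i ^ (p ^ (k - i)) *s (\<phi> ^^ k) z else 0)"
        using less p_pos later[of "k - i + j"] by (cases i j rule: linorder_cases) auto
    qed
    also have "\<dots> = c i ^ (p ^ (k - i)) *s (\<phi> ^^ k) z"
      using less by simp
    finally show "c i = 0"
      using k p_pos by simp
  qed
qed

lemma chain_length_exists:
  assumes "p_nilpotent \<phi>" "z \<noteq> 0"
  obtains k where "(\<phi> ^^ Suc k) z = 0" "(\<phi> ^^ k) z \<noteq> 0"
proof -
  define n where "n = (LEAST n. (\<phi> ^^ n) z = 0)"
  have ex: "\<exists>n. (\<phi> ^^ n) z = 0"
    using assms by (auto simp: p_nilpotent_def)
  then have n: "(\<phi> ^^ n) z = 0"
    unfolding n_def by (rule LeastI_ex)
  with assms(2) obtain k where k: "n = Suc k" by (cases n) auto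
  have "(\<phi> ^^ k) z \<noteq> 0"
    using not_less_Least[of k "\<lambda>n. (\<phi> ^^ n) z = 0"] k n_def by simp
  with that n k show thesis by simp
qed

lemma nilpotent_eigenvalue:
  assumes \<phi>: "p_map scale br \<phi>" and nil: "p_nilpotent \<phi>" and eq: "\<phi> x = c *s x" and x: "x \<noteq> 0"
  shows "c = 0"
proof (rule ccontr)
  assume c: "c \<noteq> 0"
  have "\<exists>b. b \<noteq> 0 \<and> (\<phi> ^^ n) x = b *s x" for n
  proof (induction n)
    case 0
    show ?case by (rule exI[of _ 1]) simp
  next
    case (Suc n)
    then obtain b where "b \<noteq> 0" "(\<phi> ^^ n) x = b *s x" by blast
    then show ?case
      using p_map_scale[OF \<phi>, of b x] c eq by (intro exI[of _ "b ^ p * c"]) simp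
  qed
  with nil x show False
    unfolding p_nilpotent_def by (metis scale_eq_0_iff)
qed

text \<open>If \<open>v \<noteq> 0\<close>, the vector \<open>(1, -t)\<close> with \<open>t\<^sup>p = u / v\<close> is a zero of the form \<open>(\<alpha>, \<beta>) \<mapsto> \<alpha>\<^sup>p u + \<beta>\<^sup>p v\<close>; the
form cannot vanish on a complement. Determinant \<open>1\<close> keeps the bracket of the two basis vectors.\<close>

lemma unimodular_kill_form:
  assumes "(u::'f) \<noteq> 0 \<or> v \<noteq> 0"
  obtains \<alpha> \<beta> \<gamma> \<delta> :: 'f where "\<alpha> * \<delta> - \<beta> * \<gamma> = 1" "\<alpha> ^ p * u + \<beta> ^ p * v = 0"
    "\<gamma> ^ p * u + \<delta> ^ p * v \<noteq> 0"
proof (cases "v = 0")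
  case False
  obtain t where "t ^ p = u / v" using perfect by blast
  with False show thesis
    using that[of 1 1 "- t" 0] p_pos by (simp add: frobenius_minus power_0_left)
next
  case True
  then show thesis
    using assms that[of 0 0 1 "- 1"] p_pos by (simp add: power_0_left)
qed

text \<open>For \<open>p = 2\<close> the vectors \<open>y\<^sub>1 = (\<alpha>, \<beta>)\<close> and \<open>y\<^sub>2 = (\<gamma>, \<delta>)\<close> turn the form \<open>a\<^sup>2 u + b\<^sup>2 v + a b\<close> into
\<open>D (a\<^sup>2 + \<xi> b\<^sup>2 + a b)\<close>, where \<open>D\<close> is their determinant. It is enough to find a vector where
the form does not vanish: if \<open>Q(y\<^sub>1) \<noteq> 0\<close>, then \<open>y\<^sub>2\<close> can be scaled until \<open>D = Q(y\<^sub>1)\<close>. Both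
coefficients may be zero; then \<open>Q(1, 1) = 1\<close>.\<close>

lemma quadratic_form_normalized_pair:
  obtains \<alpha> \<beta> \<gamma> \<delta> \<xi> :: 'f where "\<alpha> * \<delta> - \<beta> * \<gamma> \<noteq> 0"
    "\<alpha>\<^sup>2 * u + \<beta>\<^sup>2 * v + \<alpha> * \<beta> = \<alpha> * \<delta> - \<beta> * \<gamma>"
    "\<gamma>\<^sup>2 * u + \<delta>\<^sup>2 * v + \<gamma> * \<delta> = \<xi> * (\<alpha> * \<delta> - \<beta> * \<gamma>)"
proof -
  consider "u \<noteq> 0" | "u = 0" "v \<noteq> 0" | "u = 0" "v = 0" by blast
  then show thesis
  proof cases
    case 1
    then show thesis using that[of 1 u 0 0 "u * v"] by (simp add: power2_eq_square)
  next
    case 2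
    then show thesis using that[of 0 0 1 "- v" 0] by simp
  next
    case 3
    then show thesis using that[of 1 1 1 0 0] by simp
  qed
qed

text \<open>The form \<open>a\<^sup>2 + a b + \<xi>\<^sub>1 b\<^sup>2\<close> is the norm form of \<open>\<bbbF>[\<theta>]\<close> with \<open>\<theta>\<^sup>2 = \<theta> - \<xi>\<^sub>1\<close>. For \<open>u = a + b \<theta>\<close> and
\<open>v = c + d \<theta>\<close> the product of \<open>v\<close> with the conjugate of \<open>u\<close> is \<open>m + D \<theta>\<close>, so multiplicativity of the norm
gives \<open>\<xi>\<^sub>2 D\<^sup>2 = m\<^sup>2 + m D + \<xi>\<^sub>1 D\<^sup>2\<close>. Dividing by \<open>D\<^sup>2\<close> exhibits \<open>\<delta> = m / D\<close>.\<close>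

lemma arf_invariant:
  assumes p: "p = 2" and D: "D = a * d - b * c" "(D::'f) \<noteq> 0"
    and N: "a\<^sup>2 + \<xi>1 * b\<^sup>2 + a * b = D" "c\<^sup>2 + \<xi>1 * d\<^sup>2 + c * d = \<xi>2 * D"
  shows "\<xi>1 + \<xi>2 \<in> artin_schreier"
proof -
  define m where "m = (a + b) * c + b * d * \<xi>1"
  have "(a\<^sup>2 + \<xi>1 * b\<^sup>2 + a * b) * (c\<^sup>2 + \<xi>1 * d\<^sup>2 + c * d) = m\<^sup>2 + m * D + \<xi>1 * D\<^sup>2"
    by (simp add: m_def D power2_eq_square algebra_simps)
  then have "\<xi>2 * D\<^sup>2 - \<xi>1 * D\<^sup>2 = m * D + m\<^sup>2"
    unfolding N by (simp add: power2_eq_square algebra_simps)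
  then have "\<xi>2 - \<xi>1 = m / D + (m / D)\<^sup>2"
    using D(2) by (simp add: field_simps power2_eq_square)
  moreover have "\<xi>2 - \<xi>1 = \<xi>1 + \<xi>2"
    using minus_CHAR_2[where 'a = 'f] p p_eq_CHAR by (simp add: add.commute)
  ultimately show ?thesis
    by (auto simp: artin_schreier_def)
qed

end

context lie_algebra
begin

lemma upper_central_eq_UNIV_mono: "upper_central k = UNIV \<Longrightarrow> k \<le> n \<Longrightarrow> upper_central n = UNIV"
  by (rotate_tac, induction n rule: dec_induct) auto

lemma coord_eq_iff:
  assumes "is_basis scale xs"
  shows "x = y \<longleftrightarrow> (\<forall>i<length xs. coord xs x i = coord xs y i)"
proof
  assume *: "\<forall>i<length xs. coord xs x i = coord xs y i"
  then have "(\<Sum>i<length xs. coord xs x i *s xs ! i) = (\<Sum>i<length xs. coord xs y i *s xs ! i)"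
    by simp
  then show "x = y" by (simp only: sum_coord[OF assms])
qed simp

end

lemma (in perfect_lie_algebra) char_2_diff: "p = 2 \<Longrightarrow> (a::'f) - b = a + b"
  using minus_CHAR_2[where 'a = 'f] by (simp add: p_eq_CHAR)

section \<open>Coordinates in dimension four\<close>

locale lie_algebra_basis4 = perfect_lie_algebra scale br p
  for scale :: "'f::field \<Rightarrow> 'l::ab_group_add \<Rightarrow> 'l" (infixr "*s" 75) and br p +
  fixes x1 x2 x3 x4 :: 'l
  assumes basis: "is_basis scale [x1, x2, x3, x4]"
begin

abbreviation "xs \<equiv> [x1, x2, x3, x4]"

text \<open>The coordinates are constants of their own, opaque to the simplifier, so that all computations
reduce to rewriting with the rules below.\<close>

definition "k1 x = coord xs x 0"
definition "k2 x = coord xs x 1"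
definition "k3 x = coord xs x 2"
definition "k4 x = coord xs x 3"

lemmas k_defs = k1_def k2_def k3_def k4_def

lemma k_add [simp]: "k1 (x + y) = k1 x + k1 y" "k2 (x + y) = k2 x + k2 y"
  "k3 (x + y) = k3 x + k3 y" "k4 (x + y) = k4 x + k4 y"
  by (simp_all add: k_defs coord_add[OF basis])

lemma k_scale [simp]: "k1 (\<alpha> *s x) = \<alpha> * k1 x" "k2 (\<alpha> *s x) = \<alpha> * k2 x"
  "k3 (\<alpha> *s x) = \<alpha> * k3 x" "k4 (\<alpha> *s x) = \<alpha> * k4 x"
  by (simp_all add: k_defs coord_scale[OF basis])

lemma k_zero [simp]: "k1 0 = 0" "k2 0 = 0" "k3 0 = 0" "k4 0 = 0"
  using k_scale[of 0 0] by simp_all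

lemma k_minus [simp]: "k1 (- x) = - k1 x" "k2 (- x) = - k2 x" "k3 (- x) = - k3 x" "k4 (- x) = - k4 x"
  using k_scale[of "- 1" x] by simp_all

lemma k_diff [simp]: "k1 (x - y) = k1 x - k1 y" "k2 (x - y) = k2 x - k2 y"
  "k3 (x - y) = k3 x - k3 y" "k4 (x - y) = k4 x - k4 y"
  using k_add[of x "- y"] by simp_all

lemma k_basis [simp]:
  "k1 x1 = 1" "k1 x2 = 0" "k1 x3 = 0" "k1 x4 = 0"
  "k2 x1 = 0" "k2 x2 = 1" "k2 x3 = 0" "k2 x4 = 0"
  "k3 x1 = 0" "k3 x2 = 0" "k3 x3 = 1" "k3 x4 = 0"
  "k4 x1 = 0" "k4 x2 = 0" "k4 x3 = 0" "k4 x4 = 1"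
  using coord_basis[OF basis, of _ 0] coord_basis[OF basis, of _ 1]
    coord_basis[OF basis, of _ 2] coord_basis[OF basis, of _ 3]
  by (simp_all add: k_defs numeral_2_eq_2 numeral_3_eq_3)

lemma k_eq_iff: "x = y \<longleftrightarrow> k1 x = k1 y \<and> k2 x = k2 y \<and> k3 x = k3 y \<and> k4 x = k4 y"
  using coord_eq_iff[OF basis, of x y] by (simp add: k_defs All_less_Suc numeral_eq_Suc conj_ac)

lemma expand: "x = k1 x *s x1 + k2 x *s x2 + k3 x *s x3 + k4 x *s x4"
  by (simp add: k_eq_iff)

lemma is_basis4I:
  assumes "\<And>a b c d. a *s y1 + b *s y2 + c *s y3 + d *s y4 = 0 \<Longrightarrow> a = 0 \<and> b = 0 \<and> c = 0 \<and> d = 0"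
  shows "is_basis scale [y1, y2, y3, y4]"
proof (rule basis_of_independent_list[OF basis])
  fix c assume "(\<Sum>i<length [y1, y2, y3, y4]. c i *s [y1, y2, y3, y4] ! i) = 0"
  then show "\<forall>i<length [y1, y2, y3, y4]. c i = 0"
    using assms[of "c 0" "c 1" "c 2" "c 3"] by (simp add: All_less_Suc numeral_eq_Suc)
qed simp

end

section \<open>The Heisenberg algebra with a central line\<close>

locale heisenberg4 = lie_algebra_basis4 scale br p x1 x2 x3 x4
  for scale :: "'f::field \<Rightarrow> 'l::ab_group_add \<Rightarrow> 'l" (infixr "*s" 75) and br p and x1 x2 x3 x4 :: 'l +
  assumes br12: "br x1 x2 = x3" and br13: "br x1 x3 = 0" and br14: "br x1 x4 = 0"
    and br23: "br x2 x3 = 0" and br24: "br x2 x4 = 0" and br34: "br x3 x4 = 0"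
begin

lemma br_coords: "br x y = (k1 x * k2 y - k2 x * k1 y) *s x3"
proof -
  have "br x2 x1 = - x3" "br x3 x1 = 0" "br x4 x1 = 0" "br x3 x2 = 0" "br x4 x2 = 0" "br x4 x3 = 0"
    using br_anticommute[of x2 x1] br_anticommute[of x3 x1] br_anticommute[of x4 x1]
      br_anticommute[of x3 x2] br_anticommute[of x4 x2] br_anticommute[of x4 x3]
    by (simp_all add: br12 br13 br14 br23 br24 br34)
  then have "br (k1 x *s x1 + k2 x *s x2 + k3 x *s x3 + k4 x *s x4)
      (k1 y *s x1 + k2 y *s x2 + k3 y *s x3 + k4 y *s x4) = (k1 x * k2 y - k2 x * k1 y) *s x3"
    by (simp add: br_add_left br_add_right br_scale_left br_scale_right br_self
        br12 br13 br14 br23 br24 br34 k_eq_iff)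
  then show ?thesis
    by (simp only: expand[symmetric])
qed

lemma k_br [simp]: "k1 (br x y) = 0" "k2 (br x y) = 0" "k3 (br x y) = k1 x * k2 y - k2 x * k1 y"
  "k4 (br x y) = 0"
  by (simp_all add: br_coords)

lemma central_iff: "(\<forall>b. br z b = 0) \<longleftrightarrow> k1 z = 0 \<and> k2 z = 0"
proof
  assume "\<forall>b. br z b = 0"
  then have "k3 (br z x1) = 0" "k3 (br z x2) = 0" by simp_all
  then show "k1 z = 0 \<and> k2 z = 0" by simp
qed (simp add: k_eq_iff)

lemma class_2: "upper_central 2 = UNIV"
  by (auto simp: numeral_2_eq_2 k_eq_iff)

text \<open>The coefficient of the quadratic correction term \<open>a\<^sub>1 a\<^sub>2 x\<^sub>3\<close>; it lets both kinds of characteristic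
share one formula.\<close>

definition e :: 'f where "e = (if p = 2 then 1 else 0)"

lemma p_map_formula:
  "p_map scale br \<phi> \<longleftrightarrow>
    (\<forall>i<length xs. \<forall>b. br (\<phi> (xs ! i)) b = 0) \<and>
    (\<forall>x. \<phi> x = (\<Sum>i<length xs. coord xs x i ^ p *s \<phi> (xs ! i)) + (e * k1 x * k2 x) *s x3)"
proof (cases "p = 2")
  case True
  show ?thesis
  proof (rule p_map_iff_formula[OF basis p_map_iff_char_2[OF True class_2]])
    fix a b
    show "(e * k1 (a + b) * k2 (a + b)) *s x3 =
      (e * k1 a * k2 a) *s x3 + (e * k1 b * k2 b) *s x3 + br b a"
      unfolding e_def by (simp add: k_eq_iff True char_2_diff[OF True, of "k1 b * k2 a" "k2 b * k1 a"])
        (simp add: algebra_simps)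
  qed (auto simp: True k_eq_iff power2_eq_square numeral_eq_Suc less_Suc_eq)
next
  case False
  then have "2 \<le> p - 1" using prime_ge_2_nat[OF prime_p] by simp
  then have "upper_central (p - 1) = UNIV"
    using class_2 upper_central_eq_UNIV_mono by blast
  from p_map_iff_formula[OF basis p_map_iff_small_class[OF this], where q = "\<lambda>_. 0"] False show ?thesis
    by (simp add: e_def)
qed

lemma p_map_coords:
  assumes "p_map scale br \<phi>"
  shows "k1 (\<phi> x) = 0" "k2 (\<phi> x) = 0"
    "k3 (\<phi> x) = k1 x ^ p * k3 (\<phi> x1) + k2 x ^ p * k3 (\<phi> x2) + k3 x ^ p * k3 (\<phi> x3) +
      k4 x ^ p * k3 (\<phi> x4) + e * k1 x * k2 x"
    "k4 (\<phi> x) = k1 x ^ p * k4 (\<phi> x1) + k2 x ^ p * k4 (\<phi> x2) + k3 x ^ p * k4 (\<phi> x3) +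
      k4 x ^ p * k4 (\<phi> x4)"
proof -
  have central: "k1 (\<phi> (xs ! i)) = 0 \<and> k2 (\<phi> (xs ! i)) = 0" if "i < length xs" for i
    using assms that unfolding p_map_formula central_iff by blast
  have "\<phi> x = (\<Sum>i<length xs. coord xs x i ^ p *s \<phi> (xs ! i)) + (e * k1 x * k2 x) *s x3"
    using assms unfolding p_map_formula by blast
  then have eq: "\<phi> x = k1 x ^ p *s \<phi> x1 + k2 x ^ p *s \<phi> x2 + k3 x ^ p *s \<phi> x3 + k4 x ^ p *s \<phi> x4 +
      (e * k1 x * k2 x) *s x3"
    by (simp add: k_defs numeral_2_eq_2 numeral_3_eq_3 add.assoc)
  show "k1 (\<phi> x) = 0" "k2 (\<phi> x) = 0"
    using central[of 0] central[of 1] central[of 2] central[of 3]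
    by (simp_all add: eq numeral_2_eq_2 numeral_3_eq_3)
  from arg_cong[OF eq, of k3] arg_cong[OF eq, of k4]
  show "k3 (\<phi> x) = k1 x ^ p * k3 (\<phi> x1) + k2 x ^ p * k3 (\<phi> x2) + k3 x ^ p * k3 (\<phi> x3) +
      k4 x ^ p * k3 (\<phi> x4) + e * k1 x * k2 x"
    "k4 (\<phi> x) = k1 x ^ p * k4 (\<phi> x1) + k2 x ^ p * k4 (\<phi> x2) + k3 x ^ p * k4 (\<phi> x3) +
      k4 x ^ p * k4 (\<phi> x4)"
    by simp_all
qed

lemma p_map_exists:
  assumes "\<forall>v\<in>{v1, v2, v3, v4}. k1 v = 0 \<and> k2 v = 0"
  shows "\<exists>\<phi>. p_map_with_values scale br xs [v1, v2, v3, v4] \<phi>"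
proof (rule p_map_with_values_exists[OF basis _ _ _ p_map_formula])
  fix v b assume "v \<in> set [v1, v2, v3, v4]"
  then show "br v b = 0" using assms central_iff[of v] by auto
qed (auto simp: k_eq_iff numeral_eq_Suc less_Suc_eq)

text \<open>A basis satisfying the presentation is given by any \<open>y\<^sub>1, y\<^sub>2\<close> with \<open>y\<^sub>3 = [y\<^sub>1, y\<^sub>2] \<noteq> 0\<close> and a central \<open>y\<^sub>4\<close>
outside the line of \<open>y\<^sub>3\<close>: a linear relation loses all but one unknown coefficient on taking the
bracket with \<open>y\<^sub>2\<close> or \<open>y\<^sub>1\<close>.\<close>

lemma has_normal_form_iff:
  assumes v: "\<forall>v\<in>{v1, v2, v3, v4}. k1 v = 0 \<and> k2 v = 0"
  shows "has_normal_form \<phi> xs [v1, v2, v3, v4] \<longleftrightarrow>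
    (\<exists>y1 y2 y3 y4. br y1 y2 = y3 \<and> k3 y3 \<noteq> 0 \<and> k1 y4 = 0 \<and> k2 y4 = 0 \<and> k4 y4 \<noteq> 0 \<and>
      \<phi> y1 = k3 v1 *s y3 + k4 v1 *s y4 \<and> \<phi> y2 = k3 v2 *s y3 + k4 v2 *s y4 \<and>
      \<phi> y3 = k3 v3 *s y3 + k4 v3 *s y4 \<and> \<phi> y4 = k3 v4 *s y3 + k4 v4 *s y4)"
    (is "?L \<longleftrightarrow> ?R")
proof
  have v_eq: "v = k3 v *s x3 + k4 v *s x4" if "v \<in> {v1, v2, v3, v4}" for v
    using v that by (auto simp: k_eq_iff)
  {
    assume ?L
    then obtain A where A: "lie_automorphism scale br A"
      and eq: "\<phi> (A x1) = A v1" "\<phi> (A x2) = A v2" "\<phi> (A x3) = A v3" "\<phi> (A x4) = A v4"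
      by (auto simp: has_normal_form_def)
    interpret A: Vector_Spaces.linear scale scale A
      using A by (simp add: lie_automorphism_def)
    have bij: "bij A" and A_br: "A (br x y) = br (A x) (A y)" for x y
      using A by (auto simp: lie_automorphism_def)
    have A_eq_0: "A x = 0 \<longleftrightarrow> x = 0" for x
      using bij A.zero by (metis bij_is_inj injD)
    have A_v: "A v = k3 v *s A x3 + k4 v *s A x4" if "v \<in> {v1, v2, v3, v4}" for v
      by (subst v_eq[OF that]) (simp add: A.add A.scale)
    have br12': "br (A x1) (A x2) = A x3"
      using A_br[of x1 x2] br12 by simp
    have "x3 \<noteq> 0" "x4 \<noteq> 0" by (simp_all add: k_eq_iff)
    then have A3: "k3 (A x3) \<noteq> 0"
      using A_eq_0[of x3] by (simp add: k_eq_iff br12'[symmetric])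
    have "br (A x4) y = 0" for y
    proof -
      obtain x where "y = A x" using bij by (metis bij_pointE)
      then have "br (A x4) y = A (br x4 x)" by (simp add: A_br)
      also have "br x4 x = 0" by (simp add: k_eq_iff)
      finally show ?thesis by (simp add: A.zero)
    qed
    then have A4: "k1 (A x4) = 0 \<and> k2 (A x4) = 0"
      using central_iff[of "A x4"] by simp
    have "k4 (A x4) \<noteq> 0"
    proof
      assume "k4 (A x4) = 0"
      then have "k3 (A x3) *s A x4 - k3 (A x4) *s A x3 = 0"
        using A4 by (simp add: k_eq_iff br12'[symmetric])
      then have "A (k3 (A x3) *s x4 - k3 (A x4) *s x3) = 0"
        by (simp add: A.diff A.scale)
      then have "k3 (A x3) *s x4 - k3 (A x4) *s x3 = 0"
        by (simp only: A_eq_0)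
      from arg_cong[OF this, of k4] A3 show False by simp
    qed
    moreover have "\<phi> (A x1) = k3 v1 *s A x3 + k4 v1 *s A x4" "\<phi> (A x2) = k3 v2 *s A x3 + k4 v2 *s A x4"
      "\<phi> (A x3) = k3 v3 *s A x3 + k4 v3 *s A x4" "\<phi> (A x4) = k3 v4 *s A x3 + k4 v4 *s A x4"
      unfolding eq by (rule A_v; simp)+
    ultimately show ?R
      using br12' A3 A4 by (intro exI[of _ "A x1"] exI[of _ "A x2"] exI[of _ "A x3"] exI[of _ "A x4"]) blast
  next
    assume ?R
    then obtain y1 y2 y3 y4 where y3: "br y1 y2 = y3" and y: "k3 y3 \<noteq> 0" "k1 y4 = 0" "k2 y4 = 0" "k4 y4 \<noteq> 0"
      and eq: "\<phi> y1 = k3 v1 *s y3 + k4 v1 *s y4" "\<phi> y2 = k3 v2 *s y3 + k4 v2 *s y4"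
      "\<phi> y3 = k3 v3 *s y3 + k4 v3 *s y4" "\<phi> y4 = k3 v4 *s y3 + k4 v4 *s y4"
      by blast
    have y3_coords: "k1 y3 = 0" "k2 y3 = 0" "k4 y3 = 0" and y3_k3: "k3 y3 = k1 y1 * k2 y2 - k2 y1 * k1 y2"
      by (simp_all add: y3[symmetric])
    have ys: "is_basis scale [y1, y2, y3, y4]"
    proof (rule is_basis4I)
      fix a b c d assume *: "a *s y1 + b *s y2 + c *s y3 + d *s y4 = 0" (is "?s = 0")
      have "a * k3 y3 = k3 (br ?s y2)" "b * k3 y3 = k3 (br y1 ?s)"
        using y y3_coords by (simp_all add: y3_k3 algebra_simps)
      then have ab: "a = 0" "b = 0"
        using y unfolding * by simp_all
      then have "k4 ?s = d * k4 y4" "k3 ?s = c * k3 y3 + d * k3 y4"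
        by (simp_all add: y3_coords)
      then show "a = 0 \<and> b = 0 \<and> c = 0 \<and> d = 0"
        using y ab unfolding * by simp
    qed
    obtain A where A: "lie_automorphism scale br A" "map A xs = [y1, y2, y3, y4]"
    proof (rule automorphism_of_bases[OF basis ys])
      fix i j :: nat assume ij: "i < j" "j < length xs"
      have "br (xs ! i) (xs ! j) = (\<Sum>k<length xs. (if i = 0 \<and> j = 1 \<and> k = 2 then 1 else 0) *s xs ! k)"
        "br ([y1, y2, y3, y4] ! i) ([y1, y2, y3, y4] ! j) =
           (\<Sum>k<length xs. (if i = 0 \<and> j = 1 \<and> k = 2 then 1 else 0) *s [y1, y2, y3, y4] ! k)"
        using ij y y3 y3_coords by (auto simp: numeral_eq_Suc less_Suc_eq k_eq_iff)
      then show "\<exists>c. br (xs ! i) (xs ! j) = (\<Sum>k<length xs. c k *s xs ! k) \<and>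
          br ([y1, y2, y3, y4] ! i) ([y1, y2, y3, y4] ! j) = (\<Sum>k<length xs. c k *s [y1, y2, y3, y4] ! k)"
        by (intro exI conjI)
    qed auto
    interpret A: Vector_Spaces.linear scale scale A
      using A by (simp add: lie_automorphism_def)
    have A_v: "A v = k3 v *s y3 + k4 v *s y4" if "v \<in> {v1, v2, v3, v4}" for v
      using A(2) by (subst v_eq[OF that]) (simp add: A.add A.scale)
    show ?L
      unfolding has_normal_form_def
      using A eq A_v by (intro exI[of _ A]) simp
  }
qed

lemma e_2: "p = 2 \<Longrightarrow> e = 1" and e_odd: "p \<noteq> 2 \<Longrightarrow> e = 0"
  unfolding e_def by simp_all

context
  fixes \<phi> v1 v2 v3 v4
  assumes \<phi>: "p_map_with_values scale br xs [v1, v2, v3, v4] \<phi>"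
begin

lemma p_map: "p_map scale br \<phi>"
  and values_eq: "\<phi> x1 = v1" "\<phi> x2 = v2" "\<phi> x3 = v3" "\<phi> x4 = v4"
  using \<phi> by (simp_all add: p_map_with_values_def)

lemma values_central: "k1 v1 = 0" "k2 v1 = 0" "k1 v2 = 0" "k2 v2 = 0"
  "k1 v3 = 0" "k2 v3 = 0" "k1 v4 = 0" "k2 v4 = 0"
  using p_map_coords(1,2)[OF p_map] by (simp_all add: values_eq[symmetric])

lemma coords: "k1 (\<phi> x) = 0" "k2 (\<phi> x) = 0"
    "k3 (\<phi> x) = k1 x ^ p * k3 v1 + k2 x ^ p * k3 v2 + k3 x ^ p * k3 v3 + k4 x ^ p * k3 v4 + e * k1 x * k2 x"
    "k4 (\<phi> x) = k1 x ^ p * k4 v1 + k2 x ^ p * k4 v2 + k3 x ^ p * k4 v3 + k4 x ^ p * k4 v4"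
  using p_map_coords[OF p_map, of x] by (simp_all add: values_eq)

lemma add: "\<phi> (a + b) = \<phi> a + \<phi> b + (e * (k1 a * k2 b + k2 a * k1 b)) *s x3"
  by (simp add: k_eq_iff coords frobenius_add algebra_simps)

lemma scale: "\<phi> (\<alpha> *s a) = \<alpha> ^ p *s \<phi> a"
  using p_map by (rule p_map_scale)

lemma zero: "\<phi> 0 = 0"
  using p_map by (rule p_map_zero)

text \<open>On the two-dimensional centre \<open>\<phi>\<close> is semilinear, and a nilpotent semilinear map of a plane has square
zero: three consecutive nonzero members of a chain would be linearly independent.\<close>

lemma nilpotent_iff: "p_nilpotent \<phi> \<longleftrightarrow> \<phi> v3 = 0 \<and> \<phi> v4 = 0"
proof
  assume nil: "p_nilpotent \<phi>"
  have "\<phi> (\<phi> z) = 0" if z: "k1 z = 0" "k2 z = 0" for z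
  proof (cases "z = 0")
    case False
    obtain k where k: "(\<phi> ^^ Suc k) z = 0" "(\<phi> ^^ k) z \<noteq> 0"
      using chain_length_exists[OF nil False] .
    have indep: "c i = 0" if "(\<Sum>i\<le>k. c i *s (\<phi> ^^ i) z) = 0" "i \<le> k" for c i
    proof (rule chain_independent[OF _ _ _ _ _ k that])
      show "subspace {z. k1 z = 0 \<and> k2 z = 0}"
        by (auto simp: subspace_def)
    qed (use z in \<open>auto simp: add scale coords\<close>)
    have "\<not> k \<ge> 2"
    proof
      assume "k \<ge> 2"
      have sum3: "(\<Sum>i\<le>k. (if i = 0 then a else if i = 1 then b else if i = 2 then c else 0) *s (\<phi> ^^ i) z) =
          a *s z + b *s \<phi> z + c *s \<phi> (\<phi> z)" for a b c
      proof -
        have "(\<Sum>i\<le>k. (if i = 0 then a else if i = 1 then b else if i = 2 then c else 0) *s (\<phi> ^^ i) z) =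
            (\<Sum>i\<in>{0, 1, 2}. (if i = 0 then a else if i = 1 then b else if i = 2 then c else 0) *s (\<phi> ^^ i) z)"
          using \<open>k \<ge> 2\<close> by (intro sum.mono_neutral_right) auto
        then show ?thesis by (simp add: numeral_2_eq_2 add.assoc)
      qed
      have indep3: "a = 0 \<and> b = 0 \<and> c = 0" if "a *s z + b *s \<phi> z + c *s \<phi> (\<phi> z) = 0" for a b c
        using indep[OF trans[OF sum3 that], of 0] indep[OF trans[OF sum3 that], of 1]
          indep[OF trans[OF sum3 that], of 2] \<open>k \<ge> 2\<close> by simp
      define w where "w = \<phi> z"
      define v where "v = \<phi> w"
      have w: "k1 w = 0" "k2 w = 0" and v: "k1 v = 0" "k2 v = 0"
        by (simp_all add: w_def v_def coords)
      \<comment> \<open>Cramer's rule gives a relation between \<open>z\<close>, \<open>w\<close>, \<open>v\<close> whose coefficients are \<open>2 \<times> 2\<close> minors.\<close>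
      have "k3 z * k4 w - k4 z * k3 w = 0"
        using indep3[of "k3 w * k4 v - k4 w * k3 v" "k3 v * k4 z - k4 v * k3 z" "k3 z * k4 w - k4 z * k3 w"] z w v
        by (simp add: w_def[symmetric] v_def[symmetric] k_eq_iff algebra_simps)
      then have "k3 w = 0 \<and> - k3 z = 0" "k4 w = 0 \<and> - k4 z = 0"
        using indep3[of "k3 w" "- k3 z" 0] indep3[of "k4 w" "- k4 z" 0] z w
        by (simp_all add: w_def[symmetric] k_eq_iff algebra_simps)
      with False z show False by (simp add: k_eq_iff)
    qed
    then have "k = 0 \<or> k = 1" by auto
    then show ?thesis using k zero by auto
  qed (simp add: zero)
  then have "\<phi> (\<phi> x3) = 0" "\<phi> (\<phi> x4) = 0" by simp_all
  then show "\<phi> v3 = 0 \<and> \<phi> v4 = 0" by (simp add: values_eq)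
next
  assume *: "\<phi> v3 = 0 \<and> \<phi> v4 = 0"
  have "\<phi> (\<phi> z) = 0" if z: "k1 z = 0" "k2 z = 0" for z
  proof -
    have "\<phi> z = k3 z ^ p *s v3 + k4 z ^ p *s v4"
      using z by (simp add: k_eq_iff coords values_central)
    then show ?thesis using * by (simp add: add scale values_central)
  qed
  then have "(\<phi> ^^ 3) x = 0" for x
    by (simp add: numeral_3_eq_3 coords)
  then show "p_nilpotent \<phi>" by (auto simp: p_nilpotent_def)
qed

lemma power_zero_1_iff: "power_zero 1 \<phi> \<longleftrightarrow> p \<noteq> 2 \<and> v1 = 0 \<and> v2 = 0 \<and> v3 = 0 \<and> v4 = 0"
proof
  assume "power_zero 1 \<phi>"
  then have *: "\<phi> x = 0" for x by (simp add: power_zero_def)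
  then show "p \<noteq> 2 \<and> v1 = 0 \<and> v2 = 0 \<and> v3 = 0 \<and> v4 = 0"
    using add[of x1 x2] e_2 values_eq by (auto simp: k_eq_iff)
qed (simp add: power_zero_def k_eq_iff coords e_odd)

text \<open>For \<open>p = 2\<close> the condition on \<open>v\<^sub>3\<close> comes from the argument \<open>x\<^sub>1 + x\<^sub>2\<close>, where the correction term contributes
\<open>x\<^sub>3\<close> to the first application of \<open>\<phi>\<close>.\<close>

lemma power_zero_2_iff: "power_zero 2 \<phi> \<longleftrightarrow>
  \<phi> v1 = 0 \<and> \<phi> v2 = 0 \<and> \<phi> v3 = 0 \<and> \<phi> v4 = 0 \<and> (p = 2 \<longrightarrow> v3 = 0)"
proof
  assume "power_zero 2 \<phi>"
  then have *: "\<phi> (\<phi> x) = 0" for x by (simp add: power_zero_def numeral_2_eq_2)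
  have "v3 = 0" if "p = 2"
  proof -
    have "\<phi> (x1 + x2) = v1 + v2 + x3"
      by (simp add: add values_eq e_2[OF that])
    then have "\<phi> (v1 + v2 + x3) = 0"
      using *[of "x1 + x2"] by simp
    then show ?thesis
      using *[of x1] *[of x2] by (simp add: add values_eq values_central)
  qed
  then show "\<phi> v1 = 0 \<and> \<phi> v2 = 0 \<and> \<phi> v3 = 0 \<and> \<phi> v4 = 0 \<and> (p = 2 \<longrightarrow> v3 = 0)"
    using *[of x1] *[of x2] *[of x3] *[of x4] by (simp add: values_eq)
next
  assume *: "\<phi> v1 = 0 \<and> \<phi> v2 = 0 \<and> \<phi> v3 = 0 \<and> \<phi> v4 = 0 \<and> (p = 2 \<longrightarrow> v3 = 0)"
  have "\<phi> (\<phi> x) = 0" for x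
  proof -
    have eq: "\<phi> x = k1 x ^ p *s v1 + k2 x ^ p *s v2 + k3 x ^ p *s v3 + k4 x ^ p *s v4 + (e * k1 x * k2 x) *s x3"
      by (simp add: k_eq_iff coords values_central)
    show ?thesis
      using * e_odd by (subst eq, cases "p = 2") (simp_all add: add scale values_central values_eq)
  qed
  then show "power_zero 2 \<phi>"
    by (simp add: power_zero_def numeral_2_eq_2)
qed

lemma kills_center_iff: "kills_center \<phi> \<longleftrightarrow> v3 = 0 \<and> v4 = 0"
proof
  assume "kills_center \<phi>"
  then have "\<phi> x3 = 0" "\<phi> x4 = 0"
    unfolding kills_center_def central_iff by simp_all
  then show "v3 = 0 \<and> v4 = 0" by (simp add: values_eq)
next
  assume "v3 = 0 \<and> v4 = 0"
  then show "kills_center \<phi>"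
    unfolding kills_center_def central_iff by (simp add: k_eq_iff coords)
qed

lemma kills_brackets_iff: "kills_brackets \<phi> \<longleftrightarrow> v3 = 0"
proof
  assume "kills_brackets \<phi>"
  then have "\<phi> (br x1 x2) = 0" by (simp only: kills_brackets_def)
  then show "v3 = 0" by (simp add: br12 values_eq)
qed (simp add: kills_brackets_def br_coords scale values_eq)

lemma image_in_brackets_iff:
  "image_in_brackets \<phi> \<longleftrightarrow> k4 v1 = 0 \<and> k4 v2 = 0 \<and> k4 v3 = 0 \<and> k4 v4 = 0"
proof
  assume "image_in_brackets \<phi>"
  then have "k4 (\<phi> x) = 0" for x
    unfolding image_in_brackets_def by (metis k_br(4))
  from this[of x1] this[of x2] this[of x3] this[of x4]
  show "k4 v1 = 0 \<and> k4 v2 = 0 \<and> k4 v3 = 0 \<and> k4 v4 = 0" by (simp add: values_eq)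
next
  assume *: "k4 v1 = 0 \<and> k4 v2 = 0 \<and> k4 v3 = 0 \<and> k4 v4 = 0"
  have "\<phi> x = br (k3 (\<phi> x) *s x1) x2" for x
    by (simp add: k_eq_iff) (simp add: coords *)
  then show "image_in_brackets \<phi>"
    unfolding image_in_brackets_def by blast
qed

lemma image_avoids_brackets_iff:
  "image_avoids_brackets \<phi> \<longleftrightarrow> (\<forall>x. k4 (\<phi> x) = 0 \<longrightarrow> k3 (\<phi> x) = 0)"
proof -
  have "(\<exists>a b. \<phi> x = br a b) \<longleftrightarrow> k4 (\<phi> x) = 0" for x
  proof
    assume "k4 (\<phi> x) = 0"
    then have "\<phi> x = br (k3 (\<phi> x) *s x1) x2"
      using coords(1,2)[of x] by (simp add: k_eq_iff)
    then show "\<exists>a b. \<phi> x = br a b" by blast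
  qed auto
  then show ?thesis
    unfolding image_avoids_brackets_def using coords(1,2) by (metis k_eq_iff k_zero)
qed

end

text \<open>These six properties separate the items of both lists.\<close>

definition "profile \<phi> = [power_zero 1 \<phi>, power_zero 2 \<phi>, kills_center \<phi>, kills_brackets \<phi>,
  image_in_brackets \<phi>, image_avoids_brackets \<phi>]"

lemma profile_invariant: "equivalence_invariant profile"
  unfolding profile_def by (intro invariant_Cons invariant_Nil invariants)

lemma all_coords: "(\<forall>x. P (k1 x) (k2 x) (k3 x) (k4 x)) \<longleftrightarrow> (\<forall>a b c d. P a b c d)"
proof
  assume *: "\<forall>x. P (k1 x) (k2 x) (k3 x) (k4 x)"
  show "\<forall>a b c d. P a b c d"
  proof (intro allI)
    fix a b c d
    show "P a b c d"
      using *[rule_format, of "a *s x1 + b *s x2 + c *s x3 + d *s x4"] by simp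
  qed
qed simp

lemma profile_eq:
  assumes \<phi>: "p_map_with_values scale br xs [v1, v2, v3, v4] \<phi>"
  shows "profile \<phi> = [p \<noteq> 2 \<and> v1 = 0 \<and> v2 = 0 \<and> v3 = 0 \<and> v4 = 0,
    \<phi> v1 = 0 \<and> \<phi> v2 = 0 \<and> \<phi> v3 = 0 \<and> \<phi> v4 = 0 \<and> (p = 2 \<longrightarrow> v3 = 0),
    v3 = 0 \<and> v4 = 0, v3 = 0, k4 v1 = 0 \<and> k4 v2 = 0 \<and> k4 v3 = 0 \<and> k4 v4 = 0,
    \<forall>a b c d. a ^ p * k4 v1 + b ^ p * k4 v2 + c ^ p * k4 v3 + d ^ p * k4 v4 = 0 \<longrightarrow>
      a ^ p * k3 v1 + b ^ p * k3 v2 + c ^ p * k3 v3 + d ^ p * k3 v4 + e * a * b = 0]"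
  unfolding profile_def power_zero_1_iff[OF \<phi>] power_zero_2_iff[OF \<phi>] kills_center_iff[OF \<phi>]
    kills_brackets_iff[OF \<phi>] image_in_brackets_iff[OF \<phi>] image_avoids_brackets_iff[OF \<phi>]
    coords[OF \<phi>]
  by (subst all_coords[symmetric]) simp

lemma not_all_zero: "\<exists>a::'f. a \<noteq> 0" "\<exists>a b. a\<^sup>2 + b\<^sup>2 * \<xi> + c * a * b \<noteq> (0::'f)"
  "\<exists>a b d. d\<^sup>2 + c * a * b \<noteq> (0::'f)"
proof -
  show "\<exists>a::'f. a \<noteq> 0" by (rule exI[of _ 1]) simp
  show "\<exists>a b. a\<^sup>2 + b\<^sup>2 * \<xi> + c * a * b \<noteq> (0::'f)"
    by (rule exI[of _ 1], rule exI[of _ 0]) simp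
  show "\<exists>a b d. d\<^sup>2 + c * a * b \<noteq> (0::'f)"
    by (rule exI[of _ 0], rule exI[of _ 0], rule exI[of _ 1]) simp
qed

lemma profile_items_odd:
  assumes "p \<noteq> 2"
  shows "list_all2 (\<lambda>I k. \<forall>vs\<in>I. \<forall>\<phi>. p_map_with_values scale br xs vs \<phi> \<longrightarrow> p_nilpotent \<phi> \<and> profile \<phi> = k)
    [{[0, 0, 0, 0]}, {[x3, 0, 0, 0]}, {[x4, 0, 0, 0]}, {[x3, x4, 0, 0]},
     {[0, 0, x4, 0]}, {[0, x3, x4, 0]}, {[0, 0, 0, x3]}, {[0, x4, 0, x3]}]
    [[True, True, True, True, True, True], [False, True, True, True, True, False],
     [False, True, True, True, False, True], [False, True, True, True, False, False],
     [False, True, False, False, False, True], [False, False, False, False, False, False],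
     [False, True, False, True, True, False], [False, False, False, True, False, False]]"
  using assms p_pos
  by (auto simp: nilpotent_iff profile_eq e_odd coords k_eq_iff not_all_zero)

lemma profile_items_2:
  assumes "p = 2"
  shows "list_all2 (\<lambda>I k. \<forall>vs\<in>I. \<forall>\<phi>. p_map_with_values scale br xs vs \<phi> \<longrightarrow> p_nilpotent \<phi> \<and> profile \<phi> = k)
    [{[x3, \<xi> *s x3, 0, 0] |\<xi>. True}, {[x4, 0, 0, 0]}, {[x3, x4, 0, 0]},
     {[x3, \<xi> *s x3, x4, 0] |\<xi>. True}, {[0, 0, 0, x3]}, {[0, x4, 0, x3]}]
    [[False, True, True, True, True, False],
     [False, True, True, True, False, True], [False, True, True, True, False, False],
     [False, False, False, False, False, False],
     [False, True, False, True, True, False], [False, False, False, True, False, False]]"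
  using assms p_pos
  by (auto simp: nilpotent_iff profile_eq e_2 coords k_eq_iff not_all_zero)

lemma has_normal_formI:
  assumes "br y1 y2 = y3" "k3 y3 \<noteq> 0" "k1 y4 = 0" "k2 y4 = 0" "k4 y4 \<noteq> 0"
    and "\<phi> y1 = a1 *s y3 + b1 *s y4" "\<phi> y2 = a2 *s y3 + b2 *s y4"
    and "\<phi> y3 = a3 *s y3 + b3 *s y4" "\<phi> y4 = a4 *s y3 + b4 *s y4"
    and "v1 = a1 *s x3 + b1 *s x4" "v2 = a2 *s x3 + b2 *s x4"
    and "v3 = a3 *s x3 + b3 *s x4" "v4 = a4 *s x3 + b4 *s x4"
  shows "has_normal_form \<phi> xs [v1, v2, v3, v4]"
  using assms(1-9) unfolding assms(10-13)
  by (subst has_normal_form_iff, simp)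
    (rule exI[of _ y1], rule exI[of _ y2], rule exI[of _ y3], rule exI[of _ y4], simp)

context
  fixes \<phi> v1 v2 v3 v4
  assumes \<phi>: "p_map_with_values scale br xs [v1, v2, v3, v4] \<phi>" and nil: "p_nilpotent \<phi>"
begin

lemma values_killed: "\<phi> v3 = 0" "\<phi> v4 = 0"
  using nil nilpotent_iff[OF \<phi>] by auto

text \<open>Eigenvalues of a nilpotent semilinear map vanish: once \<open>x\<^sub>3\<close> is an eigenvector it is killed, and then
the same holds for \<open>x\<^sub>4\<close> modulo \<open>x\<^sub>3\<close>.\<close>

lemma values_central_nilpotent:
  assumes "k4 v3 = 0"
  shows "v3 = 0" "k4 v4 = 0"
proof -
  have "k3 (\<phi> v3) = k3 v3 ^ p * k3 v3"
    using assms by (simp add: coords[OF \<phi>] values_central[OF \<phi>])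
  then show v3: "v3 = 0"
    using values_killed assms values_central[OF \<phi>] by (auto simp: k_eq_iff)
  have "k4 (\<phi> v4) = k4 v4 ^ p * k4 v4"
    using v3 by (simp add: coords[OF \<phi>] values_central[OF \<phi>])
  then show "k4 v4 = 0"
    using values_killed by auto
qed

text \<open>Here \<open>\<phi>\<close> maps \<open>x\<^sub>4\<close> to a nonzero multiple of \<open>x\<^sub>3\<close>, so adding a multiple of \<open>x\<^sub>4\<close> to an element adjusts the
\<open>x\<^sub>3\<close>-component of its value at will. What remains is the semilinear form given by the
\<open>x\<^sub>4\<close>-components.\<close>

lemma normal_form_center_to_bracket:
  assumes "k4 v3 = 0" "k3 v4 \<noteq> 0"
  shows "has_normal_form \<phi> xs [0, 0, 0, x3] \<or> has_normal_form \<phi> xs [0, x4, 0, x3]"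
proof -
  note v3 = values_central_nilpotent(1)[OF assms(1)] and v4 = values_central_nilpotent(2)[OF assms(1)]
  have \<phi>4: "\<phi> (t *s x4) = (t ^ p * k3 v4) *s x3" for t
    using v4 by (simp add: k_eq_iff coords[OF \<phi>])
  have \<phi>3: "\<phi> (t *s x3) = 0" for t
    using v3 by (simp add: scale[OF \<phi>] values_eq[OF \<phi>])
  have correct: "\<exists>c. \<phi> (a *s x1 + b *s x2 + c *s x4) = (a ^ p * k4 v1 + b ^ p * k4 v2) *s x4" for a b
  proof -
    obtain c where "c ^ p = - (a ^ p * k3 v1 + b ^ p * k3 v2 + e * a * b) / k3 v4"
      using perfect by blast
    then show ?thesis
      using assms v4 by (intro exI[of _ c]) (simp add: k_eq_iff coords[OF \<phi>])
  qed
  show ?thesis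
  proof (cases "k4 v1 = 0 \<and> k4 v2 = 0")
    case True
    obtain c1 where c1: "\<phi> (1 *s x1 + 0 *s x2 + c1 *s x4) = (1 ^ p * k4 v1 + 0 ^ p * k4 v2) *s x4"
      using correct by blast
    obtain c2 where c2: "\<phi> (0 *s x1 + 1 *s x2 + c2 *s x4) = (0 ^ p * k4 v1 + 1 ^ p * k4 v2) *s x4"
      using correct by blast
    obtain t where t: "t ^ p = inverse (k3 v4)" using perfect by blast
    have "t \<noteq> 0" using t assms p_pos by auto
    have "has_normal_form \<phi> xs [0, 0, 0, x3]"
      by (rule has_normal_formI[of "x1 + c1 *s x4" "x2 + c2 *s x4" x3 "t *s x4" _ 0 0 0 0 0 0 1 0])
        (use True c1 c2 t assms \<open>t \<noteq> 0\<close> \<phi>3[of 1] in \<open>simp_all add: \<phi>4 k_eq_iff[of "br _ _"]\<close>)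
    then show ?thesis ..
  next
    case False
    then obtain \<alpha> \<beta> \<gamma> \<delta> where det: "\<alpha> * \<delta> - \<beta> * \<gamma> = 1" and kill: "\<alpha> ^ p * k4 v1 + \<beta> ^ p * k4 v2 = 0"
      and w0: "\<gamma> ^ p * k4 v1 + \<delta> ^ p * k4 v2 \<noteq> 0"
      using unimodular_kill_form by metis
    define w where "w = \<gamma> ^ p * k4 v1 + \<delta> ^ p * k4 v2"
    \<comment> \<open>The determinant \<open>s\<close> of the new pair is forced: \<open>y\<^sub>4 = w x\<^sub>4\<close> must be mapped to \<open>y\<^sub>3 = s x\<^sub>3\<close>.\<close>
    define s where "s = w ^ p * k3 v4"
    have s0: "s \<noteq> 0" using w0 assms by (simp add: s_def w_def)
    obtain c1 where c1: "\<phi> ((s * \<alpha>) *s x1 + (s * \<beta>) *s x2 + c1 *s x4) =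
        ((s * \<alpha>) ^ p * k4 v1 + (s * \<beta>) ^ p * k4 v2) *s x4" (is "\<phi> ?y1 = _")
      using correct by blast
    obtain c2 where c2: "\<phi> (\<gamma> *s x1 + \<delta> *s x2 + c2 *s x4) = (\<gamma> ^ p * k4 v1 + \<delta> ^ p * k4 v2) *s x4"
        (is "\<phi> ?y2 = _")
      using correct by blast
    have "\<phi> ?y1 = (s ^ p * (\<alpha> ^ p * k4 v1 + \<beta> ^ p * k4 v2)) *s x4"
      unfolding c1 by (simp add: power_mult_distrib algebra_simps)
    then have "\<phi> ?y1 = 0" by (simp add: kill)
    moreover have "\<phi> ?y2 = w *s x4" by (simp add: c2 w_def)
    moreover have "br ?y1 ?y2 = (s * (\<alpha> * \<delta> - \<beta> * \<gamma>)) *s x3"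
      by (simp add: k_eq_iff algebra_simps)
    then have "br ?y1 ?y2 = s *s x3"
      by (simp add: det)
    moreover have "\<phi> (w *s x4) = s *s x3" by (simp add: \<phi>4 s_def)
    ultimately have "has_normal_form \<phi> xs [0, x4, 0, x3]"
      by (intro has_normal_formI[of ?y1 ?y2 "s *s x3" "w *s x4" _ 0 0 0 1 0 0 1 0])
        (use s0 w0 in \<open>simp_all add: \<phi>3 w_def[symmetric]\<close>)
    then show ?thesis ..
  qed
qed

text \<open>A vector \<open>y\<^sub>1\<close> whose value lies on the line of \<open>x\<^sub>3\<close> is unique up to scalars and central summands. The
two normal forms are distinguished by whether that value \<open>f x\<^sub>3\<close> vanishes.\<close>

lemma normal_form_center_killed:
  assumes "v3 = 0" "v4 = 0" "k4 v1 \<noteq> 0 \<or> k4 v2 \<noteq> 0"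
  shows "has_normal_form \<phi> xs [x4, 0, 0, 0] \<or> has_normal_form \<phi> xs [x3, x4, 0, 0]"
proof -
  have \<phi>_Z: "\<phi> z = 0" if "k1 z = 0" "k2 z = 0" for z
    using that assms by (simp add: k_eq_iff coords[OF \<phi>])
  obtain \<alpha> \<beta> \<gamma> \<delta> where det: "\<alpha> * \<delta> - \<beta> * \<gamma> = 1" and kill: "\<alpha> ^ p * k4 v1 + \<beta> ^ p * k4 v2 = 0"
    and w0: "\<gamma> ^ p * k4 v1 + \<delta> ^ p * k4 v2 \<noteq> 0"
    using assms(3) unimodular_kill_form by metis
  define y1 y2 where "y1 = \<alpha> *s x1 + \<beta> *s x2" and "y2 = \<gamma> *s x1 + \<delta> *s x2"
  define f where "f = k3 (\<phi> y1)"
  have "k4 (\<phi> y1) = 0" and \<phi>y2: "k4 (\<phi> y2) \<noteq> 0"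
    using kill w0 by (simp_all add: coords[OF \<phi>] y1_def y2_def)
  then have \<phi>y1: "\<phi> y1 = f *s x3"
    using coords(1,2)[OF \<phi>, of y1] by (simp add: k_eq_iff f_def)
  have "br y1 y2 = (\<alpha> * \<delta> - \<beta> * \<gamma>) *s x3"
    by (simp add: k_eq_iff y1_def y2_def)
  then have y12: "br y1 y2 = x3" by (simp add: det)
  then have y21: "br y2 y1 = - x3" by (simp add: br_anticommute[of y2 y1])
  note \<phi>_central = coords(1,2)[OF \<phi>]
  show ?thesis
  proof (cases "f = 0")
    case True
    have "has_normal_form \<phi> xs [x4, 0, 0, 0]"
      by (rule has_normal_formI[of y2 y1 "- x3" "\<phi> y2" _ 0 1 0 0 0 0 0 0])
        (use \<phi>y2 True in \<open>simp_all add: y21 \<phi>y1 \<phi>_central \<phi>_Z\<close>)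
    then show ?thesis ..
  next
    case False
    \<comment> \<open>Scaling \<open>y\<^sub>2\<close> by \<open>f\<close> turns \<open>[y\<^sub>1, y\<^sub>2] = x\<^sub>3\<close> into \<open>f x\<^sub>3 = \<phi>(y\<^sub>1)\<close>.\<close>
    have "has_normal_form \<phi> xs [x3, x4, 0, 0]"
      by (rule has_normal_formI[of y1 "f *s y2" "f *s x3" "\<phi> (f *s y2)" _ 1 0 0 1 0 0 0 0])
        (use \<phi>y2 False in \<open>simp_all add: br_scale_right y12 \<phi>y1 \<phi>_central \<phi>_Z scale[OF \<phi>]\<close>)
    then show ?thesis ..
  qed
qed

text \<open>The two remaining situations have a common shape, with \<open>r = 1\<close> if \<open>\<phi>\<close> does not kill \<open>x\<^sub>3\<close> and \<open>r = 0\<close>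
otherwise. In the former case \<open>y\<^sub>4 = \<phi>(x\<^sub>3)\<close> completes \<open>x\<^sub>3\<close> to a basis of the centre, and multiples of \<open>x\<^sub>3\<close>
absorb the other components of \<open>\<phi>(x\<^sub>1)\<close> and \<open>\<phi>(x\<^sub>2)\<close>.\<close>

lemma adapted_pair:
  assumes "k4 v3 \<noteq> 0 \<or> (v3 = 0 \<and> v4 = 0 \<and> k4 v1 = 0 \<and> k4 v2 = 0)"
  obtains y1 y2 y4 u v r where "k1 y1 = 1" "k2 y1 = 0" "k1 y2 = 0" "k2 y2 = 1" "k1 y4 = 0" "k2 y4 = 0"
    "k4 y4 \<noteq> 0" "\<phi> y1 = u *s x3" "\<phi> y2 = v *s x3" "\<phi> x3 = r *s y4" "\<phi> y4 = 0"
    "r = (if v3 = 0 then 0 else 1)"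
proof (cases "k4 v3 = 0")
  case True
  then have "v3 = 0 \<and> v4 = 0 \<and> k4 v1 = 0 \<and> k4 v2 = 0"
    using assms by blast
  then show thesis
    by (intro that[of x1 x2 x4 "k3 v1" "k3 v2" 0])
      (simp_all add: values_eq[OF \<phi>] k_eq_iff values_central[OF \<phi>])
next
  case False
  obtain b1 b2 where b: "b1 ^ p = k4 v1 / k4 v3" "b2 ^ p = k4 v2 / k4 v3"
    using perfect by metis
  let ?y1 = "x1 + (- b1) *s x3" and ?y2 = "x2 + (- b2) *s x3"
  have "\<phi> ?y1 = k3 (\<phi> ?y1) *s x3" "\<phi> ?y2 = k3 (\<phi> ?y2) *s x3"
    using False by (simp_all add: k_eq_iff coords[OF \<phi>] frobenius_minus b)
  then show thesis
    using False values_killed values_eq[OF \<phi>] values_central[OF \<phi>]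
    by (intro that[of ?y1 ?y2 v3 _ _ 1]) auto
qed

text \<open>A pair of determinant \<open>D\<close> has bracket \<open>D x\<^sub>3\<close>, so values of \<open>\<phi>\<close> on the line of \<open>x\<^sub>3\<close> get divided by \<open>D\<close>; the
remaining basis vector is \<open>D\<^sup>p y\<^sub>4\<close> because \<open>\<phi>(D x\<^sub>3) = r D\<^sup>p y\<^sub>4\<close>.\<close>

lemma normal_form_pair:
  assumes y: "k1 y1 = 1" "k2 y1 = 0" "k1 y2 = 0" "k2 y2 = 1" "k1 y4 = 0" "k2 y4 = 0" "k4 y4 \<noteq> 0"
    and \<phi>y: "\<phi> y1 = u *s x3" "\<phi> y2 = v *s x3" "\<phi> x3 = r *s y4" "\<phi> y4 = 0"
    and D: "D = \<alpha> * \<delta> - \<beta> * \<gamma>" "D \<noteq> 0"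
    and s: "\<alpha> ^ p * u + \<beta> ^ p * v + e * \<alpha> * \<beta> = s * D"
    and t: "\<gamma> ^ p * u + \<delta> ^ p * v + e * \<gamma> * \<delta> = t * D"
  shows "has_normal_form \<phi> xs [s *s x3, t *s x3, r *s x4, 0]"
proof -
  have \<phi>_pair: "\<phi> (a *s y1 + b *s y2) = (a ^ p * u + b ^ p * v + e * a * b) *s x3" for a b
    by (simp add: add[OF \<phi>] scale[OF \<phi>] \<phi>y y scale_left_distrib algebra_simps)
  have "br (\<alpha> *s y1 + \<beta> *s y2) (\<gamma> *s y1 + \<delta> *s y2) = D *s x3"
    by (simp add: k_eq_iff y D)
  moreover have "\<phi> (\<alpha> *s y1 + \<beta> *s y2) = s *s D *s x3" "\<phi> (\<gamma> *s y1 + \<delta> *s y2) = t *s D *s x3"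
    by (simp_all add: \<phi>_pair s t)
  moreover have "\<phi> (D *s x3) = r *s D ^ p *s y4" "\<phi> (D ^ p *s y4) = 0"
    by (simp_all add: scale[OF \<phi>] \<phi>y mult.commute)
  ultimately show ?thesis
    by (intro has_normal_formI[of "\<alpha> *s y1 + \<beta> *s y2" "\<gamma> *s y1 + \<delta> *s y2" "D *s x3" "D ^ p *s y4" _ s 0 t 0 0 r 0 0])
      (use D y in simp_all)
qed

lemma normal_form_odd:
  assumes "p \<noteq> 2"
  shows "\<exists>vs\<in>{[0, 0, 0, 0], [x3, 0, 0, 0], [x4, 0, 0, 0], [x3, x4, 0, 0],
     [0, 0, x4, 0], [0, x3, x4, 0], [0, 0, 0, x3], [0, x4, 0, x3]}. has_normal_form \<phi> xs vs"
proof -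
  consider "k4 v3 = 0" "k3 v4 \<noteq> 0" | "v3 = 0" "v4 = 0" "k4 v1 \<noteq> 0 \<or> k4 v2 \<noteq> 0"
    | "k4 v3 \<noteq> 0 \<or> (v3 = 0 \<and> v4 = 0 \<and> k4 v1 = 0 \<and> k4 v2 = 0)"
    using values_central_nilpotent values_central[OF \<phi>] by (auto simp: k_eq_iff[of v4])
  then show ?thesis
  proof cases
    case 1
    then show ?thesis using normal_form_center_to_bracket by blast
  next
    case 2
    then show ?thesis using normal_form_center_killed by blast
  next
    case 3
    from adapted_pair[OF this] obtain y1 y2 y4 u v r
      where y: "k1 y1 = 1" "k2 y1 = 0" "k1 y2 = 0" "k2 y2 = 1" "k1 y4 = 0" "k2 y4 = 0" "k4 y4 \<noteq> 0"
        and \<phi>y: "\<phi> y1 = u *s x3" "\<phi> y2 = v *s x3" "\<phi> x3 = r *s y4" "\<phi> y4 = 0"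
        and r: "r = (if v3 = 0 then 0 else 1)" .
    note nf = normal_form_pair[OF y \<phi>y]
    show ?thesis
    proof (cases "u = 0 \<and> v = 0")
      case True
      then have "has_normal_form \<phi> xs [0, 0, r *s x4, 0]"
        using nf[of 1 1 1 0 0 0 0] assms by (simp add: e_odd)
      then show ?thesis by (simp add: r split: if_splits)
    next
      case False
      then obtain \<alpha> \<beta> \<gamma> \<delta> where det: "\<alpha> * \<delta> - \<beta> * \<gamma> = 1" and kill: "\<alpha> ^ p * u + \<beta> ^ p * v = 0"
        and w0: "\<gamma> ^ p * u + \<delta> ^ p * v \<noteq> 0"
        using unimodular_kill_form by metis
      define w where "w = \<gamma> ^ p * u + \<delta> ^ p * v"
      have kill': "(c * \<alpha>) ^ p * u + (c * \<beta>) ^ p * v = 0" for c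
        using kill by (simp add: power_mult_distrib mult.assoc flip: distrib_left)
      \<comment> \<open>The second pair is the first one with its members interchanged and a sign that keeps the determinant.\<close>
      have D: "w = w * \<alpha> * \<delta> - w * \<beta> * \<gamma>" "w = \<gamma> * (- w * \<beta>) - \<delta> * (- w * \<alpha>)"
        using arg_cong[OF det, of "\<lambda>c. w * c"] by (simp_all add: algebra_simps)
      have "has_normal_form \<phi> xs [0 *s x3, 1 *s x3, r *s x4, 0]" "has_normal_form \<phi> xs [1 *s x3, 0 *s x3, r *s x4, 0]"
        using nf[OF D(1), of 0 1] nf[OF D(2), of 1 0] kill'[of w] kill'[of "- w"] w0 assms by (simp_all add: e_odd w_def)
      then show ?thesis by (simp add: r split: if_splits)
    qed
  qed
qed

lemma normal_form_2:
  assumes "p = 2"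
  shows "\<exists>vs\<in>{[x3, \<xi> *s x3, 0, 0] |\<xi>. True} \<union> {[x4, 0, 0, 0], [x3, x4, 0, 0]} \<union>
     {[x3, \<xi> *s x3, x4, 0] |\<xi>. True} \<union> {[0, 0, 0, x3], [0, x4, 0, x3]}. has_normal_form \<phi> xs vs"
proof -
  consider "k4 v3 = 0" "k3 v4 \<noteq> 0" | "v3 = 0" "v4 = 0" "k4 v1 \<noteq> 0 \<or> k4 v2 \<noteq> 0"
    | "k4 v3 \<noteq> 0 \<or> (v3 = 0 \<and> v4 = 0 \<and> k4 v1 = 0 \<and> k4 v2 = 0)"
    using values_central_nilpotent values_central[OF \<phi>] by (auto simp: k_eq_iff[of v4])
  then show ?thesis
  proof cases
    case 1
    then show ?thesis using normal_form_center_to_bracket by blast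
  next
    case 2
    then show ?thesis using normal_form_center_killed by blast
  next
    case 3
    from adapted_pair[OF this] obtain y1 y2 y4 u v r
      where y: "k1 y1 = 1" "k2 y1 = 0" "k1 y2 = 0" "k2 y2 = 1" "k1 y4 = 0" "k2 y4 = 0" "k4 y4 \<noteq> 0"
        and \<phi>y: "\<phi> y1 = u *s x3" "\<phi> y2 = v *s x3" "\<phi> x3 = r *s y4" "\<phi> y4 = 0"
        and r: "r = (if v3 = 0 then 0 else 1)" .
    obtain \<alpha> \<beta> \<gamma> \<delta> \<xi> where "\<alpha> * \<delta> - \<beta> * \<gamma> \<noteq> 0"
      "\<alpha>\<^sup>2 * u + \<beta>\<^sup>2 * v + \<alpha> * \<beta> = \<alpha> * \<delta> - \<beta> * \<gamma>"
      "\<gamma>\<^sup>2 * u + \<delta>\<^sup>2 * v + \<gamma> * \<delta> = \<xi> * (\<alpha> * \<delta> - \<beta> * \<gamma>)"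
      by (rule quadratic_form_normalized_pair)
    then have "has_normal_form \<phi> xs [1 *s x3, \<xi> *s x3, r *s x4, 0]"
      using normal_form_pair[OF y \<phi>y refl, of \<alpha> \<delta> \<beta> \<gamma> 1 \<xi>]
      unfolding e_2[OF assms] by (simp add: assms)
    then show ?thesis
      by (cases "v3 = 0") (auto simp: r)
  qed
qed

end

theorem classification_odd:
  assumes "p \<noteq> 2"
  shows "nilpotent_p_maps_listed scale br xs
    [{[0, 0, 0, 0]}, {[x3, 0, 0, 0]}, {[x4, 0, 0, 0]}, {[x3, x4, 0, 0]},
     {[0, 0, x4, 0]}, {[0, x3, x4, 0]}, {[0, 0, 0, x3]}, {[0, x4, 0, x3]}]"
    (is "nilpotent_p_maps_listed _ _ _ ?items")
proof (rule nilpotent_p_maps_listedI[OF basis profile_invariant _ _ profile_items_odd[OF assms]])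
  fix \<phi> assume *: "p_map scale br \<phi>" "p_nilpotent \<phi>"
  then have "p_map_with_values scale br xs [\<phi> x1, \<phi> x2, \<phi> x3, \<phi> x4] \<phi>"
    by (simp add: p_map_with_values_def)
  from normal_form_odd[OF this *(2) assms]
  show "\<exists>I\<in>set ?items.
     \<exists>vs\<in>I. has_normal_form \<phi> xs vs" by auto
qed (auto intro!: p_map_exists)

theorem classification_2:
  assumes "p = 2"
  shows "nilpotent_p_maps_listed scale br xs
    [{[x3, \<xi> *s x3, 0, 0] |\<xi>. True}, {[x4, 0, 0, 0]}, {[x3, x4, 0, 0]},
     {[x3, \<xi> *s x3, x4, 0] |\<xi>. True}, {[0, 0, 0, x3]}, {[0, x4, 0, x3]}]"
    (is "nilpotent_p_maps_listed _ _ _ ?items")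
proof (rule nilpotent_p_maps_listedI[OF basis profile_invariant _ _ profile_items_2[OF assms]])
  fix \<phi> assume *: "p_map scale br \<phi>" "p_nilpotent \<phi>"
  then have "p_map_with_values scale br xs [\<phi> x1, \<phi> x2, \<phi> x3, \<phi> x4] \<phi>"
    by (simp add: p_map_with_values_def)
  from normal_form_2[OF this *(2) assms]
  show "\<exists>I\<in>set ?items.
     \<exists>vs\<in>I. has_normal_form \<phi> xs vs" by auto
qed (auto intro!: p_map_exists)

text \<open>The automorphism \<open>x\<^sub>2 \<mapsto> \<delta> x\<^sub>1 + x\<^sub>2\<close> changes \<open>\<xi>\<close> by \<open>\<delta> + \<delta>\<^sup>2\<close>; by the Arf invariant no other changes
occur. The scalar \<open>r\<close> selects
the family, \<open>0\<close> if \<open>x\<^sub>3\<close> is killed and \<open>1\<close> if it is mapped to \<open>x\<^sub>4\<close>.\<close>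

theorem family_iff_artin_schreier:
  assumes "p = 2"
  shows "equivalent_values scale br xs [x3, \<xi>1 *s x3, r *s x4, 0] [x3, \<xi>2 *s x3, r *s x4, 0] \<longleftrightarrow>
    \<xi>1 + \<xi>2 \<in> artin_schreier"
proof
  assume "equivalent_values scale br xs [x3, \<xi>1 *s x3, r *s x4, 0] [x3, \<xi>2 *s x3, r *s x4, 0]"
  then obtain \<phi> where \<phi>: "p_map_with_values scale br xs [x3, \<xi>1 *s x3, r *s x4, 0] \<phi>"
    and "has_normal_form \<phi> xs [x3, \<xi>2 *s x3, r *s x4, 0]"
    unfolding equivalent_values_iff[OF basis] by blast
  then obtain y1 y2 y3 y4 where y3: "br y1 y2 = y3" "k3 y3 \<noteq> 0"
    and \<phi>y: "\<phi> y1 = y3" "\<phi> y2 = \<xi>2 *s y3"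
    by (subst (asm) has_normal_form_iff) auto
  show "\<xi>1 + \<xi>2 \<in> artin_schreier"
  proof (rule arf_invariant[OF assms])
    show "k3 y3 = k1 y1 * k2 y2 - k2 y1 * k1 y2" "k3 y3 \<noteq> 0"
      using y3 by auto
    show "(k1 y1)\<^sup>2 + \<xi>1 * (k2 y1)\<^sup>2 + k1 y1 * k2 y1 = k3 y3"
      "(k1 y2)\<^sup>2 + \<xi>1 * (k2 y2)\<^sup>2 + k1 y2 * k2 y2 = \<xi>2 * k3 y3"
      using arg_cong[OF \<phi>y(1), of k3] arg_cong[OF \<phi>y(2), of k3]
      unfolding coords[OF \<phi>] e_2[OF assms] by (simp_all add: assms mult.commute)
  qed
next
  assume "\<xi>1 + \<xi>2 \<in> artin_schreier"
  then obtain \<delta> where "\<xi>1 + \<xi>2 = \<delta> + \<delta>\<^sup>2" by (auto simp: artin_schreier_def)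
  then have "\<xi>2 = \<delta> + \<delta>\<^sup>2 - \<xi>1"
    by (simp add: eq_diff_eq add.commute)
  then have \<xi>2: "\<xi>2 = \<delta>\<^sup>2 + \<xi>1 + \<delta>"
    by (simp only: char_2_diff[OF assms] ac_simps)
  obtain \<phi> where \<phi>: "p_map_with_values scale br xs [x3, \<xi>1 *s x3, r *s x4, 0] \<phi>"
    using p_map_exists[of x3 "\<xi>1 *s x3" "r *s x4" 0] by auto
  have "\<phi> (\<delta> *s x1 + x2) = \<xi>2 *s x3"
    unfolding k_eq_iff coords[OF \<phi>] e_2[OF assms] by (simp add: assms \<xi>2)
  then have "has_normal_form \<phi> xs [x3, \<xi>2 *s x3, r *s x4, 0]"
    by (intro has_normal_formI[of x1 "\<delta> *s x1 + x2" x3 x4 _ 1 0 \<xi>2 0 0 r 0 0])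
      (simp_all add: values_eq[OF \<phi>] k_eq_iff[of "br _ _"])
  with \<phi> show "equivalent_values scale br xs [x3, \<xi>1 *s x3, r *s x4, 0] [x3, \<xi>2 *s x3, r *s x4, 0]"
    unfolding equivalent_values_iff[OF basis] by blast
qed

end

section \<open>The three-dimensional Heisenberg algebra\<close>

locale lie_algebra_basis3 = perfect_lie_algebra scale br p
  for scale :: "'f::field \<Rightarrow> 'l::ab_group_add \<Rightarrow> 'l" (infixr "*s" 75) and br p +
  fixes x1 x2 x3 :: 'l
  assumes basis: "is_basis scale [x1, x2, x3]"
begin

abbreviation "xs \<equiv> [x1, x2, x3]"

definition "k1 x = coord xs x 0"
definition "k2 x = coord xs x 1"
definition "k3 x = coord xs x 2"

lemmas k_defs = k1_def k2_def k3_def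

lemma k_add [simp]: "k1 (x + y) = k1 x + k1 y" "k2 (x + y) = k2 x + k2 y" "k3 (x + y) = k3 x + k3 y"
  by (simp_all add: k_defs coord_add[OF basis])

lemma k_scale [simp]: "k1 (\<alpha> *s x) = \<alpha> * k1 x" "k2 (\<alpha> *s x) = \<alpha> * k2 x" "k3 (\<alpha> *s x) = \<alpha> * k3 x"
  by (simp_all add: k_defs coord_scale[OF basis])

lemma k_zero [simp]: "k1 0 = 0" "k2 0 = 0" "k3 0 = 0"
  using k_scale[of 0 0] by simp_all

lemma k_minus [simp]: "k1 (- x) = - k1 x" "k2 (- x) = - k2 x" "k3 (- x) = - k3 x"
  using k_scale[of "- 1" x] by simp_all

lemma k_basis [simp]:
  "k1 x1 = 1" "k1 x2 = 0" "k1 x3 = 0" "k2 x1 = 0" "k2 x2 = 1" "k2 x3 = 0" "k3 x1 = 0" "k3 x2 = 0" "k3 x3 = 1"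
  using coord_basis[OF basis, of _ 0] coord_basis[OF basis, of _ 1] coord_basis[OF basis, of _ 2]
  by (simp_all add: k_defs numeral_2_eq_2)

lemma k_eq_iff: "x = y \<longleftrightarrow> k1 x = k1 y \<and> k2 x = k2 y \<and> k3 x = k3 y"
  using coord_eq_iff[OF basis, of x y] by (simp add: k_defs All_less_Suc numeral_eq_Suc conj_ac)

lemma expand: "x = k1 x *s x1 + k2 x *s x2 + k3 x *s x3"
  by (simp add: k_eq_iff)

lemma is_basis3I:
  assumes "\<And>a b c. a *s y1 + b *s y2 + c *s y3 = 0 \<Longrightarrow> a = 0 \<and> b = 0 \<and> c = 0"
  shows "is_basis scale [y1, y2, y3]"
proof (rule basis_of_independent_list[OF basis])
  fix c assume "(\<Sum>i<length [y1, y2, y3]. c i *s [y1, y2, y3] ! i) = 0"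
  then show "\<forall>i<length [y1, y2, y3]. c i = 0"
    using assms[of "c 0" "c 1" "c 2"] by (simp add: All_less_Suc numeral_eq_Suc)
qed simp

end

locale heisenberg3 = lie_algebra_basis3 scale br p x1 x2 x3
  for scale :: "'f::field \<Rightarrow> 'l::ab_group_add \<Rightarrow> 'l" (infixr "*s" 75) and br p and x1 x2 x3 :: 'l +
  assumes br12: "br x1 x2 = x3" and br13: "br x1 x3 = 0" and br23: "br x2 x3 = 0"
begin

lemma br_coords: "br x y = (k1 x * k2 y - k2 x * k1 y) *s x3"
proof -
  have "br x2 x1 = - x3" "br x3 x1 = 0" "br x3 x2 = 0"
    using br_anticommute[of x2 x1] br_anticommute[of x3 x1] br_anticommute[of x3 x2]
    by (simp_all add: br12 br13 br23)
  then have "br (k1 x *s x1 + k2 x *s x2 + k3 x *s x3) (k1 y *s x1 + k2 y *s x2 + k3 y *s x3) =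
      (k1 x * k2 y - k2 x * k1 y) *s x3"
    by (simp add: br_add_left br_add_right br_scale_left br_scale_right br_self br12 br13 br23 k_eq_iff)
  then show ?thesis
    by (simp only: expand[symmetric])
qed

lemma k_br [simp]: "k1 (br x y) = 0" "k2 (br x y) = 0" "k3 (br x y) = k1 x * k2 y - k2 x * k1 y"
  by (simp_all add: br_coords)

lemma central_iff: "(\<forall>b. br z b = 0) \<longleftrightarrow> k1 z = 0 \<and> k2 z = 0"
proof
  assume "\<forall>b. br z b = 0"
  then have "k3 (br z x1) = 0" "k3 (br z x2) = 0" by simp_all
  then show "k1 z = 0 \<and> k2 z = 0" by simp
qed (simp add: k_eq_iff)

lemma class_2: "upper_central 2 = UNIV"
  by (auto simp: numeral_2_eq_2 k_eq_iff)

definition e :: 'f where "e = (if p = 2 then 1 else 0)"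

lemma e_2: "p = 2 \<Longrightarrow> e = 1" and e_odd: "p \<noteq> 2 \<Longrightarrow> e = 0"
  unfolding e_def by simp_all

lemma p_map_formula:
  "p_map scale br \<phi> \<longleftrightarrow>
    (\<forall>i<length xs. \<forall>b. br (\<phi> (xs ! i)) b = 0) \<and>
    (\<forall>x. \<phi> x = (\<Sum>i<length xs. coord xs x i ^ p *s \<phi> (xs ! i)) + (e * k1 x * k2 x) *s x3)"
proof (cases "p = 2")
  case True
  show ?thesis
  proof (rule p_map_iff_formula[OF basis p_map_iff_char_2[OF True class_2]])
    fix a b
    show "(e * k1 (a + b) * k2 (a + b)) *s x3 =
      (e * k1 a * k2 a) *s x3 + (e * k1 b * k2 b) *s x3 + br b a"
      unfolding e_def by (simp add: k_eq_iff True char_2_diff[OF True, of "k1 b * k2 a" "k2 b * k1 a"])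
        (simp add: algebra_simps)
  qed (auto simp: True k_eq_iff power2_eq_square numeral_eq_Suc less_Suc_eq)
next
  case False
  then have "2 \<le> p - 1" using prime_ge_2_nat[OF prime_p] by simp
  then have "upper_central (p - 1) = UNIV"
    using class_2 upper_central_eq_UNIV_mono by blast
  from p_map_iff_formula[OF basis p_map_iff_small_class[OF this], where q = "\<lambda>_. 0"] False show ?thesis
    by (simp add: e_def)
qed

lemma p_map_exists:
  assumes "\<forall>v\<in>{v1, v2, v3}. k1 v = 0 \<and> k2 v = 0"
  shows "\<exists>\<phi>. p_map_with_values scale br xs [v1, v2, v3] \<phi>"
proof (rule p_map_with_values_exists[OF basis _ _ _ p_map_formula])
  fix v b assume "v \<in> set [v1, v2, v3]"
  then show "br v b = 0" using assms central_iff[of v] by auto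
qed (auto simp: k_eq_iff numeral_eq_Suc less_Suc_eq)

lemma coords:
  assumes \<phi>: "p_map_with_values scale br xs [v1, v2, v3] \<phi>"
  shows "k1 (\<phi> x) = 0" "k2 (\<phi> x) = 0"
    "k3 (\<phi> x) = k1 x ^ p * k3 v1 + k2 x ^ p * k3 v2 + k3 x ^ p * k3 v3 + e * k1 x * k2 x"
proof -
  have pm: "p_map scale br \<phi>" and v: "v1 = \<phi> x1" "v2 = \<phi> x2" "v3 = \<phi> x3"
    using \<phi> by (auto simp: p_map_with_values_def)
  have central: "k1 (\<phi> (xs ! i)) = 0 \<and> k2 (\<phi> (xs ! i)) = 0" if "i < length xs" for i
    using pm that unfolding p_map_formula central_iff by blast
  have "\<phi> x = (\<Sum>i<length xs. coord xs x i ^ p *s \<phi> (xs ! i)) + (e * k1 x * k2 x) *s x3"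
    using pm unfolding p_map_formula by blast
  then have eq: "\<phi> x = k1 x ^ p *s v1 + k2 x ^ p *s v2 + k3 x ^ p *s v3 + (e * k1 x * k2 x) *s x3"
    by (simp add: k_defs numeral_2_eq_2 add.assoc v)
  show "k1 (\<phi> x) = 0" "k2 (\<phi> x) = 0"
    using central[of 0] central[of 1] central[of 2] by (simp_all add: eq v numeral_2_eq_2)
  from arg_cong[OF eq, of k3]
  show "k3 (\<phi> x) = k1 x ^ p * k3 v1 + k2 x ^ p * k3 v2 + k3 x ^ p * k3 v3 + e * k1 x * k2 x"
    by simp
qed

lemma has_normal_formI:
  assumes y3: "br y1 y2 = y3" "k3 y3 \<noteq> 0"
    and eq: "\<phi> y1 = a1 *s y3" "\<phi> y2 = a2 *s y3" "\<phi> y3 = 0"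
  shows "has_normal_form \<phi> xs [a1 *s x3, a2 *s x3, 0]"
proof -
  have y3_coords: "k1 y3 = 0" "k2 y3 = 0" "k3 y3 = k1 y1 * k2 y2 - k2 y1 * k1 y2"
    by (simp_all add: y3[symmetric])
  have ys: "is_basis scale [y1, y2, y3]"
  proof (rule is_basis3I)
    fix a b c assume *: "a *s y1 + b *s y2 + c *s y3 = 0" (is "?s = 0")
    have "a * k3 y3 = k3 (br ?s y2)" "b * k3 y3 = k3 (br y1 ?s)"
      by (simp_all add: y3_coords algebra_simps)
    then have ab: "a = 0" "b = 0"
      using y3 unfolding * by simp_all
    then have "k3 ?s = c * k3 y3" by simp
    then show "a = 0 \<and> b = 0 \<and> c = 0"
      using y3 ab unfolding * by simp
  qed
  obtain A where A: "lie_automorphism scale br A" "map A xs = [y1, y2, y3]"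
  proof (rule automorphism_of_bases[OF basis ys])
    fix i j :: nat assume ij: "i < j" "j < length xs"
    have "br (xs ! i) (xs ! j) = (\<Sum>k<length xs. (if i = 0 \<and> j = 1 \<and> k = 2 then 1 else 0) *s xs ! k)"
      "br ([y1, y2, y3] ! i) ([y1, y2, y3] ! j) =
         (\<Sum>k<length xs. (if i = 0 \<and> j = 1 \<and> k = 2 then 1 else 0) *s [y1, y2, y3] ! k)"
      using ij y3 y3_coords by (auto simp: numeral_eq_Suc less_Suc_eq k_eq_iff)
    then show "\<exists>c. br (xs ! i) (xs ! j) = (\<Sum>k<length xs. c k *s xs ! k) \<and>
        br ([y1, y2, y3] ! i) ([y1, y2, y3] ! j) = (\<Sum>k<length xs. c k *s [y1, y2, y3] ! k)"
      by (intro exI conjI)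
  qed auto
  interpret A: Vector_Spaces.linear scale scale A
    using A by (simp add: lie_automorphism_def)
  show ?thesis
    unfolding has_normal_form_def
    using A eq by (intro exI[of _ A]) (simp add: A.scale A.zero)
qed

lemma nilpotent_iff:
  assumes \<phi>: "p_map_with_values scale br xs [v1, v2, v3] \<phi>"
  shows "p_nilpotent \<phi> \<longleftrightarrow> v3 = 0"
proof
  have pm: "p_map scale br \<phi>" and v: "v3 = \<phi> x3"
    using \<phi> by (auto simp: p_map_with_values_def)
  have v3: "v3 = k3 v3 *s x3"
    using coords(1,2)[OF \<phi>, of x3] by (simp add: k_eq_iff v)
  assume nil: "p_nilpotent \<phi>"
  have "x3 \<noteq> 0" by (simp add: k_eq_iff)
  then have "k3 v3 = 0"
    using nilpotent_eigenvalue[OF pm nil, of x3 "k3 v3"] v3 v by simp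
  with v3 show "v3 = 0" by simp
next
  assume "v3 = 0"
  then have "\<phi> (\<phi> x) = 0" for x
    using p_pos by (simp add: k_eq_iff coords[OF \<phi>])
  then have "(\<phi> ^^ 2) x = 0" for x by (simp add: numeral_2_eq_2)
  then show "p_nilpotent \<phi>" by (auto simp: p_nilpotent_def)
qed

lemma normal_form_pair:
  assumes \<phi>: "p_map_with_values scale br xs [v1, v2, v3] \<phi>" and nil: "p_nilpotent \<phi>"
    and D: "D = \<alpha> * \<delta> - \<beta> * \<gamma>" "D \<noteq> 0"
    and s: "\<alpha> ^ p * k3 v1 + \<beta> ^ p * k3 v2 + e * \<alpha> * \<beta> = s * D"
    and t: "\<gamma> ^ p * k3 v1 + \<delta> ^ p * k3 v2 + e * \<gamma> * \<delta> = t * D"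
  shows "has_normal_form \<phi> xs [s *s x3, t *s x3, 0]"
proof (rule has_normal_formI)
  have v3: "v3 = 0" using nil nilpotent_iff[OF \<phi>] by simp
  show "br (\<alpha> *s x1 + \<beta> *s x2) (\<gamma> *s x1 + \<delta> *s x2) = D *s x3"
    by (simp add: k_eq_iff D)
  show "k3 (D *s x3) \<noteq> 0" using D by simp
  show "\<phi> (\<alpha> *s x1 + \<beta> *s x2) = s *s (D *s x3)" "\<phi> (\<gamma> *s x1 + \<delta> *s x2) = t *s (D *s x3)"
    "\<phi> (D *s x3) = 0"
    using s t p_pos by (simp_all add: k_eq_iff coords[OF \<phi>] v3)
qed

theorem classification_odd:
  assumes "p \<noteq> 2"
  shows "nilpotent_p_maps_listed scale br xs [{[0, 0, 0]}, {[x3, 0, 0]}]"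
proof (rule nilpotent_p_maps_listedI[OF basis power_zero_invariant[of 1], of "[True, False]"])
  have "power_zero 1 \<phi>" if \<phi>: "p_map_with_values scale br xs [0, 0, 0] \<phi>" for \<phi>
    using e_odd[OF assms] by (simp add: power_zero_def k_eq_iff coords[OF \<phi>])
  moreover have "\<not> power_zero 1 \<phi>" if \<phi>: "p_map_with_values scale br xs [x3, 0, 0] \<phi>" for \<phi>
  proof
    assume "power_zero 1 \<phi>"
    then have "\<phi> x1 = 0" by (simp add: power_zero_def)
    then show False using \<phi> by (simp add: p_map_with_values_def k_eq_iff)
  qed
  ultimately show "list_all2 (\<lambda>I k. \<forall>vs\<in>I. \<forall>\<phi>. p_map_with_values scale br xs vs \<phi> \<longrightarrow>
      p_nilpotent \<phi> \<and> power_zero 1 \<phi> = k) [{[0, 0, 0]}, {[x3, 0, 0]}] [True, False]"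
    by (auto simp: nilpotent_iff)
next
  fix \<phi> assume *: "p_map scale br \<phi>" "p_nilpotent \<phi>"
  then have \<phi>: "p_map_with_values scale br xs [\<phi> x1, \<phi> x2, \<phi> x3] \<phi>"
    by (simp add: p_map_with_values_def)
  have "has_normal_form \<phi> xs [0, 0, 0] \<or> has_normal_form \<phi> xs [x3, 0, 0]"
  proof (cases "k3 (\<phi> x1) = 0 \<and> k3 (\<phi> x2) = 0")
    case True
    then show ?thesis
      using normal_form_pair[OF \<phi> *(2), of 1 1 1 0 0 0 0] e_odd[OF assms] by simp
  next
    case False
    then obtain \<alpha> \<beta> \<gamma> \<delta> where det: "\<alpha> * \<delta> - \<beta> * \<gamma> = 1"
      and kill: "\<alpha> ^ p * k3 (\<phi> x1) + \<beta> ^ p * k3 (\<phi> x2) = 0"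
      and w0: "\<gamma> ^ p * k3 (\<phi> x1) + \<delta> ^ p * k3 (\<phi> x2) \<noteq> 0"
      using unimodular_kill_form by metis
    define w where "w = \<gamma> ^ p * k3 (\<phi> x1) + \<delta> ^ p * k3 (\<phi> x2)"
    have "(- w * \<alpha>) ^ p * k3 (\<phi> x1) + (- w * \<beta>) ^ p * k3 (\<phi> x2) =
        (- w) ^ p * (\<alpha> ^ p * k3 (\<phi> x1) + \<beta> ^ p * k3 (\<phi> x2))"
      by (simp only: power_mult_distrib distrib_left mult.assoc)
    then have kill': "(- w * \<alpha>) ^ p * k3 (\<phi> x1) + (- w * \<beta>) ^ p * k3 (\<phi> x2) = 0"
      using kill by simp
    have D: "w = \<gamma> * (- w * \<beta>) - \<delta> * (- w * \<alpha>)"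
      using arg_cong[OF det, of "\<lambda>c. w * c"] by (simp add: algebra_simps)
    have "has_normal_form \<phi> xs [1 *s x3, 0 *s x3, 0]"
      using normal_form_pair[OF \<phi> *(2) D, of 1 0] kill' w0 e_odd[OF assms] by (simp add: w_def)
    then show ?thesis by simp
  qed
  then show "\<exists>I\<in>set [{[0, 0, 0]}, {[x3, 0, 0]}]. \<exists>vs\<in>I. has_normal_form \<phi> xs vs"
    by auto
qed (auto intro!: p_map_exists)

theorem classification_2:
  assumes "p = 2"
  shows "nilpotent_p_maps_listed scale br xs [{[x3, \<xi> *s x3, 0] |\<xi>. True}]"
proof (rule nilpotent_p_maps_listedI[OF basis, of "\<lambda>_. ()" "[()]"])
  fix \<phi> assume *: "p_map scale br \<phi>" "p_nilpotent \<phi>"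
  then have \<phi>: "p_map_with_values scale br xs [\<phi> x1, \<phi> x2, \<phi> x3] \<phi>"
    by (simp add: p_map_with_values_def)
  obtain \<alpha> \<beta> \<gamma> \<delta> \<xi> where "\<alpha> * \<delta> - \<beta> * \<gamma> \<noteq> 0"
    "\<alpha>\<^sup>2 * k3 (\<phi> x1) + \<beta>\<^sup>2 * k3 (\<phi> x2) + \<alpha> * \<beta> = \<alpha> * \<delta> - \<beta> * \<gamma>"
    "\<gamma>\<^sup>2 * k3 (\<phi> x1) + \<delta>\<^sup>2 * k3 (\<phi> x2) + \<gamma> * \<delta> = \<xi> * (\<alpha> * \<delta> - \<beta> * \<gamma>)"
    by (rule quadratic_form_normalized_pair)
  then have "has_normal_form \<phi> xs [1 *s x3, \<xi> *s x3, 0]"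
    using normal_form_pair[OF \<phi> *(2) refl, of \<alpha> \<delta> \<beta> \<gamma> 1 \<xi>]
    unfolding e_2[OF assms] by (simp add: assms)
  then show "\<exists>I\<in>set [{[x3, \<xi> *s x3, 0] |\<xi>. True}]. \<exists>vs\<in>I. has_normal_form \<phi> xs vs"
    by auto
qed (auto intro!: p_map_exists simp: equivalence_invariant_def nilpotent_iff)

theorem family_iff_artin_schreier:
  assumes "p = 2"
  shows "equivalent_values scale br xs [x3, \<xi>1 *s x3, 0] [x3, \<xi>2 *s x3, 0] \<longleftrightarrow> \<xi>1 + \<xi>2 \<in> artin_schreier"
proof
  assume "equivalent_values scale br xs [x3, \<xi>1 *s x3, 0] [x3, \<xi>2 *s x3, 0]"
  then obtain \<phi> A where \<phi>: "p_map_with_values scale br xs [x3, \<xi>1 *s x3, 0] \<phi>"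
    and A: "lie_automorphism scale br A" "\<phi> (A x1) = A x3" "\<phi> (A x2) = A (\<xi>2 *s x3)"
    unfolding equivalent_values_iff[OF basis] has_normal_form_def by auto
  interpret A: Vector_Spaces.linear scale scale A
    using A by (simp add: lie_automorphism_def)
  have bij: "bij A" and y3: "A x3 = br (A x1) (A x2)"
    using A br12 by (auto simp: lie_automorphism_def)
  have "x3 \<noteq> 0" by (simp add: k_eq_iff)
  then have "A x3 \<noteq> 0" using bij A.zero by (metis bij_is_inj injD)
  show "\<xi>1 + \<xi>2 \<in> artin_schreier"
  proof (rule arf_invariant[OF assms])
    show "k3 (A x3) = k1 (A x1) * k2 (A x2) - k2 (A x1) * k1 (A x2)"
      by (simp add: y3)
    show "k3 (A x3) \<noteq> 0"
      using \<open>A x3 \<noteq> 0\<close> by (simp add: k_eq_iff y3)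
    show "(k1 (A x1))\<^sup>2 + \<xi>1 * (k2 (A x1))\<^sup>2 + k1 (A x1) * k2 (A x1) = k3 (A x3)"
      "(k1 (A x2))\<^sup>2 + \<xi>1 * (k2 (A x2))\<^sup>2 + k1 (A x2) * k2 (A x2) = \<xi>2 * k3 (A x3)"
      using arg_cong[OF A(2), of k3] arg_cong[OF A(3), of k3]
      unfolding coords[OF \<phi>] e_2[OF assms] by (simp_all add: assms mult.commute A.scale)
  qed
next
  assume "\<xi>1 + \<xi>2 \<in> artin_schreier"
  then obtain \<delta> where "\<xi>1 + \<xi>2 = \<delta> + \<delta>\<^sup>2" by (auto simp: artin_schreier_def)
  then have "\<xi>2 = \<delta> + \<delta>\<^sup>2 - \<xi>1"
    by (simp add: eq_diff_eq add.commute)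
  then have \<xi>2: "\<xi>2 = \<delta>\<^sup>2 + \<xi>1 + \<delta>"
    by (simp only: char_2_diff[OF assms] ac_simps)
  obtain \<phi> where \<phi>: "p_map_with_values scale br xs [x3, \<xi>1 *s x3, 0] \<phi>"
    using p_map_exists[of x3 "\<xi>1 *s x3" 0] by auto
  have "has_normal_form \<phi> xs [1 *s x3, \<xi>2 *s x3, 0]"
    using \<phi> e_2[OF assms]
    by (intro normal_form_pair[OF \<phi>, where D = 1 and \<alpha> = 1 and \<delta> = 1 and \<beta> = 0 and \<gamma> = \<delta>])
      (simp_all add: nilpotent_iff assms \<xi>2)
  with \<phi> show "equivalent_values scale br xs [x3, \<xi>1 *s x3, 0] [x3, \<xi>2 *s x3, 0]"
    unfolding equivalent_values_iff[OF basis] by auto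
qed

end

section \<open>The filiform algebra\<close>

locale filiform4 = lie_algebra_basis4 scale br p x1 x2 x3 x4
  for scale :: "'f::field \<Rightarrow> 'l::ab_group_add \<Rightarrow> 'l" (infixr "*s" 75) and br p and x1 x2 x3 x4 :: 'l +
  assumes br12: "br x1 x2 = x3" and br13: "br x1 x3 = x4" and br14: "br x1 x4 = 0"
    and br23: "br x2 x3 = 0" and br24: "br x2 x4 = 0" and br34: "br x3 x4 = 0"
begin

lemma br_coords: "br x y = (k1 x * k2 y - k2 x * k1 y) *s x3 + (k1 x * k3 y - k3 x * k1 y) *s x4"
proof -
  have "br x2 x1 = - x3" "br x3 x1 = - x4" "br x4 x1 = 0" "br x3 x2 = 0" "br x4 x2 = 0" "br x4 x3 = 0"
    using br_anticommute[of x2 x1] br_anticommute[of x3 x1] br_anticommute[of x4 x1]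
      br_anticommute[of x3 x2] br_anticommute[of x4 x2] br_anticommute[of x4 x3]
    by (simp_all add: br12 br13 br14 br23 br24 br34)
  then have "br (k1 x *s x1 + k2 x *s x2 + k3 x *s x3 + k4 x *s x4)
      (k1 y *s x1 + k2 y *s x2 + k3 y *s x3 + k4 y *s x4) =
      (k1 x * k2 y - k2 x * k1 y) *s x3 + (k1 x * k3 y - k3 x * k1 y) *s x4"
    by (simp add: br_add_left br_add_right br_scale_left br_scale_right br_self
        br12 br13 br14 br23 br24 br34 k_eq_iff)
  then show ?thesis
    by (simp only: expand[symmetric])
qed

lemma k_br [simp]: "k1 (br x y) = 0" "k2 (br x y) = 0" "k3 (br x y) = k1 x * k2 y - k2 x * k1 y"
  "k4 (br x y) = k1 x * k3 y - k3 x * k1 y"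
  by (simp_all add: br_coords)

lemma central_iff: "(\<forall>b. br z b = 0) \<longleftrightarrow> k1 z = 0 \<and> k2 z = 0 \<and> k3 z = 0"
proof
  assume *: "\<forall>b. br z b = 0"
  then have "k3 (br z x1) = 0" "k3 (br z x2) = 0" "k4 (br z x1) = 0" by (simp_all only: k_zero)
  then show "k1 z = 0 \<and> k2 z = 0 \<and> k3 z = 0" by simp
qed (simp add: k_eq_iff)

text \<open>A \<open>[2]\<close>-map would give \<open>[\<phi>(x\<^sub>1), x\<^sub>2] = [x\<^sub>1, [x\<^sub>1, x\<^sub>2]] = x\<^sub>4\<close>, but brackets with \<open>x\<^sub>2\<close> are multiples of \<open>x\<^sub>3\<close>.\<close>

lemma not_restrictable_2:
  assumes "p = 2"
  shows "\<not> restrictable scale br"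
proof
  assume "restrictable scale br"
  then obtain \<phi> where "p_map scale br \<phi>" by (auto simp: restrictable_def)
  then have "(br x1 ^^ 2) x2 = br (\<phi> x1) x2"
    using assms p_eq_CHAR by (simp add: p_map_def)
  then have "k4 (br x1 (br x1 x2)) = k4 (br (\<phi> x1) x2)"
    by (simp add: numeral_2_eq_2)
  then show False by simp
qed

lemma class_3: "upper_central 3 = UNIV"
  by (auto simp: numeral_3_eq_3 k_eq_iff)

text \<open>The coefficient of the cubic correction term \<open>a\<^sub>1\<^sup>2 a\<^sub>2 x\<^sub>4\<close>.\<close>

definition e :: 'f where "e = (if p = 3 then 1 else 0)"

lemma e_3: "p = 3 \<Longrightarrow> e = 1" and e_not_3: "p \<noteq> 3 \<Longrightarrow> e = 0"
  unfolding e_def by simp_all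

lemma p_map_formula:
  assumes "p \<noteq> 2"
  shows "p_map scale br \<phi> \<longleftrightarrow>
    (\<forall>i<length xs. \<forall>b. br (\<phi> (xs ! i)) b = 0) \<and>
    (\<forall>x. \<phi> x = (\<Sum>i<length xs. coord xs x i ^ p *s \<phi> (xs ! i)) + (e * (k1 x)\<^sup>2 * k2 x) *s x4)"
proof (cases "p = 3")
  case True
  have three: "(3::'f) = 0"
    by (metis of_nat_CHAR of_nat_numeral True p_eq_CHAR)
  show ?thesis
  proof (rule p_map_iff_formula[OF basis p_map_iff_char_3[OF True class_3]])
    fix a b
    \<comment> \<open>Over the integers the two sides differ by a multiple of \<open>3\<close>.\<close>
    have "(k1 a + k1 b)\<^sup>2 * (k2 a + k2 b) - ((k1 a)\<^sup>2 * k2 a + (k1 b)\<^sup>2 * k2 b +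
        (k1 b * (k1 b * k2 a - k2 b * k1 a) - k1 a * (k1 b * k2 a - k2 b * k1 a))) =
        3 * (k1 a * k1 b * (k2 a + k2 b))"
      by algebra
    then have "(k1 a + k1 b)\<^sup>2 * (k2 a + k2 b) = (k1 a)\<^sup>2 * k2 a + (k1 b)\<^sup>2 * k2 b +
        (k1 b * (k1 b * k2 a - k2 b * k1 a) - k1 a * (k1 b * k2 a - k2 b * k1 a))"
      unfolding three by simp
    then show "(e * (k1 (a + b))\<^sup>2 * k2 (a + b)) *s x4 = (e * (k1 a)\<^sup>2 * k2 a) *s x4 +
        (e * (k1 b)\<^sup>2 * k2 b) *s x4 + (br b (br b a) - br a (br b a))"
      unfolding e_3[OF True] by (simp add: k_eq_iff)
  qed (auto simp: True k_eq_iff power2_eq_square power3_eq_cube numeral_eq_Suc less_Suc_eq)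
next
  case False
  then have "3 \<le> p - 1" using prime_ge_2_nat[OF prime_p] assms by simp
  then have "upper_central (p - 1) = UNIV"
    using class_3 upper_central_eq_UNIV_mono by blast
  from p_map_iff_formula[OF basis p_map_iff_small_class[OF this], where q = "\<lambda>_. 0"] False show ?thesis
    by (simp add: e_def)
qed

lemma p_map_exists:
  assumes "p \<noteq> 2"
  shows "\<exists>\<phi>. p_map_with_values scale br xs [a *s x4, b *s x4, c *s x4, d *s x4] \<phi>"
proof (rule p_map_with_values_exists[OF basis _ _ _ p_map_formula[OF assms]])
  fix v y assume "v \<in> set [a *s x4, b *s x4, c *s x4, d *s x4]"
  then show "br v y = 0" using central_iff[of v] by auto
qed (auto simp: k_eq_iff numeral_eq_Suc less_Suc_eq)

lemma p_map_values:
  assumes "p \<noteq> 2" "p_map scale br \<phi>"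
  obtains a b c d where "p_map_with_values scale br xs [a *s x4, b *s x4, c *s x4, d *s x4] \<phi>"
proof -
  have central: "k1 (\<phi> (xs ! i)) = 0 \<and> k2 (\<phi> (xs ! i)) = 0 \<and> k3 (\<phi> (xs ! i)) = 0" if "i < length xs" for i
    using assms(2) that unfolding p_map_formula[OF assms(1)] central_iff by blast
  have "p_map_with_values scale br xs [k4 (\<phi> x1) *s x4, k4 (\<phi> x2) *s x4, k4 (\<phi> x3) *s x4, k4 (\<phi> x4) *s x4] \<phi>"
    using assms(2) central[of 0] central[of 1] central[of 2] central[of 3]
    by (simp add: p_map_with_values_def k_eq_iff numeral_2_eq_2 numeral_3_eq_3)
  with that show thesis .
qed

context
  fixes \<phi> A B C D
  assumes p: "p \<noteq> 2" and \<phi>: "p_map_with_values scale br xs [A *s x4, B *s x4, C *s x4, D *s x4] \<phi>"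
begin

lemma p_map: "p_map scale br \<phi>"
  and values_eq: "\<phi> x1 = A *s x4" "\<phi> x2 = B *s x4" "\<phi> x3 = C *s x4" "\<phi> x4 = D *s x4"
  using \<phi> by (simp_all add: p_map_with_values_def)

lemma formula: "\<phi> x = (k1 x ^ p * A + k2 x ^ p * B + k3 x ^ p * C + k4 x ^ p * D + e * (k1 x)\<^sup>2 * k2 x) *s x4"
proof -
  have "\<phi> x = (\<Sum>i<length xs. coord xs x i ^ p *s \<phi> (xs ! i)) + (e * (k1 x)\<^sup>2 * k2 x) *s x4"
    using p_map unfolding p_map_formula[OF p] by blast
  then show ?thesis
    by (simp add: k_defs numeral_2_eq_2 numeral_3_eq_3 add.assoc values_eq scale_left_distrib)
qed

lemma nilpotent_iff: "p_nilpotent \<phi> \<longleftrightarrow> D = 0"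
proof
  assume nil: "p_nilpotent \<phi>"
  have "x4 \<noteq> 0" by (simp add: k_eq_iff)
  then show "D = 0"
    using nilpotent_eigenvalue[OF p_map nil values_eq(4)] by simp
next
  assume "D = 0"
  then have "(\<phi> ^^ 2) x = 0" for x
    using p_map_scale[OF p_map, of _ x4] values_eq(4) by (simp add: numeral_2_eq_2 formula[of x])
  then show "p_nilpotent \<phi>" by (auto simp: p_nilpotent_def)
qed

lemma kills_brackets_iff: "kills_brackets \<phi> \<longleftrightarrow> C = 0 \<and> D = 0"
proof
  assume "kills_brackets \<phi>"
  then have "\<phi> (br x1 x2) = 0" "\<phi> (br x1 x3) = 0" by (simp_all only: kills_brackets_def)
  then show "C = 0 \<and> D = 0" by (simp_all add: br12 br13 values_eq k_eq_iff)
qed (simp add: kills_brackets_def formula)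

text \<open>The centralizer of the brackets is spanned by \<open>x\<^sub>2\<close>, \<open>x\<^sub>3\<close> and \<open>x\<^sub>4\<close>.\<close>

lemma kills_bracket_centralizer_iff: "kills_bracket_centralizer \<phi> \<longleftrightarrow> B = 0 \<and> C = 0 \<and> D = 0"
proof
  assume *: "kills_bracket_centralizer \<phi>"
  have "br x (br a b) = 0" if "x \<in> {x2, x3, x4}" for x a b
    using that by (auto simp: k_eq_iff)
  then have "\<phi> x2 = 0 \<and> \<phi> x3 = 0 \<and> \<phi> x4 = 0"
    using * by (simp add: kills_bracket_centralizer_def)
  then show "B = 0 \<and> C = 0 \<and> D = 0" by (simp add: values_eq k_eq_iff)
next
  assume *: "B = 0 \<and> C = 0 \<and> D = 0"
  have "\<phi> x = 0" if "\<And>a b. br x (br a b) = 0" for x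
  proof -
    have "k4 (br x (br x1 x2)) = 0" using that by (simp only: k_zero)
    then have "k1 x = 0" by simp
    then show ?thesis using * by (simp add: formula[of x])
  qed
  then show "kills_bracket_centralizer \<phi>"
    unfolding kills_bracket_centralizer_def by blast
qed

text \<open>The bases satisfying the presentation are given, up to central summands, by \<open>y\<^sub>1 = a x\<^sub>1 + b x\<^sub>2 + f x\<^sub>3\<close> and
\<open>y\<^sub>2 = c x\<^sub>2 + d x\<^sub>3\<close> with \<open>a, c \<noteq> 0\<close>; the relation \<open>[y\<^sub>2, y\<^sub>3] = 0\<close> excludes \<open>x\<^sub>1\<close> from \<open>y\<^sub>2\<close>. Then
\<open>y\<^sub>4 = a\<^sup>2 c x\<^sub>4\<close>, and the equations compare \<open>\<phi>(y\<^sub>i)\<close> with \<open>s\<^sub>i y\<^sub>4\<close>.\<close>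

lemma has_normal_form_iff:
  assumes D: "D = 0"
  shows "has_normal_form \<phi> xs [s1 *s x4, s2 *s x4, s3 *s x4, 0] \<longleftrightarrow>
    (\<exists>a b f c d. a \<noteq> 0 \<and> c \<noteq> 0 \<and>
      a ^ p * A + b ^ p * B + f ^ p * C + e * a\<^sup>2 * b = s1 * (a\<^sup>2 * c) \<and>
      c ^ p * B + d ^ p * C = s2 * (a\<^sup>2 * c) \<and>
      (a * c) ^ p * C = s3 * (a\<^sup>2 * c))"
    (is "?L \<longleftrightarrow> ?R")
proof
  assume ?L
  then obtain F where F: "lie_automorphism scale br F"
    and eq: "\<phi> (F x1) = F (s1 *s x4)" "\<phi> (F x2) = F (s2 *s x4)" "\<phi> (F x3) = F (s3 *s x4)"
    by (auto simp: has_normal_form_def)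
  interpret F: Vector_Spaces.linear scale scale F
    using F by (simp add: lie_automorphism_def)
  have bij: "bij F" and F_br: "F (br x y) = br (F x) (F y)" for x y
    using F by (auto simp: lie_automorphism_def)
  have F3: "F x3 = br (F x1) (F x2)" and F4: "F x4 = br (F x1) (F x3)" and F23: "br (F x2) (F x3) = 0"
    using F_br[of x1 x2] F_br[of x1 x3] F_br[of x2 x3] by (simp_all add: br12 br13 br23 F.zero)
  have "x4 \<noteq> 0" by (simp add: k_eq_iff)
  then have "F x4 \<noteq> 0" using bij F.zero by (metis bij_is_inj injD)
  then have "k1 (F x1) * k3 (F x3) \<noteq> 0"
    by (simp add: F4 k_eq_iff) (simp add: F3)
  moreover have "k1 (F x2) * k3 (F x3) = 0"
    using arg_cong[OF F23, of k4] by (simp add: F3)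
  ultimately have k: "k1 (F x2) = 0" "k1 (F x1) \<noteq> 0" "k2 (F x2) \<noteq> 0"
    by (auto simp: F3)
  have F4': "F x4 = ((k1 (F x1))\<^sup>2 * k2 (F x2)) *s x4"
    by (simp add: F4 k_eq_iff) (simp add: F3 k power2_eq_square)
  show ?R
    using k arg_cong[OF eq(1), of k4] arg_cong[OF eq(2), of k4] arg_cong[OF eq(3), of k4]
    by (intro exI[of _ "k1 (F x1)"] exI[of _ "k2 (F x1)"] exI[of _ "k3 (F x1)"]
        exI[of _ "k2 (F x2)"] exI[of _ "k3 (F x2)"])
      (simp add: F.scale F4' formula D F3)
next
  assume ?R
  then obtain a b f c d where ac: "a \<noteq> 0" "c \<noteq> 0"
    and eq: "a ^ p * A + b ^ p * B + f ^ p * C + e * a\<^sup>2 * b = s1 * (a\<^sup>2 * c)"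
      "c ^ p * B + d ^ p * C = s2 * (a\<^sup>2 * c)" "(a * c) ^ p * C = s3 * (a\<^sup>2 * c)"
    by blast
  define y1 y2 y3 y4 where y: "y1 = a *s x1 + b *s x2 + f *s x3" "y2 = c *s x2 + d *s x3"
    "y3 = (a * c) *s x3 + (a * d) *s x4" "y4 = (a\<^sup>2 * c) *s x4"
  have brs: "br y1 y2 = y3" "br y1 y3 = y4" "br y1 y4 = 0" "br y2 y3 = 0" "br y2 y4 = 0" "br y3 y4 = 0"
    by (simp_all add: k_eq_iff y power2_eq_square)
  have ys: "is_basis scale [y1, y2, y3, y4]"
    by (rule is_basis4I) (use ac in \<open>auto simp: k_eq_iff y\<close>)
  obtain F where F: "lie_automorphism scale br F" "map F xs = [y1, y2, y3, y4]"
  proof (rule automorphism_of_bases[OF basis ys])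
    fix i j :: nat assume ij: "i < j" "j < length xs"
    define \<epsilon> :: "nat \<Rightarrow> 'f" where
      "\<epsilon> k = (if i = 0 \<and> j = 1 \<and> k = 2 \<or> i = 0 \<and> j = 2 \<and> k = 3 then 1 else 0)" for k
    have "br (xs ! i) (xs ! j) = (\<Sum>k<length xs. \<epsilon> k *s xs ! k)"
      "br ([y1, y2, y3, y4] ! i) ([y1, y2, y3, y4] ! j) = (\<Sum>k<length xs. \<epsilon> k *s [y1, y2, y3, y4] ! k)"
      using ij by (auto simp: numeral_eq_Suc less_Suc_eq brs br12 br13 br14 br23 br24 br34 \<epsilon>_def)
    then show "\<exists>c. br (xs ! i) (xs ! j) = (\<Sum>k<length xs. c k *s xs ! k) \<and>
        br ([y1, y2, y3, y4] ! i) ([y1, y2, y3, y4] ! j) = (\<Sum>k<length xs. c k *s [y1, y2, y3, y4] ! k)"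
      by (intro exI conjI)
  qed auto
  interpret F: Vector_Spaces.linear scale scale F
    using F by (simp add: lie_automorphism_def)
  have "\<phi> y1 = s1 *s y4" "\<phi> y2 = s2 *s y4" "\<phi> y3 = s3 *s y4" "\<phi> y4 = 0"
    using eq by (simp_all add: formula D y)
  then show ?L
    unfolding has_normal_form_def using F by (intro exI[of _ F]) (simp add: F.scale F.zero)
qed

text \<open>The choice \<open>a = C\<close>, \<open>c = 1 / C\<close> gives \<open>(a c)\<^sup>p C = C = a\<^sup>2 c\<close>, and multiples of \<open>x\<^sub>3\<close> in \<open>y\<^sub>1\<close> and \<open>y\<^sub>2\<close> make their
values vanish.\<close>

lemma normal_form_bracket_survives:
  assumes "D = 0" "C \<noteq> 0"
  shows "has_normal_form \<phi> xs [0, 0, x4, 0]"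
proof -
  obtain f where f: "f ^ p = - (C ^ p * A) / C" using perfect by blast
  obtain d where d: "d ^ p = - (inverse C ^ p * B) / C" using perfect by blast
  have "has_normal_form \<phi> xs [0 *s x4, 0 *s x4, 1 *s x4, 0]"
    unfolding has_normal_form_iff[OF assms(1)]
    by (rule exI[of _ C], rule exI[of _ 0], rule exI[of _ f], rule exI[of _ "inverse C"], rule exI[of _ d])
      (use assms in \<open>simp add: f d power2_eq_square\<close>)
  then show ?thesis by simp
qed

text \<open>If \<open>B = C = 0\<close>, the correction term alone removes \<open>A\<close>: adding \<open>- A x\<^sub>2\<close> to \<open>x\<^sub>1\<close> contributes \<open>- A\<close>.\<close>

lemma normal_form_3:
  assumes "D = 0" "p = 3"
  shows "has_normal_form \<phi> xs [0, 0, 0, 0] \<or> has_normal_form \<phi> xs [0, 0, x4, 0] \<or>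
    (B \<noteq> 0 \<and> has_normal_form \<phi> xs [A *s x4, B *s x4, 0, 0])"
proof -
  consider "C \<noteq> 0" | "C = 0" "B \<noteq> 0" | "C = 0" "B = 0" by blast
  then show ?thesis
  proof cases
    case 1
    then show ?thesis using normal_form_bracket_survives[OF assms(1)] by blast
  next
    case 2
    have "has_normal_form \<phi> xs [A *s x4, B *s x4, 0 *s x4, 0]"
      unfolding has_normal_form_iff[OF assms(1)]
      by (rule exI[of _ 1], rule exI[of _ 0], rule exI[of _ 0], rule exI[of _ 1], rule exI[of _ 0])
        (use 2 in simp)
    then show ?thesis using 2 by simp
  next
    case 3
    have "has_normal_form \<phi> xs [0 *s x4, 0 *s x4, 0 *s x4, 0]"
      unfolding has_normal_form_iff[OF assms(1)] e_3[OF assms(2)]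
      by (rule exI[of _ 1], rule exI[of _ "- A"], rule exI[of _ 0], rule exI[of _ 1], rule exI[of _ 0])
        (use 3 in simp)
    then show ?thesis by simp
  qed
qed

lemma normal_form_ge_5:
  assumes "D = 0" "p \<noteq> 3"
  shows "has_normal_form \<phi> xs [0, 0, 0, 0] \<or> has_normal_form \<phi> xs [x4, 0, 0, 0] \<or>
    (B \<noteq> 0 \<and> has_normal_form \<phi> xs [0, B *s x4, 0, 0]) \<or> has_normal_form \<phi> xs [0, 0, x4, 0]"
proof -
  consider "C \<noteq> 0" | "C = 0" "B \<noteq> 0" | "C = 0" "B = 0" "A \<noteq> 0" | "C = 0" "B = 0" "A = 0" by blast
  then show ?thesis
  proof cases
    case 1
    then show ?thesis using normal_form_bracket_survives[OF assms(1)] by blast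
  next
    case 2
    obtain b where b: "b ^ p = - A / B" using perfect by blast
    have "has_normal_form \<phi> xs [0 *s x4, B *s x4, 0 *s x4, 0]"
      unfolding has_normal_form_iff[OF assms(1)] e_not_3[OF assms(2)]
      by (rule exI[of _ 1], rule exI[of _ b], rule exI[of _ 0], rule exI[of _ 1], rule exI[of _ 0])
        (use 2 in \<open>simp add: b\<close>)
    then show ?thesis using 2 by simp
  next
    case 3
    have "has_normal_form \<phi> xs [1 *s x4, 0 *s x4, 0 *s x4, 0]"
      unfolding has_normal_form_iff[OF assms(1)] e_not_3[OF assms(2)]
      by (rule exI[of _ 1], rule exI[of _ 0], rule exI[of _ 0], rule exI[of _ A], rule exI[of _ 0])
        (use 3 in simp)
    then show ?thesis by simp
  next
    case 4
    have "has_normal_form \<phi> xs [0 *s x4, 0 *s x4, 0 *s x4, 0]"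
      unfolding has_normal_form_iff[OF assms(1)] e_not_3[OF assms(2)]
      by (rule exI[of _ 1], rule exI[of _ 0], rule exI[of _ 0], rule exI[of _ 1], rule exI[of _ 0])
        (use 4 in simp)
    then show ?thesis by simp
  qed
qed

lemma power_zero_1_iff:
  assumes "p \<noteq> 3"
  shows "power_zero 1 \<phi> \<longleftrightarrow> A = 0 \<and> B = 0 \<and> C = 0 \<and> D = 0"
proof
  assume "power_zero 1 \<phi>"
  then have "\<phi> x = 0" for x by (simp add: power_zero_def)
  from this[of x1] this[of x2] this[of x3] this[of x4]
  show "A = 0 \<and> B = 0 \<and> C = 0 \<and> D = 0" by (simp add: values_eq k_eq_iff)
qed (simp add: power_zero_def formula e_not_3[OF assms])

end

theorem classification_3:
  assumes p: "p = 3"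
  shows "nilpotent_p_maps_listed scale br xs
    [{[0, 0, 0, 0]}, {[0, 0, x4, 0]}, {[\<alpha> *s x4, \<beta> *s x4, 0, 0] |\<alpha> \<beta>. \<beta> \<noteq> 0}]"
    (is "nilpotent_p_maps_listed _ _ _ ?items")
proof (rule nilpotent_p_maps_listedI[OF basis,
      of "\<lambda>\<phi>. [kills_bracket_centralizer \<phi>, kills_brackets \<phi>]" "[[True, True], [False, False], [False, True]]"])
  show "equivalence_invariant (\<lambda>\<phi>. [kills_bracket_centralizer \<phi>, kills_brackets \<phi>])"
    by (intro invariant_Cons invariant_Nil invariants)
  have p2: "p \<noteq> 2" using p by simp
  show "\<exists>\<phi>. p_map_with_values scale br xs vs \<phi>" if "I \<in> set ?items" "vs \<in> I" for I vs
    using that p_map_exists[OF p2, of 0 0 0 0] p_map_exists[OF p2, of 0 0 1 0] p_map_exists[OF p2, of _ _ 0 0]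
    by auto
  show "list_all2 (\<lambda>I k. \<forall>vs\<in>I. \<forall>\<phi>. p_map_with_values scale br xs vs \<phi> \<longrightarrow>
      p_nilpotent \<phi> \<and> [kills_bracket_centralizer \<phi>, kills_brackets \<phi>] = k)
    ?items
    [[True, True], [False, False], [False, True]]"
    using nilpotent_iff[OF p2, of 0 0 0 0] nilpotent_iff[OF p2, of 0 0 1 0] nilpotent_iff[OF p2, of _ _ 0 0]
      kills_brackets_iff[OF p2, of 0 0 0 0] kills_brackets_iff[OF p2, of 0 0 1 0] kills_brackets_iff[OF p2, of _ _ 0 0]
      kills_bracket_centralizer_iff[OF p2, of 0 0 0 0] kills_bracket_centralizer_iff[OF p2, of 0 0 1 0]
      kills_bracket_centralizer_iff[OF p2, of _ _ 0 0]
    by auto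
  fix \<phi> assume \<phi>: "p_map scale br \<phi>" "p_nilpotent \<phi>"
  then obtain A B C D where *: "p_map_with_values scale br xs [A *s x4, B *s x4, C *s x4, D *s x4] \<phi>"
    using p_map_values[OF p2] by blast
  with \<phi> have "D = 0" using nilpotent_iff[OF p2] by blast
  from normal_form_3[OF p2 * this p]
  show "\<exists>I\<in>set ?items.
      \<exists>vs\<in>I. has_normal_form \<phi> xs vs" by auto
qed simp

theorem classification_ge_5:
  assumes p: "p \<noteq> 2" "p \<noteq> 3"
  shows "nilpotent_p_maps_listed scale br xs
    [{[0, 0, 0, 0]}, {[x4, 0, 0, 0]}, {[0, \<xi> *s x4, 0, 0] |\<xi>. \<xi> \<noteq> 0}, {[0, 0, x4, 0]}]"
    (is "nilpotent_p_maps_listed _ _ _ ?items")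
proof (rule nilpotent_p_maps_listedI[OF basis,
      of "\<lambda>\<phi>. [power_zero 1 \<phi>, kills_bracket_centralizer \<phi>, kills_brackets \<phi>]"
        "[[True, True, True], [False, True, True], [False, False, True], [False, False, False]]"])
  show "equivalence_invariant (\<lambda>\<phi>. [power_zero 1 \<phi>, kills_bracket_centralizer \<phi>, kills_brackets \<phi>])"
    by (intro invariant_Cons invariant_Nil invariants)
  note ex = p_map_exists[OF p(1), of 0 0 0 0] p_map_exists[OF p(1), of 1 0 0 0]
    p_map_exists[OF p(1), of 0 _ 0 0] p_map_exists[OF p(1), of 0 0 1 0]
  show "\<exists>\<phi>. p_map_with_values scale br xs vs \<phi>" if "I \<in> set ?items" "vs \<in> I" for I vs
    using that ex by auto
  have "p_nilpotent \<phi> \<and> [power_zero 1 \<phi>, kills_bracket_centralizer \<phi>, kills_brackets \<phi>] =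
      [A = 0 \<and> B = 0 \<and> C = 0, B = 0 \<and> C = 0, C = 0]"
    if "p_map_with_values scale br xs [A *s x4, B *s x4, C *s x4, 0] \<phi>" for A B C \<phi>
    using nilpotent_iff[OF p(1), of A B C 0] kills_brackets_iff[OF p(1), of A B C 0]
      kills_bracket_centralizer_iff[OF p(1), of A B C 0] power_zero_1_iff[OF p(1), of A B C 0] that p(2)
    by simp
  from this[of 0 0 0] this[of 1 0 0] this[of 0 _ 0] this[of 0 0 1]
  show "list_all2 (\<lambda>I k. \<forall>vs\<in>I. \<forall>\<phi>. p_map_with_values scale br xs vs \<phi> \<longrightarrow>
      p_nilpotent \<phi> \<and> [power_zero 1 \<phi>, kills_bracket_centralizer \<phi>, kills_brackets \<phi>] = k)
    ?items
    [[True, True, True], [False, True, True], [False, False, True], [False, False, False]]"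
    by auto
  fix \<phi> assume \<phi>: "p_map scale br \<phi>" "p_nilpotent \<phi>"
  then obtain A B C D where *: "p_map_with_values scale br xs [A *s x4, B *s x4, C *s x4, D *s x4] \<phi>"
    using p_map_values[OF p(1)] by blast
  with \<phi> have "D = 0" using nilpotent_iff[OF p(1)] by blast
  from normal_form_ge_5[OF p(1) * this p(2)]
  show "\<exists>I\<in>set ?items.
      \<exists>vs\<in>I. has_normal_form \<phi> xs vs" by auto
qed simp

lemma equivalent_family_iff:
  assumes "p \<noteq> 2"
  shows "equivalent_values scale br xs [\<alpha>1 *s x4, \<beta>1 *s x4, 0, 0] [\<alpha>2 *s x4, \<beta>2 *s x4, 0, 0] \<longleftrightarrow>
    (\<exists>a b c. a \<noteq> 0 \<and> c \<noteq> 0 \<and> a ^ p * \<alpha>1 + b ^ p * \<beta>1 + e * a\<^sup>2 * b = \<alpha>2 * (a\<^sup>2 * c) \<and>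
      c ^ p * \<beta>1 = \<beta>2 * (a\<^sup>2 * c))" (is "?L \<longleftrightarrow> ?R")
proof -
  obtain \<phi> where \<phi>: "p_map_with_values scale br xs [\<alpha>1 *s x4, \<beta>1 *s x4, 0 *s x4, 0 *s x4] \<phi>"
    using p_map_exists[OF assms] by blast
  have "?L \<longleftrightarrow> has_normal_form \<phi> xs [\<alpha>2 *s x4, \<beta>2 *s x4, 0 *s x4, 0]"
    using \<phi> p_map_with_values_unique[OF basis \<phi>]
    unfolding equivalent_values_iff[OF basis] scale_zero_left by blast
  also have "\<dots> \<longleftrightarrow> ?R"
    unfolding has_normal_form_iff[OF assms \<phi> refl] by simp
  finally show ?thesis .
qed

text \<open>The equation \<open>c\<^sup>p \<xi>\<^sub>1 = \<xi>\<^sub>2 a\<^sup>2 c\<close> with \<open>p = 2 m + 1\<close> says that \<open>\<xi>\<^sub>1 / \<xi>\<^sub>2\<close> is the square of \<open>a / c\<^sup>m\<close>.\<close>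

theorem family_iff_square:
  assumes p: "p \<noteq> 2" "p \<noteq> 3" and \<xi>: "\<xi>1 \<noteq> 0" "\<xi>2 \<noteq> 0"
  shows "equivalent_values scale br xs [0, \<xi>1 *s x4, 0, 0] [0, \<xi>2 *s x4, 0, 0] \<longleftrightarrow>
    is_square (\<xi>1 * inverse \<xi>2)"
proof -
  have "odd p" using p prime_p prime_odd_nat[of p] prime_ge_2_nat[of p] by auto
  then obtain m where m: "p = 2 * m + 1" by (rule oddE)
  have "equivalent_values scale br xs [0 *s x4, \<xi>1 *s x4, 0, 0] [0 *s x4, \<xi>2 *s x4, 0, 0] \<longleftrightarrow>
    (\<exists>a c. a \<noteq> 0 \<and> c \<noteq> 0 \<and> c ^ p * \<xi>1 = \<xi>2 * (a\<^sup>2 * c))"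
    unfolding equivalent_family_iff[OF p(1)] e_not_3[OF p(2)] using \<xi> p_pos by auto
  also have "\<dots> \<longleftrightarrow> (\<exists>t. \<xi>1 * inverse \<xi>2 = t\<^sup>2)"
  proof safe
    fix a c :: 'f assume "a \<noteq> 0" "c \<noteq> 0" and eq: "c ^ p * \<xi>1 = \<xi>2 * (a\<^sup>2 * c)"
    then have "\<xi>1 * inverse \<xi>2 = (a / c ^ m)\<^sup>2"
      using \<xi> by (simp add: m field_simps power_mult power2_eq_square)
    then show "\<exists>t. \<xi>1 * inverse \<xi>2 = t\<^sup>2" ..
  next
    fix t assume "\<xi>1 * inverse \<xi>2 = t\<^sup>2"
    then have t: "\<xi>1 = \<xi>2 * t\<^sup>2" using \<xi> by (simp add: field_simps)
    then show "\<exists>a c. a \<noteq> 0 \<and> c \<noteq> 0 \<and> c ^ p * \<xi>1 = \<xi>2 * (a\<^sup>2 * c)"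
      using \<xi> by (intro exI[of _ t] exI[of _ 1]) auto
  qed
  finally show ?thesis by (simp add: is_nth_power_def)
qed

text \<open>With \<open>r = c / a\<close> and \<open>t = b / a\<close> the two equations read \<open>\<alpha>\<^sub>2 r = \<alpha>\<^sub>1 + \<beta>\<^sub>1 t\<^sup>3 + t\<close> and \<open>\<beta>\<^sub>2 = r\<^sup>2 \<beta>\<^sub>1\<close>, and \<open>r\<close>
may be replaced by \<open>- r\<close>.\<close>

theorem family_iff_K_set:
  assumes p: "p = 3" and \<beta>: "\<beta>1 \<noteq> 0" "\<beta>2 \<noteq> 0"
  shows "equivalent_values scale br xs [\<alpha>1 *s x4, \<beta>1 *s x4, 0, 0] [\<alpha>2 *s x4, \<beta>2 *s x4, 0, 0] \<longleftrightarrow>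
    (\<exists>r. r\<^sup>2 = \<beta>2 / \<beta>1 \<and> (\<alpha>1 + \<alpha>2 * r \<in> K_set \<beta>1 \<or> \<alpha>1 - \<alpha>2 * r \<in> K_set \<beta>1))" (is "?L \<longleftrightarrow> ?R")
proof -
  have p2: "p \<noteq> 2" using p by simp
  have "?L \<longleftrightarrow> (\<exists>a b c. a \<noteq> 0 \<and> c \<noteq> 0 \<and> a ^ 3 * \<alpha>1 + b ^ 3 * \<beta>1 + a\<^sup>2 * b = \<alpha>2 * (a\<^sup>2 * c) \<and>
      c ^ 3 * \<beta>1 = \<beta>2 * (a\<^sup>2 * c))"
    unfolding equivalent_family_iff[OF p2] e_3[OF p] by (simp only: p mult_1_left)
  also have "\<dots> \<longleftrightarrow> ?R"
  proof safe
    fix a b c :: 'f assume ac: "a \<noteq> 0" "c \<noteq> 0" and eq: "a ^ 3 * \<alpha>1 + b ^ 3 * \<beta>1 + a\<^sup>2 * b = \<alpha>2 * (a\<^sup>2 * c)"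
      "c ^ 3 * \<beta>1 = \<beta>2 * (a\<^sup>2 * c)"
    define r t where "r = c / a" and "t = b / a"
    then have bc: "b = t * a" "c = r * a" "r \<noteq> 0" using ac by simp_all
    have "a ^ 3 * (\<alpha>1 + t ^ 3 * \<beta>1 + t - \<alpha>2 * r) = 0"
      using eq(1) by (simp add: bc power2_eq_square power3_eq_cube algebra_simps)
    then have "\<alpha>1 + t ^ 3 * \<beta>1 + t - \<alpha>2 * r = 0"
      using ac(1) by (simp only: mult_eq_0_iff power_eq_0_iff) simp
    then have "\<alpha>1 - \<alpha>2 * r = \<beta>1 * (- t) ^ 3 + (- t)"
      by (simp add: power3_eq_cube algebra_simps)
    then have "\<alpha>1 - \<alpha>2 * r \<in> K_set \<beta>1"
      unfolding K_set_def by blast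
    moreover have "a ^ 3 * r * (r\<^sup>2 * \<beta>1 - \<beta>2) = 0"
      using eq(2) by (simp add: bc power2_eq_square power3_eq_cube algebra_simps)
    then have "r\<^sup>2 * \<beta>1 - \<beta>2 = 0"
      using ac(1) bc(3) by (simp only: mult_eq_0_iff power_eq_0_iff) simp
    then have "r\<^sup>2 = \<beta>2 / \<beta>1"
      using \<beta> by (simp add: eq_divide_eq)
    ultimately show ?R by blast
  next
    have change: "\<exists>a b c. a \<noteq> 0 \<and> c \<noteq> 0 \<and> a ^ 3 * \<alpha>1 + b ^ 3 * \<beta>1 + a\<^sup>2 * b = \<alpha>2 * (a\<^sup>2 * c) \<and>
      c ^ 3 * \<beta>1 = \<beta>2 * (a\<^sup>2 * c)" if r: "r\<^sup>2 = \<beta>2 / \<beta>1" "\<alpha>1 - \<alpha>2 * r \<in> K_set \<beta>1" for r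
    proof -
      obtain \<delta> where \<delta>: "\<alpha>1 - \<alpha>2 * r = \<beta>1 * \<delta> ^ 3 + \<delta>" using r by (auto simp: K_set_def)
      have "r \<noteq> 0" using r \<beta> by auto
      moreover have "\<alpha>1 + (- \<delta>) ^ 3 * \<beta>1 - \<delta> = \<alpha>2 * r"
        using \<delta> by (simp add: algebra_simps power3_eq_cube)
      moreover have "r ^ 3 * \<beta>1 = \<beta>2 * r"
        using r(1) \<beta> by (simp add: power3_eq_cube power2_eq_square field_simps)
      ultimately show ?thesis
        by (intro exI[of _ 1] exI[of _ "- \<delta>"] exI[of _ r]) simp
    qed
    fix r assume r: "r\<^sup>2 = \<beta>2 / \<beta>1"
    show "\<exists>a b c. a \<noteq> 0 \<and> c \<noteq> 0 \<and> a ^ 3 * \<alpha>1 + b ^ 3 * \<beta>1 + a\<^sup>2 * b = \<alpha>2 * (a\<^sup>2 * c) \<and>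
      c ^ 3 * \<beta>1 = \<beta>2 * (a\<^sup>2 * c)" if "\<alpha>1 + \<alpha>2 * r \<in> K_set \<beta>1"
      using change[of "- r"] that r by simp
    show "\<exists>a b c. a \<noteq> 0 \<and> c \<noteq> 0 \<and> a ^ 3 * \<alpha>1 + b ^ 3 * \<beta>1 + a\<^sup>2 * b = \<alpha>2 * (a\<^sup>2 * c) \<and>
      c ^ 3 * \<beta>1 = \<beta>2 * (a\<^sup>2 * c)" if "\<alpha>1 - \<alpha>2 * r \<in> K_set \<beta>1"
      using change[of r] that r by simp
  qed
  finally show ?thesis .
qed

end

section \<open>Abelian Lie algebras\<close>

lemma (in lie_algebra) br_zero_of_basis:
  assumes xs: "is_basis scale xs" and br: "\<And>i j. i < j \<Longrightarrow> j < length xs \<Longrightarrow> br (xs ! i) (xs ! j) = 0"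
  shows "br x y = 0"
proof -
  have "br (xs ! i) (xs ! j) = 0" if "i < length xs" "j < length xs" for i j
    using br[of i j] br[of j i] br_anticommute[of "xs ! i" "xs ! j"] br_self that
    by (cases i j rule: linorder_cases) simp_all
  then have "br (\<Sum>i<length xs. coord xs x i *s xs ! i) (\<Sum>j<length xs. coord xs y j *s xs ! j) = 0"
    by (simp add: br_sum_left br_sum_right br_scale_left br_scale_right)
  then show ?thesis by (simp only: sum_coord[OF xs])
qed

locale abelian_lie_algebra = perfect_lie_algebra scale br p
  for scale :: "'f::field \<Rightarrow> 'l::ab_group_add \<Rightarrow> 'l" (infixr "*s" 75) and br p +
  fixes xs :: "'l list"
  assumes basis: "is_basis scale xs" and br_zero [simp]: "br x y = 0"
begin

lemma p_map_iff_semilinear: "p_map scale br \<phi> \<longleftrightarrow> central_p_map (\<lambda>_ _. 0) \<phi>"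
proof (rule p_map_iff_small_class)
  have "upper_central 1 = UNIV" by simp
  then show "upper_central (p - 1) = UNIV"
    using prime_ge_2_nat[OF prime_p] upper_central_eq_UNIV_mono[of 1 "p - 1"] by simp
qed

lemma p_map_exists:
  assumes "length vs = length xs"
  shows "\<exists>\<phi>. p_map_with_values scale br xs vs \<phi>"
proof (rule p_map_with_values_exists[OF basis assms, of "\<lambda>_. 0"])
  fix \<phi>
  show "p_map scale br \<phi> \<longleftrightarrow> (\<forall>i<length xs. \<forall>b. br (\<phi> (xs ! i)) b = 0) \<and>
      (\<forall>x. \<phi> x = (\<Sum>i<length xs. coord xs x i ^ p *s \<phi> (xs ! i)) + 0)"
    by (rule p_map_iff_formula[OF basis p_map_iff_semilinear]) simp_all
qed simp_all

lemma has_normal_formI: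
  assumes "is_basis scale ys" "length ys = length xs"
    and "\<And>A. A 0 = 0 \<Longrightarrow> map A xs = ys \<Longrightarrow> map \<phi> ys = map A vs"
  shows "has_normal_form \<phi> xs vs"
proof -
  have "\<exists>c. br (xs ! i) (xs ! j) = (\<Sum>k<length xs. c k *s xs ! k) \<and>
      br (ys ! i) (ys ! j) = (\<Sum>k<length xs. c k *s ys ! k)" for i j
    by (rule exI[of _ "\<lambda>_. 0"]) simp
  with automorphism_of_bases[OF basis assms(1,2)]
  obtain A where A: "lie_automorphism scale br A" "map A xs = ys" by metis
  then interpret A: Vector_Spaces.linear scale scale A by (simp add: lie_automorphism_def)
  have "map \<phi> ys = map A vs" using assms(3)[OF A.zero A(2)] .
  moreover have "map (\<lambda>x. \<phi> (A x)) xs = map \<phi> (map A xs)" by simp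
  ultimately have "map (\<lambda>x. \<phi> (A x)) xs = map A vs" by (simp only: A(2))
  with A(1) show ?thesis by (auto simp: has_normal_form_def)
qed

context
  fixes \<phi>
  assumes \<phi>: "p_map scale br \<phi>"
begin

lemma add: "\<phi> (a + b) = \<phi> a + \<phi> b"
  using \<phi> by (simp add: p_map_iff_semilinear central_p_map_def)

lemma scale: "\<phi> (\<alpha> *s a) = \<alpha> ^ p *s \<phi> a"
  using \<phi> by (rule p_map_scale)

lemma zero: "\<phi> 0 = 0"
  using \<phi> by (rule p_map_zero)

lemma minus: "\<phi> (- a) = - \<phi> a"
  using add[of a "- a"] zero by (simp add: eq_neg_iff_add_eq_0 add.commute)

lemma power_zero_iff: "power_zero k \<phi> \<longleftrightarrow> (\<forall>x\<in>set xs. (\<phi> ^^ k) x = 0)"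
proof
  assume *: "\<forall>x\<in>set xs. (\<phi> ^^ k) x = 0"
  have pow: "(\<phi> ^^ k) (a + b) = (\<phi> ^^ k) a + (\<phi> ^^ k) b" "(\<phi> ^^ k) (\<alpha> *s a) = \<alpha> ^ (p ^ k) *s (\<phi> ^^ k) a"
    "(\<phi> ^^ k) 0 = 0" for a b \<alpha> k
    by (induction k) (simp_all add: add scale zero power_mult[symmetric] mult.commute)
  have "(\<phi> ^^ k) x = 0" if "x \<in> span (set xs)" for x
    using that by (induction rule: span_induct_alt) (use * in \<open>simp_all add: pow\<close>)
  then show "power_zero k \<phi>"
    using basis by (simp add: is_basis_def power_zero_def)
qed (simp add: power_zero_def)

lemma power_zero_nilpotent: "power_zero k \<phi> \<Longrightarrow> p_nilpotent \<phi>"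
  by (auto simp: power_zero_def p_nilpotent_def)

lemma chain_list:
  assumes "(\<phi> ^^ Suc k) z = 0" "(\<phi> ^^ k) z \<noteq> 0"
  shows "distinct (map (\<lambda>i. (\<phi> ^^ i) z) [0..<Suc k])" (is "distinct ?ys")
    and "independent (set (map (\<lambda>i. (\<phi> ^^ i) z) [0..<Suc k]))"
proof -
  have "\<forall>i<length ?ys. c i = 0" if "(\<Sum>i<length ?ys. c i *s ?ys ! i) = 0" for c
  proof -
    have "(\<Sum>i\<le>k. c i *s (\<phi> ^^ i) z) = 0"
      using that by (simp add: lessThan_Suc_atMost[symmetric] del: upt_Suc)
    then have "c i = 0" if "i \<le> k" for i
      using that chain_independent[of UNIV \<phi> z k c i] assms add scale by simp
    then show ?thesis by simp
  qed
  then show "distinct ?ys" "independent (set ?ys)"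
    by (rule independent_listI; blast)+
qed

lemma power_zero_length:
  assumes nil: "p_nilpotent \<phi>"
  shows "power_zero (length xs) \<phi>"
  unfolding power_zero_def
proof
  fix x
  show "(\<phi> ^^ length xs) x = 0"
  proof (cases "x = 0")
    case False
    obtain k where k: "(\<phi> ^^ Suc k) x = 0" "(\<phi> ^^ k) x \<noteq> 0"
      using chain_length_exists[OF nil False] .
    have "Suc k \<le> length xs"
      using independent_list_length_le[OF basis chain_list[OF k]] by simp
    then obtain m where m: "length xs = m + Suc k"
      using le_Suc_ex by (metis add.commute)
    have "(\<phi> ^^ m) 0 = 0" by (induction m) (simp_all add: zero)
    then show ?thesis
      using k unfolding m funpow_add by simp
  next
    case True
    have "(\<phi> ^^ m) 0 = 0" for m by (induction m) (simp_all add: zero)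
    with True show ?thesis by simp
  qed
qed

text \<open>The map induced on the quotient by \<open>S\<close> is nilpotent and hence has no nonzero eigenvalue.\<close>

lemma nilpotent_modulo_subspace:
  assumes nil: "p_nilpotent \<phi>" and S: "subspace S" "\<And>u. u \<in> S \<Longrightarrow> \<phi> u \<in> S"
    and w: "w \<notin> S" and d: "\<phi> w - d *s w \<in> S"
  shows "\<phi> w \<in> S"
proof -
  have "d = 0"
  proof (rule ccontr)
    assume d0: "d \<noteq> 0"
    have "\<exists>c. c \<noteq> 0 \<and> (\<phi> ^^ n) w - c *s w \<in> S" for n
    proof (induction n)
      case 0
      show ?case using S by (intro exI[of _ 1]) (simp add: subspace_0)
    next
      case (Suc n)
      then obtain c where c: "c \<noteq> 0" "(\<phi> ^^ n) w - c *s w \<in> S" by blast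
      have "\<phi> (((\<phi> ^^ n) w - c *s w) + c *s w) - (c ^ p * d) *s w =
          \<phi> ((\<phi> ^^ n) w - c *s w) + c ^ p *s (\<phi> w - d *s w)"
        by (subst add) (simp add: scale scale_right_diff_distrib)
      then have "(\<phi> ^^ Suc n) w - (c ^ p * d) *s w \<in> S"
        using S c d by (simp add: subspace_add subspace_scale)
      then show ?case using c d0 by (intro exI[of _ "c ^ p * d"]) simp
    qed
    then obtain c where "c \<noteq> 0" "- (c *s w) \<in> S"
      using nil by (metis diff_0 p_nilpotent_def)
    then have "inverse c *s - (- (c *s w)) \<in> S"
      using S by (metis subspace_neg subspace_scale)
    then show False using w \<open>c \<noteq> 0\<close> by simp
  qed
  with d show ?thesis by simp
qed

text \<open>A \<open>p\<close>-th root of the coefficient corrects \<open>w\<close> to an element of the kernel.\<close>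

lemma kernel_complement:
  assumes "\<phi> w \<in> span {\<phi> z}"
  obtains c where "\<phi> (w - c *s z) = 0"
proof -
  obtain k where k: "\<phi> w = k *s \<phi> z"
    using assms by (auto simp: span_singleton)
  obtain c where "c ^ p = k" using perfect by blast
  then have "\<phi> (w - c *s z) = 0"
    using add[of w "- (c *s z)"] k by (simp add: minus scale)
  with that show thesis .
qed

lemma square_zero_basis:
  assumes sq: "power_zero 2 \<phi>" and z: "\<phi> z \<noteq> 0"
  shows "distinct [z, \<phi> z]" "independent {z, \<phi> z}"
proof -
  have "(\<phi> ^^ Suc 1) z = 0" using sq by (simp add: power_zero_def numeral_2_eq_2)
  from chain_list[OF this] z show "distinct [z, \<phi> z]" "independent {z, \<phi> z}"
    by (simp_all add: insert_commute)
qed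

lemma span_diff_iff: "c *s z \<in> span S \<Longrightarrow> w - c *s z \<in> span S \<longleftrightarrow> w \<in> span S"
  using span_add[of "w - c *s z" S "c *s z"] span_diff by auto

lemma extend_by_kernel:
  assumes len: "length ys < length xs" and z: "z \<in> set ys"
    and img: "\<And>w. \<phi> w \<in> span {\<phi> z}"
    and ys: "distinct ys" "independent (set ys)"
  obtains w where "\<phi> w = 0" "distinct (ys @ [w])" "independent (set (ys @ [w]))"
proof -
  obtain w where w: "w \<notin> span (set ys)"
    using independent_list_extend[OF basis len] .
  obtain c where c: "\<phi> (w - c *s z) = 0"
    using kernel_complement[OF img] .
  have "w - c *s z \<notin> span (set ys)"
    using w z by (simp add: span_diff_iff span_scale span_base)
  with ys span_base[of "w - c *s z" "set ys"]
  have "distinct (ys @ [w - c *s z])" "independent (set (ys @ [w - c *s z]))"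
    by (auto simp: independent_insert)
  with that c show thesis by blast
qed

text \<open>Applying \<open>\<phi>\<close> to a relation kills the terms \<open>\<phi> z\<close> and \<open>\<phi> w\<close> and leaves one between \<open>\<phi> z\<close> and \<open>\<phi> w\<close>, which
must be trivial.\<close>

lemma four_independent:
  assumes sq: "power_zero 2 \<phi>" and z: "\<phi> z \<noteq> 0" and w: "\<phi> w \<notin> span {\<phi> z}"
  shows "distinct [z, \<phi> z, w, \<phi> w]" "independent (set [z, \<phi> z, w, \<phi> w])"
proof -
  let ?ys = "[z, \<phi> z, w, \<phi> w]"
  have sq': "\<phi> (\<phi> x) = 0" for x using sq by (simp add: power_zero_def numeral_2_eq_2)
  have ind: "a = 0 \<and> b = 0" if "a *s \<phi> z + b *s \<phi> w = 0" for a b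
  proof -
    have "b = 0"
    proof (rule ccontr)
      assume "b \<noteq> 0"
      have "b *s \<phi> w = - a *s \<phi> z" using that by (simp add: eq_neg_iff_add_eq_0 add.commute)
      then have "inverse b *s b *s \<phi> w = inverse b *s - a *s \<phi> z" by simp
      then have "\<phi> w = (inverse b * - a) *s \<phi> z" using \<open>b \<noteq> 0\<close> by simp
      with w show False unfolding span_singleton by blast
    qed
    with that z show ?thesis by simp
  qed
  have "\<forall>i<length ?ys. c i = 0" if "(\<Sum>i<length ?ys. c i *s ?ys ! i) = 0" for c
  proof -
    have *: "c 0 *s z + c 1 *s \<phi> z + c 2 *s w + c 3 *s \<phi> w = 0"
      using that by (simp add: numeral_2_eq_2 numeral_3_eq_3)
    have "\<phi> (c 0 *s z + c 1 *s \<phi> z + c 2 *s w + c 3 *s \<phi> w) = c 0 ^ p *s \<phi> z + c 2 ^ p *s \<phi> w"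
      by (simp add: add scale sq')
    then have "c 0 = 0 \<and> c 2 = 0"
      using ind[of "c 0 ^ p" "c 2 ^ p"] p_pos unfolding * zero by simp
    moreover from this have "c 1 = 0 \<and> c 3 = 0" using * ind[of "c 1" "c 3"] by simp
    ultimately show ?thesis by (simp add: All_less_Suc numeral_eq_Suc)
  qed
  then show "distinct ?ys" "independent (set ?ys)"
    by (rule independent_listI; blast)+
qed

text \<open>The case of a single Jordan block.\<close>

lemma full_chain_basis:
  assumes nil: "p_nilpotent \<phi>" and not: "\<not> power_zero (length xs - 1) \<phi>" and xs: "xs \<noteq> []"
  obtains z where "is_basis scale (map (\<lambda>i. (\<phi> ^^ i) z) [0..<length xs])" "(\<phi> ^^ length xs) z = 0"
proof -
  obtain z where z: "(\<phi> ^^ (length xs - 1)) z \<noteq> 0"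
    using not by (auto simp: power_zero_def)
  obtain m where m: "length xs = Suc m" using xs by (cases xs) auto
  have z0: "(\<phi> ^^ Suc m) z = 0"
    using power_zero_length[OF nil] m by (simp add: power_zero_def)
  have "is_basis scale (map (\<lambda>i. (\<phi> ^^ i) z) [0..<Suc m])"
    using z m by (intro is_basis_of_length[OF basis chain_list[OF z0]]) simp_all
  with that z0 show thesis by (simp only: m)
qed

lemma normal_form_zero:
  assumes "power_zero 1 \<phi>"
  shows "has_normal_form \<phi> xs (map (\<lambda>_. 0) xs)"
proof (rule has_normal_formI[OF basis refl])
  fix A :: "'l \<Rightarrow> 'l" assume "A 0 = 0"
  then show "map \<phi> xs = map A (map (\<lambda>_. 0) xs)"
    using assms by (simp add: power_zero_def)
qed

lemma normal_form_2:
  assumes nil: "p_nilpotent \<phi>" and xs: "xs = [x1, x2]"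
  shows "has_normal_form \<phi> xs [0, 0] \<or> has_normal_form \<phi> xs [x2, 0]"
proof (cases "power_zero 1 \<phi>")
  case True
  from normal_form_zero[OF this] show ?thesis by (simp add: xs)
next
  case False
  then obtain z where z: "is_basis scale [z, \<phi> z]" "\<phi> (\<phi> z) = 0"
    using full_chain_basis[OF nil] by (auto simp: xs)
  have "has_normal_form \<phi> xs [x2, 0]"
    by (rule has_normal_formI[OF z(1)]) (use z(2) in \<open>auto simp: xs\<close>)
  then show ?thesis ..
qed

lemma normal_form_3:
  assumes nil: "p_nilpotent \<phi>" and xs: "xs = [x1, x2, x3]"
  shows "has_normal_form \<phi> xs [0, 0, 0] \<or> has_normal_form \<phi> xs [x2, 0, 0] \<or> has_normal_form \<phi> xs [x2, x3, 0]"
proof -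
  consider "power_zero 1 \<phi>" | "power_zero 2 \<phi>" "\<not> power_zero 1 \<phi>" | "\<not> power_zero 2 \<phi>" by blast
  then show ?thesis
  proof cases
    case 1
    from normal_form_zero[OF this] show ?thesis by (simp add: xs)
  next
    case 2
    then obtain z where z: "\<phi> z \<noteq> 0" by (auto simp: power_zero_def)
    note zz = square_zero_basis[OF 2(1) z]
    have img: "\<phi> w \<in> span {\<phi> z}" for w
    proof (rule ccontr)
      assume "\<phi> w \<notin> span {\<phi> z}"
      from independent_list_length_le[OF basis four_independent[OF 2(1) z this]]
      show False by (simp add: xs)
    qed
    obtain w where w: "\<phi> w = 0" "distinct ([z, \<phi> z] @ [w])" "independent (set ([z, \<phi> z] @ [w]))"
      by (rule extend_by_kernel[of "[z, \<phi> z]" z]) (use img zz in \<open>simp_all add: xs\<close>)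
    have "is_basis scale [z, \<phi> z, w]"
      by (rule is_basis_of_length[OF basis]) (use w in \<open>simp_all add: xs\<close>)
    then have "has_normal_form \<phi> xs [x2, 0, 0]"
      by (rule has_normal_formI) (use w 2(1) in \<open>auto simp: xs power_zero_def numeral_2_eq_2\<close>)
    then show ?thesis by blast
  next
    case 3
    then obtain z where z: "is_basis scale [z, \<phi> z, \<phi> (\<phi> z)]" "\<phi> (\<phi> (\<phi> z)) = 0"
      using full_chain_basis[OF nil] by (auto simp: xs numeral_2_eq_2)
    have "has_normal_form \<phi> xs [x2, x3, 0]"
      by (rule has_normal_formI[OF z(1)]) (use z(2) in \<open>auto simp: xs\<close>)
    then show ?thesis by blast
  qed
qed

text \<open>A longest chain has an invariant complement. For \<open>w\<close> outside the span \<open>S\<close> of the chain, \<open>\<phi> w\<close> lies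
in \<open>S\<close> by nilpotency of the induced map on the quotient. Its \<open>z\<close>-component vanishes because \<open>\<phi>\<^sup>3 w = 0\<close>, and the
other two components are removed by subtracting \<open>p\<close>-th roots times \<open>z\<close> and \<open>\<phi> z\<close> from \<open>w\<close>.\<close>

lemma cube_zero_complement:
  assumes nil: "p_nilpotent \<phi>" and cu: "power_zero 3 \<phi>" and z: "\<phi> (\<phi> z) \<noteq> 0"
    and len: "length xs = 4"
  obtains w where "is_basis scale [z, \<phi> z, \<phi> (\<phi> z), w]" "\<phi> w = 0"
proof -
  let ?S = "span {z, \<phi> z, \<phi> (\<phi> z)}"
  have cu': "\<phi> (\<phi> (\<phi> x)) = 0" for x using cu by (simp add: power_zero_def numeral_3_eq_3)
  have "(\<phi> ^^ Suc 2) z = 0" "(\<phi> ^^ 2) z \<noteq> 0" using cu' z by (simp_all add: numeral_2_eq_2)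
  from chain_list[OF this]
  have chain: "distinct [z, \<phi> z, \<phi> (\<phi> z)]" "independent {z, \<phi> z, \<phi> (\<phi> z)}"
    by (simp_all add: numeral_2_eq_2 insert_commute)
  have S_iff: "u \<in> ?S \<longleftrightarrow> (\<exists>a b c. u = a *s z + b *s \<phi> z + c *s \<phi> (\<phi> z))" for u
    by (simp add: span_breakdown_eq algebra_simps)
  have S_stable: "\<phi> u \<in> ?S" if "u \<in> ?S" for u
  proof -
    obtain a b c where "u = a *s z + b *s \<phi> z + c *s \<phi> (\<phi> z)" using \<open>u \<in> ?S\<close> S_iff by blast
    then have "\<phi> u = 0 *s z + a ^ p *s \<phi> z + b ^ p *s \<phi> (\<phi> z)" by (simp add: add scale cu')
    then show ?thesis unfolding S_iff by blast
  qed
  obtain w where w: "w \<notin> ?S"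
    using independent_list_extend[OF basis, of "[z, \<phi> z, \<phi> (\<phi> z)]"] len by auto
  have basis_of: "is_basis scale [z, \<phi> z, \<phi> (\<phi> z), y]" if "y \<notin> ?S" for y
  proof (rule is_basis_of_length[OF basis])
    show "distinct [z, \<phi> z, \<phi> (\<phi> z), y]"
      using chain(1) that span_base[of z "{z, \<phi> z, \<phi> (\<phi> z)}"] span_base[of "\<phi> z" "{z, \<phi> z, \<phi> (\<phi> z)}"]
        span_base[of "\<phi> (\<phi> z)" "{z, \<phi> z, \<phi> (\<phi> z)}"] by auto
    have "set [z, \<phi> z, \<phi> (\<phi> z), y] = insert y {z, \<phi> z, \<phi> (\<phi> z)}" by auto
    then show "independent (set [z, \<phi> z, \<phi> (\<phi> z), y])"
      using chain(2) that independent_insert[of y "{z, \<phi> z, \<phi> (\<phi> z)}"] by (simp only:) presburger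
  qed (simp add: len)
  have "set [z, \<phi> z, \<phi> (\<phi> z), w] = insert w {z, \<phi> z, \<phi> (\<phi> z)}" by auto
  then have "\<phi> w \<in> span (insert w {z, \<phi> z, \<phi> (\<phi> z)})"
    using basis_of[OF w] unfolding is_basis_def by (metis UNIV_I)
  then obtain d where "\<phi> w - d *s w \<in> ?S" unfolding span_breakdown_eq[of _ w] by blast
  then have "\<phi> w \<in> ?S"
    using nilpotent_modulo_subspace[OF nil subspace_span S_stable w] by blast
  then obtain a b c where \<phi>w: "\<phi> w = a *s z + b *s \<phi> z + c *s \<phi> (\<phi> z)" using S_iff by blast
  have "\<phi> (\<phi> (a *s z + b *s \<phi> z + c *s \<phi> (\<phi> z))) = (a ^ p) ^ p *s \<phi> (\<phi> z)"
    by (simp add: add scale cu')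
  then have "(a ^ p) ^ p *s \<phi> (\<phi> z) = 0" using cu'[of w] by (simp add: \<phi>w)
  then have "a = 0" using z by simp
  obtain b' c' where "b' ^ p = b" "c' ^ p = c" using perfect by metis
  then have "\<phi> (w + - (b' *s z + c' *s \<phi> z)) = 0"
    using \<open>a = 0\<close> unfolding add minus scale \<phi>w by simp
  moreover have "w + - (b' *s z + c' *s \<phi> z) \<notin> ?S"
  proof
    assume "w + - (b' *s z + c' *s \<phi> z) \<in> ?S"
    moreover have "b' *s z + c' *s \<phi> z \<in> ?S"
      by (intro span_add span_scale span_base) auto
    ultimately have "w + - (b' *s z + c' *s \<phi> z) + (b' *s z + c' *s \<phi> z) \<in> ?S"
      by (rule span_add)
    with w show False by simp
  qed
  ultimately show thesis using that basis_of by blast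
qed

lemma normal_form_4:
  assumes nil: "p_nilpotent \<phi>" and xs: "xs = [x1, x2, x3, x4]"
  shows "\<exists>vs\<in>{[0, 0, 0, 0], [x2, 0, 0, 0], [x2, 0, x4, 0], [x2, x3, 0, 0], [x2, x3, x4, 0]}.
    has_normal_form \<phi> xs vs"
proof -
  consider "power_zero 1 \<phi>" | "power_zero 2 \<phi>" "\<not> power_zero 1 \<phi>" | "power_zero 3 \<phi>" "\<not> power_zero 2 \<phi>"
    | "\<not> power_zero 3 \<phi>" by blast
  then show ?thesis
  proof cases
    case 1
    from normal_form_zero[OF this] show ?thesis by (simp add: xs)
  next
    case 2
    then obtain z where z: "\<phi> z \<noteq> 0" by (auto simp: power_zero_def)
    note zz = square_zero_basis[OF 2(1) z]
    have sq: "\<phi> (\<phi> x) = 0" for x using 2 by (simp add: power_zero_def numeral_2_eq_2)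
    show ?thesis
    proof (cases "\<exists>w. \<phi> w \<notin> span {\<phi> z}")
      case True
      then obtain w where w: "\<phi> w \<notin> span {\<phi> z}" by blast
      have "is_basis scale [z, \<phi> z, w, \<phi> w]"
        by (rule is_basis_of_length[OF basis four_independent[OF 2(1) z w]]) (simp add: xs)
      then have "has_normal_form \<phi> xs [x2, 0, x4, 0]"
        by (rule has_normal_formI) (use sq in \<open>auto simp: xs\<close>)
      then show ?thesis by blast
    next
      case False
      then have img: "\<phi> w \<in> span {\<phi> z}" for w by blast
      obtain w where w: "\<phi> w = 0" "distinct ([z, \<phi> z] @ [w])" "independent (set ([z, \<phi> z] @ [w]))"
        by (rule extend_by_kernel[of "[z, \<phi> z]" z]) (use img zz in \<open>simp_all add: xs\<close>)
      obtain v where v: "\<phi> v = 0" "distinct (([z, \<phi> z] @ [w]) @ [v])"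
        "independent (set (([z, \<phi> z] @ [w]) @ [v]))"
        by (rule extend_by_kernel[OF _ _ img w(2,3)]) (simp_all add: xs)
      have "is_basis scale [z, \<phi> z, w, v]"
        by (rule is_basis_of_length[OF basis]) (use v in \<open>simp_all add: xs\<close>)
      then have "has_normal_form \<phi> xs [x2, 0, 0, 0]"
        by (rule has_normal_formI) (use w v sq in \<open>auto simp: xs\<close>)
      then show ?thesis by blast
    qed
  next
    case 3
    then obtain z where "\<phi> (\<phi> z) \<noteq> 0" by (auto simp: power_zero_def numeral_2_eq_2)
    from cube_zero_complement[OF nil 3(1) this] obtain w
      where w: "is_basis scale [z, \<phi> z, \<phi> (\<phi> z), w]" "\<phi> w = 0" by (auto simp: xs)
    have "has_normal_form \<phi> xs [x2, x3, 0, 0]"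
      by (rule has_normal_formI[OF w(1)])
        (use w(2) 3(1) in \<open>auto simp: xs power_zero_def numeral_3_eq_3\<close>)
    then show ?thesis by blast
  next
    case 4
    then obtain z where z: "is_basis scale [z, \<phi> z, \<phi> (\<phi> z), \<phi> (\<phi> (\<phi> z))]" "\<phi> (\<phi> (\<phi> (\<phi> z))) = 0"
      using full_chain_basis[OF nil] by (auto simp: xs numeral_3_eq_3)
    have "has_normal_form \<phi> xs [x2, x3, x4, 0]"
      by (rule has_normal_formI[OF z(1)]) (use z(2) in \<open>auto simp: xs\<close>)
    then show ?thesis by blast
  qed
qed

text \<open>This property separates the two types of square zero and rank one or two.\<close>

lemma kernel_in_image_of_two_blocks:
  assumes xs: "xs = [x1, x2, x3, x4]"
  shows "map \<phi> xs = [x2, 0, x4, 0] \<Longrightarrow> kernel_in_image \<phi>"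
    and "map \<phi> xs = [x2, 0, 0, 0] \<Longrightarrow> \<not> kernel_in_image \<phi>"
proof -
  interpret lie_algebra_basis4 scale br p x1 x2 x3 x4
    using basis by unfold_locales (simp add: xs)
  have \<phi>_expand: "\<phi> x = k1 x ^ p *s \<phi> x1 + k2 x ^ p *s \<phi> x2 + k3 x ^ p *s \<phi> x3 + k4 x ^ p *s \<phi> x4" for x
    using arg_cong[OF expand[of x], of \<phi>] by (simp only: add scale)
  show "kernel_in_image \<phi>" if "map \<phi> xs = [x2, 0, x4, 0]"
    unfolding kernel_in_image_def
  proof (intro allI impI)
    have v: "\<phi> x1 = x2" "\<phi> x2 = 0" "\<phi> x3 = x4" "\<phi> x4 = 0" using that by (simp_all add: xs)
    fix x assume "\<phi> x = 0"
    then have "k2 (\<phi> x) = 0" "k4 (\<phi> x) = 0" by simp_all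
    then have "k1 x = 0" "k3 x = 0" by (simp_all add: \<phi>_expand[of x] v)
    obtain a b where "a ^ p = k2 x" "b ^ p = k4 x" using perfect by metis
    then have "x = \<phi> (a *s x1 + b *s x3)"
      using \<open>k1 x = 0\<close> \<open>k3 x = 0\<close> by (simp add: k_eq_iff add scale v)
    then show "\<exists>y. x = \<phi> y" ..
  qed
  show "\<not> kernel_in_image \<phi>" if "map \<phi> xs = [x2, 0, 0, 0]"
  proof
    have v: "\<phi> x1 = x2" "\<phi> x2 = 0" "\<phi> x3 = 0" "\<phi> x4 = 0" using that by (simp_all add: xs)
    assume "kernel_in_image \<phi>"
    with v obtain y where "x3 = \<phi> y" by (auto simp: kernel_in_image_def)
    from arg_cong[OF this, of k3] show False by (simp add: \<phi>_expand[of y] v)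
  qed
qed

end

theorem classification_1:
  assumes xs: "xs = [x1]"
  shows "nilpotent_p_maps_listed scale br xs [{[0]}]"
proof (rule nilpotent_p_maps_listedI[OF basis, of "\<lambda>_. ()" "[()]"])
  fix \<phi> assume "p_map scale br \<phi>" "p_nilpotent \<phi>"
  then show "\<exists>I\<in>set [{[0]}]. \<exists>vs\<in>I. has_normal_form \<phi> xs vs"
    using normal_form_zero[of \<phi>] power_zero_length[of \<phi>] by (simp add: xs)
next
  have "p_nilpotent \<phi>" if "p_map_with_values scale br xs [0] \<phi>" for \<phi>
    using that power_zero_iff[of \<phi> 1] power_zero_nilpotent[of \<phi> 1] by (simp add: p_map_with_values_def xs)
  then show "list_all2 (\<lambda>I k. \<forall>vs\<in>I. \<forall>\<phi>. p_map_with_values scale br xs vs \<phi> \<longrightarrow> p_nilpotent \<phi> \<and> () = k)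
      [{[0]}] [()]" by simp
qed (simp add: equivalence_invariant_def, simp, rule p_map_exists, auto simp: xs)

theorem classification_2:
  assumes xs: "xs = [x1, x2]"
  shows "nilpotent_p_maps_listed scale br xs [{[0, 0]}, {[x2, 0]}]"
proof (rule nilpotent_p_maps_listedI[OF basis power_zero_invariant[of 1], of "[True, False]"])
  fix \<phi> assume "p_map scale br \<phi>" "p_nilpotent \<phi>"
  then show "\<exists>I\<in>set [{[0, 0]}, {[x2, 0]}]. \<exists>vs\<in>I. has_normal_form \<phi> xs vs"
    using normal_form_2[of \<phi>] by (auto simp: xs)
next
  have "x2 \<noteq> 0" using basis dependent_zero by (auto simp: xs is_basis_def)
  then have "p_nilpotent \<phi> \<and> power_zero 1 \<phi> = (vs = [0, 0])"
    if "p_map_with_values scale br xs vs \<phi>" "vs \<in> {[0, 0], [x2, 0]}" for \<phi> vs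
    using that power_zero_iff[of \<phi> 1] power_zero_iff[of \<phi> 2] power_zero_nilpotent[of \<phi> 2] zero[of \<phi>]
    by (auto simp: p_map_with_values_def xs numeral_2_eq_2)
  then show "list_all2 (\<lambda>I k. \<forall>vs\<in>I. \<forall>\<phi>. p_map_with_values scale br xs vs \<phi> \<longrightarrow>
      p_nilpotent \<phi> \<and> power_zero 1 \<phi> = k) [{[0, 0]}, {[x2, 0]}] [True, False]"
    using \<open>x2 \<noteq> 0\<close> by simp
qed (simp, rule p_map_exists, auto simp: xs)

theorem classification_3:
  assumes xs: "xs = [x1, x2, x3]"
  shows "nilpotent_p_maps_listed scale br xs [{[0, 0, 0]}, {[x2, 0, 0]}, {[x2, x3, 0]}]"
proof (rule nilpotent_p_maps_listedI[OF basis, of "\<lambda>\<phi>. [power_zero 1 \<phi>, power_zero 2 \<phi>]"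
      "[[True, True], [False, True], [False, False]]"])
  show "equivalence_invariant (\<lambda>\<phi>. [power_zero 1 \<phi>, power_zero 2 \<phi>])"
    by (intro invariant_Cons invariant_Nil invariants)
  fix \<phi> assume "p_map scale br \<phi>" "p_nilpotent \<phi>"
  then show "\<exists>I\<in>set [{[0, 0, 0]}, {[x2, 0, 0]}, {[x2, x3, 0]}]. \<exists>vs\<in>I. has_normal_form \<phi> xs vs"
    using normal_form_3[of \<phi>] by (auto simp: xs)
next
  have nz: "x2 \<noteq> 0" "x3 \<noteq> 0" using basis dependent_zero by (auto simp: xs is_basis_def)
  have "p_nilpotent \<phi> \<and> power_zero 1 \<phi> = (vs = [0, 0, 0]) \<and> power_zero 2 \<phi> = (vs \<noteq> [x2, x3, 0])"
    if "p_map_with_values scale br xs vs \<phi>" "vs \<in> {[0, 0, 0], [x2, 0, 0], [x2, x3, 0]}" for \<phi> vs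
    using that nz power_zero_iff[of \<phi> 1] power_zero_iff[of \<phi> 2] power_zero_iff[of \<phi> 3]
      power_zero_nilpotent[of \<phi> 3] zero[of \<phi>]
    by (auto simp: p_map_with_values_def xs numeral_2_eq_2 numeral_3_eq_3)
  then show "list_all2 (\<lambda>I k. \<forall>vs\<in>I. \<forall>\<phi>. p_map_with_values scale br xs vs \<phi> \<longrightarrow>
      p_nilpotent \<phi> \<and> [power_zero 1 \<phi>, power_zero 2 \<phi>] = k)
      [{[0, 0, 0]}, {[x2, 0, 0]}, {[x2, x3, 0]}] [[True, True], [False, True], [False, False]]"
    using nz by simp
qed (simp, rule p_map_exists, auto simp: xs)

theorem classification_4:
  assumes xs: "xs = [x1, x2, x3, x4]"
  shows "nilpotent_p_maps_listed scale br xs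
    [{[0, 0, 0, 0]}, {[x2, 0, 0, 0]}, {[x2, 0, x4, 0]}, {[x2, x3, 0, 0]}, {[x2, x3, x4, 0]}]"
    (is "nilpotent_p_maps_listed _ _ _ ?items")
proof (rule nilpotent_p_maps_listedI[OF basis, of
      "\<lambda>\<phi>. [power_zero 1 \<phi>, power_zero 2 \<phi>, power_zero 3 \<phi>, \<not> power_zero 1 \<phi> \<and> power_zero 2 \<phi> \<and> kernel_in_image \<phi>]"
      "[[True, True, True, False], [False, True, True, False], [False, True, True, True],
        [False, False, True, False], [False, False, False, False]]"])
  show "equivalence_invariant (\<lambda>\<phi>. [power_zero 1 \<phi>, power_zero 2 \<phi>, power_zero 3 \<phi>,
      \<not> power_zero 1 \<phi> \<and> power_zero 2 \<phi> \<and> kernel_in_image \<phi>])"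
    using power_zero_invariant[of 1] power_zero_invariant[of 2] kernel_in_image_invariant
    by (intro invariant_Cons invariant_Nil invariants) (simp add: equivalence_invariant_def)
  fix \<phi> assume "p_map scale br \<phi>" "p_nilpotent \<phi>"
  then show "\<exists>I\<in>set ?items. \<exists>vs\<in>I. has_normal_form \<phi> xs vs"
    using normal_form_4[of \<phi>] by (auto simp: xs)
next
  have nz: "x2 \<noteq> 0" "x3 \<noteq> 0" "x4 \<noteq> 0" using basis dependent_zero by (auto simp: xs is_basis_def)
  have "p_nilpotent \<phi> \<and> power_zero 1 \<phi> = (vs = [0, 0, 0, 0]) \<and>
      power_zero 2 \<phi> = (vs \<in> {[0, 0, 0, 0], [x2, 0, 0, 0], [x2, 0, x4, 0]}) \<and>
      power_zero 3 \<phi> = (vs \<noteq> [x2, x3, x4, 0]) \<and>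
      (vs = [x2, 0, x4, 0] \<longrightarrow> kernel_in_image \<phi>) \<and> (vs = [x2, 0, 0, 0] \<longrightarrow> \<not> kernel_in_image \<phi>)"
    if \<phi>: "p_map_with_values scale br xs vs \<phi>"
      and vs: "vs \<in> {[0, 0, 0, 0], [x2, 0, 0, 0], [x2, 0, x4, 0], [x2, x3, 0, 0], [x2, x3, x4, 0]}" for \<phi> vs
  proof -
    have pm: "p_map scale br \<phi>" and v: "map \<phi> xs = vs" using \<phi> by (simp_all add: p_map_with_values_def)
    have "power_zero 4 \<phi>" and pz: "power_zero 1 \<phi> = (vs = [0, 0, 0, 0])"
      "power_zero 2 \<phi> = (vs \<in> {[0, 0, 0, 0], [x2, 0, 0, 0], [x2, 0, x4, 0]})"
      "power_zero 3 \<phi> = (vs \<noteq> [x2, x3, x4, 0])"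
      using v vs nz zero[OF pm] unfolding power_zero_iff[OF pm]
      by (auto simp: xs numeral_2_eq_2 numeral_3_eq_3 numeral_eq_Suc[of "num.Bit0 (num.Bit0 num.One)"])
    moreover have "p_nilpotent \<phi>"
      using \<open>power_zero 4 \<phi>\<close> by (rule power_zero_nilpotent[OF pm])
    ultimately show ?thesis
      using kernel_in_image_of_two_blocks[OF pm xs] v by simp
  qed
  then show "list_all2 (\<lambda>I k. \<forall>vs\<in>I. \<forall>\<phi>. p_map_with_values scale br xs vs \<phi> \<longrightarrow> p_nilpotent \<phi> \<and>
      [power_zero 1 \<phi>, power_zero 2 \<phi>, power_zero 3 \<phi>, \<not> power_zero 1 \<phi> \<and> power_zero 2 \<phi> \<and> kernel_in_image \<phi>] = k)
      ?items [[True, True, True, False], [False, True, True, False], [False, True, True, True],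
        [False, False, True, False], [False, False, False, False]]"
    using nz by simp
qed (simp, rule p_map_exists, auto simp: xs)

end

section \<open>The classification\<close>

context perfect_lie_algebra
begin

lemma abelian_presentation:
  assumes "has_presentation scale br xs []"
  shows "abelian_lie_algebra scale br p xs"
proof unfold_locales
  show "is_basis scale xs" using assms by (simp add: has_presentation_def)
  then show "br x y = 0" for x y
    using assms by - (rule br_zero_of_basis[of xs], simp_all add: has_presentation_def)
qed

lemma heisenberg3_presentation:
  assumes "has_presentation scale br [x1, x2, x3] [((x1, x2), x3)]"
  shows "heisenberg3 scale br p x1 x2 x3"
proof -
  have basis: "is_basis scale [x1, x2, x3]"
    and br: "\<And>i j. i < j \<Longrightarrow> j < 3 \<Longrightarrow> br ([x1, x2, x3] ! i) ([x1, x2, x3] ! j) =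
      (case map_of [((x1, x2), x3)] ([x1, x2, x3] ! i, [x1, x2, x3] ! j) of None \<Rightarrow> 0 | Some z \<Rightarrow> z)"
    using assms by (simp_all add: has_presentation_def)
  have "distinct [x1, x2, x3]" using basis by (simp add: is_basis_def)
  with basis br[of 0 1] br[of 0 2] br[of 1 2] show ?thesis
    by unfold_locales (auto simp: numeral_2_eq_2)
qed

lemma heisenberg4_presentation:
  assumes "has_presentation scale br [x1, x2, x3, x4] [((x1, x2), x3)]"
  shows "heisenberg4 scale br p x1 x2 x3 x4"
proof -
  have basis: "is_basis scale [x1, x2, x3, x4]"
    and br: "\<And>i j. i < j \<Longrightarrow> j < 4 \<Longrightarrow> br ([x1, x2, x3, x4] ! i) ([x1, x2, x3, x4] ! j) =
      (case map_of [((x1, x2), x3)] ([x1, x2, x3, x4] ! i, [x1, x2, x3, x4] ! j) of None \<Rightarrow> 0 | Some z \<Rightarrow> z)"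
    using assms by (simp_all add: has_presentation_def)
  have "distinct [x1, x2, x3, x4]" using basis by (simp add: is_basis_def)
  with basis br[of 0 1] br[of 0 2] br[of 0 3] br[of 1 2] br[of 1 3] br[of 2 3] show ?thesis
    by unfold_locales (auto simp: numeral_2_eq_2 numeral_3_eq_3)
qed

lemma filiform4_presentation:
  assumes "has_presentation scale br [x1, x2, x3, x4] [((x1, x2), x3), ((x1, x3), x4)]"
  shows "filiform4 scale br p x1 x2 x3 x4"
proof -
  have basis: "is_basis scale [x1, x2, x3, x4]"
    and br: "\<And>i j. i < j \<Longrightarrow> j < 4 \<Longrightarrow> br ([x1, x2, x3, x4] ! i) ([x1, x2, x3, x4] ! j) =
      (case map_of [((x1, x2), x3), ((x1, x3), x4)] ([x1, x2, x3, x4] ! i, [x1, x2, x3, x4] ! j)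
        of None \<Rightarrow> 0 | Some z \<Rightarrow> z)"
    using assms by (simp_all add: has_presentation_def)
  have "distinct [x1, x2, x3, x4]" using basis by (simp add: is_basis_def)
  with basis br[of 0 1] br[of 0 2] br[of 0 3] br[of 1 2] br[of 1 3] br[of 2 3] show ?thesis
    by unfold_locales (auto simp: numeral_2_eq_2 numeral_3_eq_3)
qed

end

theorem theorem2p1:
  fixes scale :: "'f::field \<Rightarrow> 'l::ab_group_add \<Rightarrow> 'l" (infixr "*s" 75)
    and br :: "'l \<Rightarrow> 'l \<Rightarrow> 'l"
    and x1 x2 x3 x4 :: 'l
    and p :: nat
  assumes "lie_algebra scale br"
    and "p = CHAR('f)" and "p > 0"
    and perfect: "\<forall>a::'f. \<exists>b. b ^ p = a"
  shows
    "(has_presentation scale br [x1] [] \<longrightarrow>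
       nilpotent_p_maps_listed scale br [x1]
         [{[0]}]) \<and>
     (has_presentation scale br [x1, x2] [] \<longrightarrow>
       nilpotent_p_maps_listed scale br [x1, x2]
         [{[0, 0]},
          {[x2, 0]}]) \<and>
     (has_presentation scale br [x1, x2, x3] [] \<longrightarrow>
       nilpotent_p_maps_listed scale br [x1, x2, x3]
         [{[0, 0, 0]},
          {[x2, 0, 0]},
          {[x2, x3, 0]}]) \<and>
     (has_presentation scale br [x1, x2, x3] [((x1, x2), x3)] \<longrightarrow>
       (p \<ge> 3 \<longrightarrow>
          nilpotent_p_maps_listed scale br [x1, x2, x3]
            [{[0, 0, 0]},
             {[x3, 0, 0]}]) \<and>
       (p = 2 \<longrightarrow>
          nilpotent_p_maps_listed scale br [x1, x2, x3]
            [{[x3, \<xi> *s x3, 0] | \<xi>. True}] \<and>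
          (\<forall>\<xi>1 \<xi>2.
             equivalent_values scale br [x1, x2, x3]
               [x3, \<xi>1 *s x3, 0] [x3, \<xi>2 *s x3, 0]
             \<longleftrightarrow> \<xi>1 + \<xi>2 \<in> artin_schreier))) \<and>
     (has_presentation scale br [x1, x2, x3, x4] [] \<longrightarrow>
       nilpotent_p_maps_listed scale br [x1, x2, x3, x4]
         [{[0, 0, 0, 0]},
          {[x2, 0, 0, 0]},
          {[x2, 0, x4, 0]},
          {[x2, x3, 0, 0]},
          {[x2, x3, x4, 0]}]) \<and>
     (has_presentation scale br [x1, x2, x3, x4] [((x1, x2), x3)] \<longrightarrow>
       (p \<ge> 3 \<longrightarrow>
          nilpotent_p_maps_listed scale br [x1, x2, x3, x4]
            [{[0, 0, 0, 0]},
             {[x3, 0, 0, 0]},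
             {[x4, 0, 0, 0]},
             {[x3, x4, 0, 0]},
             {[0, 0, x4, 0]},
             {[0, x3, x4, 0]},
             {[0, 0, 0, x3]},
             {[0, x4, 0, x3]}]) \<and>
       (p = 2 \<longrightarrow>
          nilpotent_p_maps_listed scale br [x1, x2, x3, x4]
            [{[x3, \<xi> *s x3, 0, 0] | \<xi>. True},
             {[x4, 0, 0, 0]},
             {[x3, x4, 0, 0]},
             {[x3, \<xi> *s x3, x4, 0] | \<xi>. True},
             {[0, 0, 0, x3]},
             {[0, x4, 0, x3]}] \<and>
          (\<forall>\<xi>1 \<xi>2.
             equivalent_values scale br [x1, x2, x3, x4]
               [x3, \<xi>1 *s x3, 0, 0] [x3, \<xi>2 *s x3, 0, 0]
             \<longleftrightarrow> \<xi>1 + \<xi>2 \<in> artin_schreier) \<and>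
          (\<forall>\<xi>1 \<xi>2.
             equivalent_values scale br [x1, x2, x3, x4]
               [x3, \<xi>1 *s x3, x4, 0] [x3, \<xi>2 *s x3, x4, 0]
             \<longleftrightarrow> \<xi>1 + \<xi>2 \<in> artin_schreier))) \<and>
     (has_presentation scale br [x1, x2, x3, x4] [((x1, x2), x3), ((x1, x3), x4)] \<longrightarrow>
       (p \<ge> 5 \<longrightarrow>
          nilpotent_p_maps_listed scale br [x1, x2, x3, x4]
            [{[0, 0, 0, 0]},
             {[x4, 0, 0, 0]},
             {[0, \<xi> *s x4, 0, 0] | \<xi>. \<xi> \<noteq> 0},
             {[0, 0, x4, 0]}] \<and>
          (\<forall>\<xi>1 \<xi>2. \<xi>1 \<noteq> 0 \<and> \<xi>2 \<noteq> 0 \<longrightarrow>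
             (equivalent_values scale br [x1, x2, x3, x4]
               [0, \<xi>1 *s x4, 0, 0] [0, \<xi>2 *s x4, 0, 0]
             \<longleftrightarrow> is_square (\<xi>1 * inverse \<xi>2)))) \<and>
       (p = 3 \<longrightarrow>
          nilpotent_p_maps_listed scale br [x1, x2, x3, x4]
            [{[0, 0, 0, 0]},
             {[0, 0, x4, 0]},
             {[\<alpha> *s x4, \<beta> *s x4, 0, 0] | \<alpha> \<beta>. \<beta> \<noteq> 0}] \<and>
          (\<forall>\<alpha>1 \<beta>1 \<alpha>2 \<beta>2. \<beta>1 \<noteq> 0 \<and> \<beta>2 \<noteq> 0 \<longrightarrow>
             (equivalent_values scale br [x1, x2, x3, x4]
               [\<alpha>1 *s x4, \<beta>1 *s x4, 0, 0] [\<alpha>2 *s x4, \<beta>2 *s x4, 0, 0]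
             \<longleftrightarrow> (\<exists>r. r\<^sup>2 = \<beta>2 / \<beta>1 \<and>
                 (\<alpha>1 + \<alpha>2 * r \<in> K_set \<beta>1 \<or> \<alpha>1 - \<alpha>2 * r \<in> K_set \<beta>1))))) \<and>
       (p = 2 \<longrightarrow> \<not> restrictable scale br))"
proof -
  interpret lie_algebra scale br by fact
  interpret perfect_lie_algebra scale br p
    using assms by unfold_locales auto
  have odd: "p \<noteq> 2" if "p \<ge> 3" using that by simp
  have ge_5: "p \<noteq> 2 \<and> p \<noteq> 3" if "p \<ge> 5" using that by simp
  show ?thesis
  proof (intro conjI impI allI)
    assume "has_presentation scale br [x1] []"
    then interpret abelian_lie_algebra scale br p "[x1]" by (rule abelian_presentation)
    show "nilpotent_p_maps_listed scale br [x1] [{[0]}]" by (rule classification_1) simp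
  next
    assume "has_presentation scale br [x1, x2] []"
    then interpret abelian_lie_algebra scale br p "[x1, x2]" by (rule abelian_presentation)
    show "nilpotent_p_maps_listed scale br [x1, x2] [{[0, 0]}, {[x2, 0]}]"
      by (rule classification_2) simp
  next
    assume "has_presentation scale br [x1, x2, x3] []"
    then interpret abelian_lie_algebra scale br p "[x1, x2, x3]" by (rule abelian_presentation)
    show "nilpotent_p_maps_listed scale br [x1, x2, x3] [{[0, 0, 0]}, {[x2, 0, 0]}, {[x2, x3, 0]}]"
      by (rule classification_3) simp
  next
    assume "has_presentation scale br [x1, x2, x3, x4] []"
    then interpret abelian_lie_algebra scale br p "[x1, x2, x3, x4]" by (rule abelian_presentation)
    show "nilpotent_p_maps_listed scale br [x1, x2, x3, x4]
      [{[0, 0, 0, 0]}, {[x2, 0, 0, 0]}, {[x2, 0, x4, 0]}, {[x2, x3, 0, 0]}, {[x2, x3, x4, 0]}]"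
      by (rule classification_4) simp
  next
    assume pres: "has_presentation scale br [x1, x2, x3] [((x1, x2), x3)]"
    interpret heisenberg3 scale br p x1 x2 x3 using pres by (rule heisenberg3_presentation)
    show "nilpotent_p_maps_listed scale br [x1, x2, x3] [{[0, 0, 0]}, {[x3, 0, 0]}]" if "p \<ge> 3"
      using odd[OF that] by (rule classification_odd)
    assume p: "p = 2"
    show "nilpotent_p_maps_listed scale br [x1, x2, x3] [{[x3, \<xi> *s x3, 0] | \<xi>. True}]"
      using p by (rule classification_2)
    show "equivalent_values scale br [x1, x2, x3] [x3, \<xi>1 *s x3, 0] [x3, \<xi>2 *s x3, 0]
        \<longleftrightarrow> \<xi>1 + \<xi>2 \<in> artin_schreier" for \<xi>1 \<xi>2
      using p by (rule family_iff_artin_schreier)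
  next
    assume pres: "has_presentation scale br [x1, x2, x3, x4] [((x1, x2), x3)]"
    interpret heisenberg4 scale br p x1 x2 x3 x4 using pres by (rule heisenberg4_presentation)
    show "nilpotent_p_maps_listed scale br [x1, x2, x3, x4]
        [{[0, 0, 0, 0]}, {[x3, 0, 0, 0]}, {[x4, 0, 0, 0]}, {[x3, x4, 0, 0]},
         {[0, 0, x4, 0]}, {[0, x3, x4, 0]}, {[0, 0, 0, x3]}, {[0, x4, 0, x3]}]" if "p \<ge> 3"
      using odd[OF that] by (rule classification_odd)
    assume p: "p = 2"
    show "nilpotent_p_maps_listed scale br [x1, x2, x3, x4]
        [{[x3, \<xi> *s x3, 0, 0] | \<xi>. True}, {[x4, 0, 0, 0]}, {[x3, x4, 0, 0]},
         {[x3, \<xi> *s x3, x4, 0] | \<xi>. True}, {[0, 0, 0, x3]}, {[0, x4, 0, x3]}]"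
      using p by (rule classification_2)
    show "equivalent_values scale br [x1, x2, x3, x4] [x3, \<xi>1 *s x3, 0, 0] [x3, \<xi>2 *s x3, 0, 0]
        \<longleftrightarrow> \<xi>1 + \<xi>2 \<in> artin_schreier" for \<xi>1 \<xi>2
      using family_iff_artin_schreier[OF p, of \<xi>1 0 \<xi>2] by simp
    show "equivalent_values scale br [x1, x2, x3, x4] [x3, \<xi>1 *s x3, x4, 0] [x3, \<xi>2 *s x3, x4, 0]
        \<longleftrightarrow> \<xi>1 + \<xi>2 \<in> artin_schreier" for \<xi>1 \<xi>2
      using family_iff_artin_schreier[OF p, of \<xi>1 1 \<xi>2] by simp
  next
    assume pres: "has_presentation scale br [x1, x2, x3, x4] [((x1, x2), x3), ((x1, x3), x4)]"
    interpret filiform4 scale br p x1 x2 x3 x4 using pres by (rule filiform4_presentation)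
    {
      assume "p \<ge> 5"
      then have p: "p \<noteq> 2" "p \<noteq> 3" using ge_5 by auto
      show "nilpotent_p_maps_listed scale br [x1, x2, x3, x4]
          [{[0, 0, 0, 0]}, {[x4, 0, 0, 0]}, {[0, \<xi> *s x4, 0, 0] | \<xi>. \<xi> \<noteq> 0}, {[0, 0, x4, 0]}]"
        using p by (rule classification_ge_5)
      show "equivalent_values scale br [x1, x2, x3, x4] [0, \<xi>1 *s x4, 0, 0] [0, \<xi>2 *s x4, 0, 0]
          \<longleftrightarrow> is_square (\<xi>1 * inverse \<xi>2)" if "\<xi>1 \<noteq> 0 \<and> \<xi>2 \<noteq> 0" for \<xi>1 \<xi>2
        using that by (intro family_iff_square[OF p]) auto
    next
      assume p: "p = 3"
      show "nilpotent_p_maps_listed scale br [x1, x2, x3, x4]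
          [{[0, 0, 0, 0]}, {[0, 0, x4, 0]}, {[\<alpha> *s x4, \<beta> *s x4, 0, 0] | \<alpha> \<beta>. \<beta> \<noteq> 0}]"
        using p by (rule classification_3)
      show "equivalent_values scale br [x1, x2, x3, x4]
            [\<alpha>1 *s x4, \<beta>1 *s x4, 0, 0] [\<alpha>2 *s x4, \<beta>2 *s x4, 0, 0]
          \<longleftrightarrow> (\<exists>r. r\<^sup>2 = \<beta>2 / \<beta>1 \<and>
              (\<alpha>1 + \<alpha>2 * r \<in> K_set \<beta>1 \<or> \<alpha>1 - \<alpha>2 * r \<in> K_set \<beta>1))"
        if "\<beta>1 \<noteq> 0 \<and> \<beta>2 \<noteq> 0" for \<alpha>1 \<beta>1 \<alpha>2 \<beta>2
        using that by (intro family_iff_K_set[OF p]) auto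
    next
      assume "p = 2"
      then show "\<not> restrictable scale br" by (rule not_restrictable_2)
    }
  qed
qed

end
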